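(* Let $M$ be a complete connected Riemannian manifold. Consider on $M$ the stochastic differential equation $dx_t=X(x_t)\circ dB_t+A(x_t)\,dt$ with coefficients $X,A$ of class $C^2$, and suppose there is a point $\bar x\in M$ with $\xi(\bar x)=\infty$ almost surely. Suppose that $$\liminf_{j\to\infty}\ \sup_{x\in K} E\left(|T_xF_{S_j^K}|\,\chi_{\{S_j^K<t\}}\right)<\infty$$ for every compact set $K\in K_1^1$ and every $t>0$. Then $\xi^H=\infty$ almost surely for all $H\in K_1^1$. In particular the equation is strongly $1$-complete, and it is strongly complete if $\dim M\le 2$.
   Context: $\{\Omega,\mathcal F,\mathcal F_t,P\}$ is a filtered probability space satisfying the usual conditions, $B_t$ is an $\mathbb R^m$-valued Brownian motion, $X(x):\mathbb R^m\to T_xM$ is linear for each $x\in M$, $A$ is a vector field, and $\circ$ denotes the Stratonovich integral. $F_t(x)$ is the maximal solution starting from $x$, with explosion time $\xi(x)$; $(F_t(\cdot),\xi(\cdot))$ is the partial flow, i.e. the version for which, almost surely, for each $t$ the set $\{x:t<\xi(x,\omega)\}$ is open, $F_t(\cdot,\omega)$ is a $C^{1}$ diffeomorphism of this set onto an open subset of $M$ depending continuously on $t$ (in the topology of $C^1$ convergence on compacta), and, for $K$ compact and $\xi^K:=\inf_{x\in K}\xi(x)$, $\lim_{t\nearrow \xi^K}\sup_{x\in K}d(x_0,F_t(x))=\infty$ a.s. on $\{\xi^K<\infty\}$ (for any complete metric $d$ and fixed $x_0$). $T_xF_t:T_xM\to T_{F_t(x)}M$ is the derivative of $F_t$ at $x$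 (the derivative flow); $v_t=T_xF_t(v)$ solves the covariant equation $Dv_t=\nabla X(v_t)\circ dB_t+\nabla A(v_t)\,dt$, $v_0=v$. $K_1^1=\{\mathrm{Image}(\sigma): \sigma:[0,\ell]\to M \text{ is } C^1,\ \ell<\infty\}$. Stopping times: fix a sequence of nested relatively compact open sets $U_i$ covering $M$ with $\bar U_i\subset U_{i+1}$, and smooth cut-off functions $\lambda^i$ with $\lambda^i=1$ on $U_{i+1}$ and $\lambda^i=0$ off $U_{i+2}$. Let $F^i_\cdot$ be the (globally defined) solution flow of the equation with coefficients $\lambda^iX,\lambda^iA$, let $S_i(x)$ be the first exit time of $F^i_t(x)$ from $\bar U_i$, and $S_i^K=\inf_{x\in K}S_i(x)$. (Then $F^i_t(x)=F_t(x)$ before $S_i^K$ for $x\in K$, and $S_i^K\nearrow\xi^K$.) The equation is strongly $p$-complete if $\xi^K=\infty$ a.s. for every $K$ that is the image of a smooth singular $p$-simplex (smooth meaning that it extends smoothly over an open neighbourhood of the standard simplex). It is strongly complete if there is a version of the solution which is jointly continuous in time and space for all time (equivalently it is strongly $n$-complete with $n=\dim M$). *)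

theory Defs
  imports "HOL-Probability.Probability"
begin

section \<open>Manifolds\<close>

text \<open>
  The manifold is a whole type \<open>'a\<close> (Hausdorff, second countable), modelled on a Euclidean
  space \<open>'e\<close>, so its dimension is \<open>DIM('e)\<close>. A chart is a pair of a domain and a coordinate
  map; values of the coordinate map outside the domain are irrelevant.
\<close>

type_synonym ('a, 'e) chart = "'a set \<times> ('a \<Rightarrow> 'e)"

definition chart_inv :: "('a, 'e) chart \<Rightarrow> 'e \<Rightarrow> 'a" where
  "chart_inv c = inv_into (fst c) (snd c)"

definition chart_at :: "('a, 'e) chart set \<Rightarrow> 'a \<Rightarrow> ('a, 'e) chart" where
  "chart_at \<A> x = (SOME c. c \<in> \<A> \<and> x \<in> fst c)"

text \<open>
  \<open>C_on k f S\<close> says that \<open>f\<close> is of class \<open>C\<^sup>k\<close> on \<open>S\<close>; it is meant for open \<open>S\<close> only.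
\<close>

primrec C_on :: "nat \<Rightarrow> ('p::euclidean_space \<Rightarrow> 'q::real_normed_vector) \<Rightarrow> 'p set \<Rightarrow> bool" where
  "C_on 0 f S \<longleftrightarrow> continuous_on S f"
| "C_on (Suc k) f S \<longleftrightarrow>
     (\<forall>x\<in>S. f differentiable at x) \<and>
     (\<forall>v. C_on k (\<lambda>x. frechet_derivative f (at x) v) S)"

definition smooth_on :: "('p::euclidean_space \<Rightarrow> 'q::real_normed_vector) \<Rightarrow> 'p set \<Rightarrow> bool" where
  "smooth_on f S \<longleftrightarrow> (\<forall>k. C_on k f S)"

definition smooth_atlas ::
  "('a::{t2_space,second_countable_topology}, 'e::euclidean_space) chart set \<Rightarrow> bool" where
  "smooth_atlas \<A> \<longleftrightarrow>
     (\<forall>c\<in>\<A>. open (fst c) \<and> open (snd c ` fst c) \<and>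
        homeomorphism (fst c) (snd c ` fst c) (snd c) (chart_inv c)) \<and>
     (\<Union>c\<in>\<A>. fst c) = UNIV \<and>
     (\<forall>c\<in>\<A>. \<forall>d\<in>\<A>. smooth_on (snd d \<circ> chart_inv c) (snd c ` (fst c \<inter> fst d)))"

text \<open>
  A tangent vector at \<open>x\<close> is the family of its coordinate vectors, one for every chart around
  \<open>x\<close>, related by the derivatives of the changes of coordinates. The other entries are set
  to zero so that equal tangent vectors are equal as functions. The linear structure is the
  pointwise one.
\<close>

type_synonym ('a, 'e) tvec = "('a, 'e) chart \<Rightarrow> 'e"

definition tangent_space ::
  "('a, 'e::euclidean_space) chart set \<Rightarrow> 'a \<Rightarrow> ('a, 'e) tvec set" where
  "tangent_space \<A> x =
     {v. (\<forall>c\<in>\<A>. \<forall>d\<in>\<A>. x \<in> fst c \<and> x \<in> fst d \<longrightarrow>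
            v d = frechet_derivative (snd d \<circ> chart_inv c) (at (snd c x)) (v c)) \<and>
         (\<forall>c. \<not> (c \<in> \<A> \<and> x \<in> fst c) \<longrightarrow> v c = 0)}"

text \<open>The tangent vector at \<open>x\<close> whose coordinate vector in the chart \<open>c\<close> is \<open>u\<close>.\<close>

definition coord_tvec ::
  "('a, 'e::euclidean_space) chart set \<Rightarrow> ('a, 'e) chart \<Rightarrow> 'a \<Rightarrow> 'e \<Rightarrow> ('a, 'e) tvec" where
  "coord_tvec \<A> c x u =
     (\<lambda>d. if d \<in> \<A> \<and> x \<in> fst d
          then frechet_derivative (snd d \<circ> chart_inv c) (at (snd c x)) u else 0)"

text \<open>The differential of a scalar function, and the tangent map of a self-map of the manifold.\<close>

definition scalar_diff ::
  "('a, 'e::euclidean_space) chart set \<Rightarrow> ('a \<Rightarrow> real) \<Rightarrow> 'a \<Rightarrow> ('a, 'e) tvec \<Rightarrow> real" where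
  "scalar_diff \<A> f x v =
     (let c = chart_at \<A> x in frechet_derivative (f \<circ> chart_inv c) (at (snd c x)) (v c))"

definition tangent_map ::
  "('a, 'e::euclidean_space) chart set \<Rightarrow> ('a \<Rightarrow> 'a) \<Rightarrow> 'a \<Rightarrow> ('a, 'e) tvec \<Rightarrow> ('a, 'e) tvec" where
  "tangent_map \<A> f x v =
     (let c = chart_at \<A> x in
      (\<lambda>d. if d \<in> \<A> \<and> f x \<in> fst d
           then frechet_derivative (snd d \<circ> f \<circ> chart_inv c) (at (snd c x)) (v c) else 0))"

definition smooth_scalar :: "('a, 'e::euclidean_space) chart set \<Rightarrow> ('a \<Rightarrow> real) \<Rightarrow> bool" where
  "smooth_scalar \<A> f \<longleftrightarrow> (\<forall>c\<in>\<A>. smooth_on (f \<circ> chart_inv c) (snd c ` fst c))"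

definition test_function ::
  "('a::topological_space, 'e::euclidean_space) chart set \<Rightarrow> ('a \<Rightarrow> real) \<Rightarrow> bool" where
  "test_function \<A> f \<longleftrightarrow> smooth_scalar \<A> f \<and> (\<exists>C. compact C \<and> (\<forall>x. x \<notin> C \<longrightarrow> f x = 0))"

definition C1_map_on ::
  "('a::topological_space, 'e::euclidean_space) chart set \<Rightarrow> 'a set \<Rightarrow> ('a \<Rightarrow> 'a) \<Rightarrow> bool" where
  "C1_map_on \<A> S f \<longleftrightarrow> continuous_on S f \<and>
     (\<forall>c\<in>\<A>. \<forall>d\<in>\<A>. C_on 1 (snd d \<circ> f \<circ> chart_inv c) (snd c ` (S \<inter> fst c \<inter> f -` fst d)))"

definition C1_diffeo_on ::
  "('a::topological_space, 'e::euclidean_space) chart set \<Rightarrow> 'a set \<Rightarrow> ('a \<Rightarrow> 'a) \<Rightarrow> bool" where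
  "C1_diffeo_on \<A> S f \<longleftrightarrow> open S \<and> open (f ` S) \<and> inj_on f S \<and>
     C1_map_on \<A> S f \<and> C1_map_on \<A> (f ` S) (inv_into S f)"

definition C2_vector_field ::
  "('a, 'e::euclidean_space) chart set \<Rightarrow> ('a \<Rightarrow> ('a, 'e) tvec) \<Rightarrow> bool" where
  "C2_vector_field \<A> V \<longleftrightarrow> (\<forall>x. V x \<in> tangent_space \<A> x) \<and>
     (\<forall>c\<in>\<A>. C_on 2 (\<lambda>y. V (chart_inv c y) c) (snd c ` fst c))"

text \<open>
  \<open>X x\<close> is a linear map into the tangent space at \<open>x\<close>; linearity is componentwise because the
  linear structure of tangent vectors is.
\<close>

definition C2_diffusion_coeff ::
  "('a, 'e::euclidean_space) chart set \<Rightarrow> ('a \<Rightarrow> 'b::euclidean_space \<Rightarrow> ('a, 'e) tvec) \<Rightarrow> bool" where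
  "C2_diffusion_coeff \<A> X \<longleftrightarrow> (\<forall>x c. linear (\<lambda>u. X x u c)) \<and>
     (\<forall>u. C2_vector_field \<A> (\<lambda>x. X x u))"


section \<open>Riemannian metrics and curves\<close>

type_synonym ('a, 'e) metric = "'a \<Rightarrow> ('a, 'e) tvec \<Rightarrow> ('a, 'e) tvec \<Rightarrow> real"

definition riemannian_metric ::
  "('a, 'e::euclidean_space) chart set \<Rightarrow> ('a, 'e) metric \<Rightarrow> bool" where
  "riemannian_metric \<A> g \<longleftrightarrow>
     (\<forall>x. \<forall>u\<in>tangent_space \<A> x. \<forall>v\<in>tangent_space \<A> x.
        g x u v = g x v u \<and>
        (\<forall>w\<in>tangent_space \<A> x. \<forall>a b.
           g x (\<lambda>c. a *\<^sub>R u c + b *\<^sub>R v c) w = a * g x u w + b * g x v w) \<and>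
        (u \<noteq> (\<lambda>_. 0) \<longrightarrow> g x u u > 0)) \<and>
     (\<forall>c\<in>\<A>. \<forall>u v.
        smooth_on (\<lambda>y. g (chart_inv c y) (coord_tvec \<A> c (chart_inv c y) u)
                                         (coord_tvec \<A> c (chart_inv c y) v)) (snd c ` fst c))"

definition tnorm :: "('a, 'e) metric \<Rightarrow> 'a \<Rightarrow> ('a, 'e) tvec \<Rightarrow> real" where
  "tnorm g x v = sqrt (g x v v)"

text \<open>The operator norm of the tangent map of \<open>f\<close> at \<open>x\<close>.\<close>

definition tangent_map_norm ::
  "('a, 'e::euclidean_space) chart set \<Rightarrow> ('a, 'e) metric \<Rightarrow> ('a \<Rightarrow> 'a) \<Rightarrow> 'a \<Rightarrow> ennreal" where
  "tangent_map_norm \<A> g f x =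
     (SUP v\<in>{v \<in> tangent_space \<A> x. tnorm g x v \<le> 1}.
        ennreal (tnorm g (f x) (tangent_map \<A> f x v)))"

text \<open>\<open>C\<^sup>1\<close> on a closed interval, with one-sided derivatives at the end points.\<close>

definition C1_curve ::
  "('a::topological_space, 'e::euclidean_space) chart set \<Rightarrow> real \<Rightarrow> real \<Rightarrow> (real \<Rightarrow> 'a) \<Rightarrow> bool" where
  "C1_curve \<A> a b \<sigma> \<longleftrightarrow> continuous_on {a..b} \<sigma> \<and>
     (\<forall>c\<in>\<A>. let J = {s \<in> {a..b}. \<sigma> s \<in> fst c} in
        (\<forall>s\<in>J. (snd c \<circ> \<sigma>) differentiable (at s within {a..b})) \<and>
        continuous_on J (\<lambda>s. vector_derivative (snd c \<circ> \<sigma>) (at s within {a..b})))"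

definition velocity ::
  "('a, 'e::euclidean_space) chart set \<Rightarrow> real \<Rightarrow> real \<Rightarrow> (real \<Rightarrow> 'a) \<Rightarrow> real \<Rightarrow> ('a, 'e) tvec" where
  "velocity \<A> a b \<sigma> s =
     (\<lambda>c. if c \<in> \<A> \<and> \<sigma> s \<in> fst c
          then vector_derivative (snd c \<circ> \<sigma>) (at s within {a..b}) else 0)"

definition curve_length ::
  "('a, 'e::euclidean_space) chart set \<Rightarrow> ('a, 'e) metric \<Rightarrow> real \<Rightarrow> real \<Rightarrow> (real \<Rightarrow> 'a) \<Rightarrow> real" where
  "curve_length \<A> g a b \<sigma> = integral {a..b} (\<lambda>s. tnorm g (\<sigma> s) (velocity \<A> a b \<sigma> s))"

text \<open>
  The infimum of the lengths of piecewise \<open>C\<^sup>1\<close> curves: the break points are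
  \<open>ts 0 < \<dots> < ts n\<close>.
\<close>

definition riemannian_dist ::
  "('a::topological_space, 'e::euclidean_space) chart set \<Rightarrow> ('a, 'e) metric \<Rightarrow> 'a \<Rightarrow> 'a \<Rightarrow> real" where
  "riemannian_dist \<A> g x y =
     Inf {(\<Sum>i<n. curve_length \<A> g (ts i) (ts (Suc i)) \<sigma>) |(n::nat) ts \<sigma>.
            (\<forall>i<n. ts i < ts (Suc i) \<and> C1_curve \<A> (ts i) (ts (Suc i)) \<sigma>) \<and>
            \<sigma> (ts 0) = x \<and> \<sigma> (ts n) = y}"

text \<open>The class of images of \<open>C\<^sup>1\<close> curves \<open>[0,l] \<rightarrow> M\<close>.\<close>

definition C1_curve_images ::
  "('a::topological_space, 'e::euclidean_space) chart set \<Rightarrow> 'a set set" where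
  "C1_curve_images \<A> = {\<sigma> ` {0..l} |\<sigma> l. 0 < l \<and> C1_curve \<A> 0 l \<sigma>}"

text \<open>
  Images of smooth singular \<open>p\<close>-simplices, \<open>p = DIM('q)\<close>: the standard simplex is the convex
  hull of the origin and the standard basis of \<open>'q\<close>.
\<close>

definition smooth_simplex_images ::
  "'q::euclidean_space itself \<Rightarrow> ('a::topological_space, 'e::euclidean_space) chart set \<Rightarrow> 'a set set" where
  "smooth_simplex_images (_ :: 'q itself) \<A> =
     {\<sigma> ` (convex hull (insert 0 Basis)) |\<sigma> V.
        open (V :: 'q set) \<and> convex hull (insert 0 Basis) \<subseteq> V \<and> continuous_on V \<sigma> \<and>
        (\<forall>c\<in>\<A>. smooth_on (snd c \<circ> \<sigma>) (V \<inter> \<sigma> -` fst c))}"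


section \<open>Stochastic integration\<close>

text \<open>
  Processes and filtrations are indexed by the reals, but only times \<open>t \<ge> 0\<close> matter.
\<close>

definition usual_conditions :: "'w measure \<Rightarrow> (real \<Rightarrow> 'w measure) \<Rightarrow> bool" where
  "usual_conditions P \<F> \<longleftrightarrow> filtration (space P) \<F> \<and> (\<forall>t. subalgebra P (\<F> t)) \<and>
     (\<forall>t\<ge>0. (\<Inter>s\<in>{t<..}. sets (\<F> s)) = sets (\<F> t)) \<and>
     (\<forall>N\<in>null_sets P. \<forall>A\<subseteq>N. A \<in> sets (\<F> 0))"

definition brownian_motion ::
  "'w measure \<Rightarrow> (real \<Rightarrow> 'w measure) \<Rightarrow> (real \<Rightarrow> 'w \<Rightarrow> 'b::euclidean_space) \<Rightarrow> bool" where
  "brownian_motion P \<F> B \<longleftrightarrow>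
     (\<forall>t\<ge>0. B t \<in> borel_measurable (\<F> t)) \<and>
     (AE \<omega> in P. B 0 \<omega> = 0 \<and> continuous_on {0..} (\<lambda>t. B t \<omega>)) \<and>
     (\<forall>s t. 0 \<le> s \<and> s < t \<longrightarrow>
        distributed P lborel (\<lambda>\<omega>. B t \<omega> - B s \<omega>)
          (\<lambda>x. ennreal (\<Prod>b\<in>Basis. normal_density 0 (sqrt (t - s)) (x \<bullet> b))) \<and>
        prob_space.indep_set P (sets (\<F> s))
          {(\<lambda>\<omega>. B t \<omega> - B s \<omega>) -` S \<inter> space P |S. S \<in> sets borel})"

definition martingale :: "'w measure \<Rightarrow> (real \<Rightarrow> 'w measure) \<Rightarrow> (real \<Rightarrow> 'w \<Rightarrow> real) \<Rightarrow> bool" where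
  "martingale P \<F> M \<longleftrightarrow>
     (\<forall>t\<ge>0. M t \<in> borel_measurable (\<F> t) \<and> integrable P (M t)) \<and>
     (\<forall>s t. 0 \<le> s \<and> s \<le> t \<longrightarrow> (AE \<omega> in P. real_cond_exp P (\<F> s) (M t) \<omega> = M s \<omega>))"

definition continuous_adapted ::
  "'w measure \<Rightarrow> (real \<Rightarrow> 'w measure) \<Rightarrow> (real \<Rightarrow> 'w \<Rightarrow> real) \<Rightarrow> bool" where
  "continuous_adapted P \<F> Y \<longleftrightarrow>
     (\<forall>t\<ge>0. Y t \<in> borel_measurable (\<F> t)) \<and> (AE \<omega> in P. continuous_on {0..} (\<lambda>t. Y t \<omega>))"

text \<open>
  Localising sequences may be taken finite-valued (replace \<open>T n\<close> by \<open>min (T n) n\<close>).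
\<close>

definition continuous_local_martingale ::
  "'w measure \<Rightarrow> (real \<Rightarrow> 'w measure) \<Rightarrow> (real \<Rightarrow> 'w \<Rightarrow> real) \<Rightarrow> bool" where
  "continuous_local_martingale P \<F> M \<longleftrightarrow> continuous_adapted P \<F> M \<and>
     (\<exists>T :: nat \<Rightarrow> 'w \<Rightarrow> real.
        (\<forall>n. stopping_time \<F> (T n) \<and> (\<forall>\<omega>\<in>space P. 0 \<le> T n \<omega>) \<and>
             martingale P \<F> (\<lambda>t \<omega>. M (min t (T n \<omega>)) \<omega> - M 0 \<omega>)) \<and>
        (AE \<omega> in P. incseq (\<lambda>n. T n \<omega>) \<and> filterlim (\<lambda>n. T n \<omega>) at_top sequentially))"

text \<open>
  The finite variation part is a difference of two continuous adapted nondecreasing processes.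
\<close>

definition continuous_semimartingale ::
  "'w measure \<Rightarrow> (real \<Rightarrow> 'w measure) \<Rightarrow> (real \<Rightarrow> 'w \<Rightarrow> real) \<Rightarrow> bool" where
  "continuous_semimartingale P \<F> Y \<longleftrightarrow> continuous_adapted P \<F> Y \<and>
     (\<exists>M V W. continuous_local_martingale P \<F> M \<and>
        continuous_adapted P \<F> V \<and> (AE \<omega> in P. mono_on {0..} (\<lambda>t. V t \<omega>)) \<and>
        continuous_adapted P \<F> W \<and> (AE \<omega> in P. mono_on {0..} (\<lambda>t. W t \<omega>)) \<and>
        (AE \<omega> in P. \<forall>t\<ge>0. Y t \<omega> = M t \<omega> + V t \<omega> - W t \<omega>))"

text \<open>
  \<open>I\<close> is the Stratonovich integral of \<open>Y\<close> against \<open>Z\<close> over \<open>[0,t]\<close>: the limit in probability,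
  as the mesh tends to zero, of the symmetric sums over partitions
  \<open>0 = \<pi> 0 \<le> \<dots> \<le> \<pi> N = t\<close>. For continuous semimartingales this limit exists and equals the
  Ito integral plus half the covariation.
\<close>

definition stratonovich_integral ::
  "'w measure \<Rightarrow> (real \<Rightarrow> 'w measure) \<Rightarrow> (real \<Rightarrow> 'w \<Rightarrow> real) \<Rightarrow> (real \<Rightarrow> 'w \<Rightarrow> real) \<Rightarrow>
   real \<Rightarrow> ('w \<Rightarrow> real) \<Rightarrow> bool" where
  "stratonovich_integral P \<F> Y Z t I \<longleftrightarrow>
     continuous_semimartingale P \<F> Y \<and> continuous_semimartingale P \<F> Z \<and>
     I \<in> borel_measurable P \<and>
     (\<forall>\<epsilon>>0. \<exists>\<delta>>0. \<forall>(N::nat) \<pi>.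
        \<pi> 0 = 0 \<and> \<pi> N = t \<and> (\<forall>i<N. \<pi> i \<le> \<pi> (Suc i) \<and> \<pi> (Suc i) - \<pi> i < \<delta>) \<longrightarrow>
        measure P {\<omega> \<in> space P.
          \<bar>(\<Sum>i<N. (Y (\<pi> i) \<omega> + Y (\<pi> (Suc i)) \<omega>) / 2 * (Z (\<pi> (Suc i)) \<omega> - Z (\<pi> i) \<omega>)) - I \<omega>\<bar>
            > \<epsilon>} < \<epsilon>)"


section \<open>Solutions and flows of the stochastic differential equation\<close>

text \<open>\<open>h\<close> along the path \<open>x\<close>, extended by zero from the explosion time on.\<close>

definition along :: "('w \<Rightarrow> ereal) \<Rightarrow> (real \<Rightarrow> 'w \<Rightarrow> 'a) \<Rightarrow> ('a \<Rightarrow> real) \<Rightarrow> real \<Rightarrow> 'w \<Rightarrow> real" where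
  "along \<zeta> x h t \<omega> = (if ereal t < \<zeta> \<omega> then h (x t \<omega>) else 0)"

text \<open>
  The maximal solution with explosion time \<open>\<zeta>\<close>, tested against smooth functions of compact
  support. Since the path leaves every compact set at an explosion, the extension by zero
  in \<open>along\<close> is continuous in time, so the equation makes sense for all times.
\<close>

definition maximal_solution ::
  "('a::{t2_space,second_countable_topology}, 'e::euclidean_space) chart set \<Rightarrow>
   'w measure \<Rightarrow> (real \<Rightarrow> 'w measure) \<Rightarrow> (real \<Rightarrow> 'w \<Rightarrow> 'b::euclidean_space) \<Rightarrow>
   ('a \<Rightarrow> 'b \<Rightarrow> ('a, 'e) tvec) \<Rightarrow> ('a \<Rightarrow> ('a, 'e) tvec) \<Rightarrow>
   'a \<Rightarrow> (real \<Rightarrow> 'w \<Rightarrow> 'a) \<Rightarrow> ('w \<Rightarrow> ereal) \<Rightarrow> bool" where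
  "maximal_solution \<A> P \<F> B X A x0 x \<zeta> \<longleftrightarrow>
     (AE \<omega> in P. 0 < \<zeta> \<omega> \<and> x 0 \<omega> = x0 \<and>
        continuous_on {t. 0 \<le> t \<and> ereal t < \<zeta> \<omega>} (\<lambda>t. x t \<omega>)) \<and>
     (\<forall>t\<ge>0. \<forall>G\<in>sets borel. {\<omega> \<in> space P. ereal t < \<zeta> \<omega> \<and> x t \<omega> \<in> G} \<in> sets (\<F> t)) \<and>
     (\<forall>C. compact C \<longrightarrow> (AE \<omega> in P. \<zeta> \<omega> < \<infinity> \<longrightarrow>
        eventually (\<lambda>t. x t \<omega> \<notin> C) (at_left (real_of_ereal (\<zeta> \<omega>))))) \<and>
     (\<forall>f. test_function \<A> f \<longrightarrow> (\<forall>t\<ge>0. \<exists>I :: 'b \<Rightarrow> 'w \<Rightarrow> real.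
        (\<forall>b\<in>Basis. stratonovich_integral P \<F>
           (along \<zeta> x (\<lambda>y. scalar_diff \<A> f y (X y b))) (\<lambda>s \<omega>. B s \<omega> \<bullet> b) t (I b)) \<and>
        (AE \<omega> in P. along \<zeta> x f t \<omega> = f x0 + (\<Sum>b\<in>Basis. I b \<omega>) +
           integral {0..t} (\<lambda>s. along \<zeta> x (\<lambda>y. scalar_diff \<A> f y (A y)) s \<omega>))))"

definition explosion_inf :: "('a \<Rightarrow> 'w \<Rightarrow> ereal) \<Rightarrow> 'a set \<Rightarrow> 'w \<Rightarrow> ereal" where
  "explosion_inf \<xi> K \<omega> = (INF x\<in>K. \<xi> x \<omega>)"

text \<open>
  The third clause is continuity in \<open>t\<close> for \<open>C\<^sup>1\<close> convergence on compacta: it runs over the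
  subbasic neighbourhoods of that topology, given by a compact set inside the domain of a
  chart \<open>c\<close> that is mapped into the domain of a chart \<open>d\<close>.
\<close>

definition partial_flow ::
  "('a::{t2_space,second_countable_topology}, 'e::euclidean_space) chart set \<Rightarrow> ('a, 'e) metric \<Rightarrow>
   'w measure \<Rightarrow> (real \<Rightarrow> 'w measure) \<Rightarrow> (real \<Rightarrow> 'w \<Rightarrow> 'b::euclidean_space) \<Rightarrow>
   ('a \<Rightarrow> 'b \<Rightarrow> ('a, 'e) tvec) \<Rightarrow> ('a \<Rightarrow> ('a, 'e) tvec) \<Rightarrow>
   (real \<Rightarrow> 'a \<Rightarrow> 'w \<Rightarrow> 'a) \<Rightarrow> ('a \<Rightarrow> 'w \<Rightarrow> ereal) \<Rightarrow> bool" where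
  "partial_flow \<A> g P \<F> B X A F \<xi> \<longleftrightarrow>
     (\<forall>x. maximal_solution \<A> P \<F> B X A x (\<lambda>t. F t x) (\<xi> x)) \<and>
     (AE \<omega> in P.
        (\<forall>x. 0 < \<xi> x \<omega> \<and> F 0 x \<omega> = x) \<and>
        (\<forall>t\<ge>0. C1_diffeo_on \<A> {x. ereal t < \<xi> x \<omega>} (\<lambda>x. F t x \<omega>)) \<and>
        (\<forall>s\<ge>0. \<forall>c\<in>\<A>. \<forall>d\<in>\<A>. \<forall>C.
           compact C \<and> C \<subseteq> fst c \<and> C \<subseteq> {x. ereal s < \<xi> x \<omega>} \<and> (\<lambda>x. F s x \<omega>) ` C \<subseteq> fst d \<longrightarrow>
           (\<forall>\<epsilon>>0. eventually (\<lambda>t.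
              C \<subseteq> {x. ereal t < \<xi> x \<omega>} \<and> (\<lambda>x. F t x \<omega>) ` C \<subseteq> fst d \<and>
              (\<forall>x\<in>C. norm (snd d (F t x \<omega>) - snd d (F s x \<omega>)) < \<epsilon> \<and>
                 onorm (\<lambda>u.
                   frechet_derivative (snd d \<circ> (\<lambda>y. F t y \<omega>) \<circ> chart_inv c) (at (snd c x)) u -
                   frechet_derivative (snd d \<circ> (\<lambda>y. F s y \<omega>) \<circ> chart_inv c) (at (snd c x)) u) < \<epsilon>))
              (at s within {0..})))) \<and>
     (\<forall>K x0. compact K \<longrightarrow> (AE \<omega> in P. explosion_inf \<xi> K \<omega> < \<infinity> \<longrightarrow>
        ((\<lambda>t. SUP x\<in>K. ereal (riemannian_dist \<A> g x0 (F t x \<omega>))) \<longlongrightarrow> \<infinity>)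
          (at_left (real_of_ereal (explosion_inf \<xi> K \<omega>)))))"

definition exit_time :: "'a::topological_space set \<Rightarrow> (real \<Rightarrow> 'a \<Rightarrow> 'w \<Rightarrow> 'a) \<Rightarrow> 'a \<Rightarrow> 'w \<Rightarrow> ereal" where
  "exit_time U G x \<omega> = (INF t\<in>{t. 0 \<le> t \<and> G t x \<omega> \<notin> closure U}. ereal t)"

definition exit_inf ::
  "'a::topological_space set \<Rightarrow> (real \<Rightarrow> 'a \<Rightarrow> 'w \<Rightarrow> 'a) \<Rightarrow> 'a set \<Rightarrow> 'w \<Rightarrow> ereal" where
  "exit_inf U G K \<omega> = (INF x\<in>K. exit_time U G x \<omega>)"

text \<open>
  The exhaustion \<open>U\<close>, the cut-off functions \<open>\<phi>\<close> and the global flows \<open>G i\<close> of the equations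
  with coefficients \<open>\<phi> i X\<close>, \<open>\<phi> i A\<close>. The last clause records that \<open>G i\<close> and the flow \<open>F\<close>
  are the same before the exit from \<open>closure (U i)\<close> (pathwise uniqueness, as the two equations
  have equal coefficients on \<open>U (i + 1)\<close>).
\<close>

definition localisation ::
  "('a::{t2_space,second_countable_topology}, 'e::euclidean_space) chart set \<Rightarrow> ('a, 'e) metric \<Rightarrow>
   'w measure \<Rightarrow> (real \<Rightarrow> 'w measure) \<Rightarrow> (real \<Rightarrow> 'w \<Rightarrow> 'b::euclidean_space) \<Rightarrow>
   ('a \<Rightarrow> 'b \<Rightarrow> ('a, 'e) tvec) \<Rightarrow> ('a \<Rightarrow> ('a, 'e) tvec) \<Rightarrow>
   (real \<Rightarrow> 'a \<Rightarrow> 'w \<Rightarrow> 'a) \<Rightarrow> ('a \<Rightarrow> 'w \<Rightarrow> ereal) \<Rightarrow>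
   (nat \<Rightarrow> 'a set) \<Rightarrow> (nat \<Rightarrow> 'a \<Rightarrow> real) \<Rightarrow> (nat \<Rightarrow> real \<Rightarrow> 'a \<Rightarrow> 'w \<Rightarrow> 'a) \<Rightarrow> bool" where
  "localisation \<A> g P \<F> B X A F \<xi> U \<phi> G \<longleftrightarrow>
     (\<forall>i. open (U i) \<and> compact (closure (U i)) \<and> closure (U i) \<subseteq> U (Suc i)) \<and>
     (\<Union>i. U i) = UNIV \<and>
     (\<forall>i. smooth_scalar \<A> (\<phi> i) \<and> (\<forall>x\<in>U (i + 1). \<phi> i x = 1) \<and>
        (\<forall>x. x \<notin> U (i + 2) \<longrightarrow> \<phi> i x = 0)) \<and>
     (\<forall>i. partial_flow \<A> g P \<F> B
        (\<lambda>x u c. \<phi> i x *\<^sub>R X x u c) (\<lambda>x c. \<phi> i x *\<^sub>R A x c) (G i) (\<lambda>x \<omega>. \<infinity>)) \<and>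
     (\<forall>i K. compact K \<longrightarrow> (AE \<omega> in P. \<forall>x\<in>K. \<forall>t\<ge>0.
        ereal t < exit_inf (U i) (G i) K \<omega> \<longrightarrow> ereal t < \<xi> x \<omega> \<and> G i t x \<omega> = F t x \<omega>))"


section \<open>Strong completeness\<close>

definition strongly_p_complete ::
  "'q::euclidean_space itself \<Rightarrow> ('a::topological_space, 'e::euclidean_space) chart set \<Rightarrow>
   'w measure \<Rightarrow> ('a \<Rightarrow> 'w \<Rightarrow> ereal) \<Rightarrow> bool" where
  "strongly_p_complete q \<A> P \<xi> \<longleftrightarrow>
     (\<forall>K\<in>smooth_simplex_images q \<A>. AE \<omega> in P. explosion_inf \<xi> K \<omega> = \<infinity>)"

text \<open>
  A version \<open>H\<close> of the solution that has infinite life time and is jointly continuous in time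
  and space.
\<close>

definition strongly_complete ::
  "'w measure \<Rightarrow> (real \<Rightarrow> 'a::topological_space \<Rightarrow> 'w \<Rightarrow> 'a) \<Rightarrow> ('a \<Rightarrow> 'w \<Rightarrow> ereal) \<Rightarrow> bool" where
  "strongly_complete P F \<xi> \<longleftrightarrow> (\<exists>H :: real \<Rightarrow> 'a \<Rightarrow> 'w \<Rightarrow> 'a.
     (\<forall>x. AE \<omega> in P. \<xi> x \<omega> = \<infinity> \<and> (\<forall>t\<ge>0. H t x \<omega> = F t x \<omega>)) \<and>
     (\<forall>\<omega>\<in>space P. continuous_on ({0..} \<times> UNIV) (\<lambda>(t, x). H t x \<omega>)))"

end

(*
  Along a C^1 curve K through a point x that never explodes, the flow at the exit time S_j of K
  from U_j is again a C^1 curve, whose length is at most the integral of |T F_{S_j}| times the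
  speed of K. By Tonelli, the hypothesis and Fatou's lemma, the lower limit of these lengths is almost
  surely finite on the event that K explodes before t. The image of K contains the image of x,
  which stays in a compact set, so along a subsequence the images of K stay at bounded distance from
  a fixed point, although by the definition of the partial flow their distance tends to infinity
  as S_j increases to the explosion time of K. Hence K does not explode, the set of points that
  never explode is open and closed, and connectedness gives the claim for all C^1 curves.

  In dimension at most two the boundary of a small chart disc D lies on a C^1 curve, so up to the
  explosion time of D its image stays in a compact set Q. Outside Q the image of D is open and closed
  and relatively compact, and only finitely many such sets occur outside a neighbourhood of Q, so the
  image of D stays bounded and D does not explode.
*)
theory Submission
  imports Defs
begin

section \<open>Curves in charts\<close>

text \<open>The obstacle is that the flow stopped at S_j must make sense on all of K and be
  measurable in \<omega>. It makes sense because S_j, when finite, is strictly smaller than the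
  explosion time of K: before S_j the images of K lie in the compact set
  \<open>closure (U j)\<close>, on which the distance from a fixed point is bounded, so an explosion
  at S_j would contradict the blow-up clause of the partial flow. It is measurable because at S_j it
  coincides with the cut-off flow \<open>G j\<close>, which lives for all times, so that a random
  time can be inserted; S_j itself is an infimum over rational times and curve parameters. Pathwise
  statements are proved for a fixed \<omega> and then combined on one measurable set of full
  probability. Distances are estimated from above by lengths of explicit curves: compact sets have
  bounded distance from a point, and two image points of K differ by at most the length of the image
  curve. For a disc that explodes at time T, the flow of the surrounding curve survives beyond T.
  Its image over the closed interval from 0 to T is therefore compact, although the disc is only
  transported for t < T.\<close>

lemma frechet_derivative_combine:
  fixes h :: "'p::euclidean_space \<Rightarrow> 'q::real_normed_vector"
  assumes "h differentiable (at x)"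
  shows "frechet_derivative h (at x) v = (\<Sum>b\<in>Basis. (v \<bullet> b) *\<^sub>R frechet_derivative h (at x) b)"
proof -
  have "linear (frechet_derivative h (at x))"
    using assms by (rule linear_frechet_derivative)
  then have "frechet_derivative h (at x) (\<Sum>b\<in>Basis. (v \<bullet> b) *\<^sub>R b) =
      (\<Sum>b\<in>Basis. (v \<bullet> b) *\<^sub>R frechet_derivative h (at x) b)"
    by (simp add: linear_sum linear_cmul)
  then show ?thesis
    by (simp add: euclidean_representation)
qed

lemma C_on_1:
  "C_on 1 h S \<longleftrightarrow> (\<forall>x\<in>S. h differentiable (at x)) \<and>
    (\<forall>v. continuous_on S (\<lambda>x. frechet_derivative h (at x) v))"
  by simp

lemma C_on_1_differentiable: "C_on 1 h S \<Longrightarrow> x \<in> S \<Longrightarrow> h differentiable (at x)"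
  by (simp add: C_on_1)

text \<open>\<open>C_on\<close> controls the derivative in each fixed direction only. Expanding the
  direction in the basis gives continuity when point and direction move together, as they do along a
  curve.\<close>

lemma C_on_1_continuous_on_derivative:
  fixes h :: "'p::euclidean_space \<Rightarrow> 'q::real_normed_vector"
  assumes "C_on 1 h S" "continuous_on T p" "continuous_on T w" "p ` T \<subseteq> S"
  shows "continuous_on T (\<lambda>s. frechet_derivative h (at (p s)) (w s))"
proof -
  have "continuous_on T (\<lambda>s. \<Sum>b\<in>Basis. (w s \<bullet> b) *\<^sub>R frechet_derivative h (at (p s)) b)"
  proof (intro continuous_intros assms)
    fix b
    have "continuous_on S (\<lambda>x. frechet_derivative h (at x) b)"
      using assms(1) by (auto simp: C_on_1)
    then show "continuous_on T (\<lambda>s. frechet_derivative h (at (p s)) b)"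
      using assms(2,4) by (rule continuous_on_compose2)
  qed
  moreover have "frechet_derivative h (at (p s)) (w s) =
      (\<Sum>b\<in>Basis. (w s \<bullet> b) *\<^sub>R frechet_derivative h (at (p s)) b)" if "s \<in> T" for s
    using assms(1,4) that by (intro frechet_derivative_combine) (auto simp: C_on_1)
  ultimately show ?thesis
    by simp
qed

lemma eventually_preimage_open:
  assumes "continuous_on T f" "s \<in> T" "open V" "f s \<in> V"
  shows "eventually (\<lambda>r. f r \<in> V) (at s within T)"
  using assms unfolding continuous_on_def by (blast intro: topological_tendstoD)

lemma vector_derivative_within_ivl:
  fixes f :: "real \<Rightarrow> 'q::real_normed_vector"
  assumes "(f has_vector_derivative D) (at s within {a..b})" "a < b" "s \<in> {a..b}"
  shows "vector_derivative f (at s within {a..b}) = D"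
  using vector_derivative_within_cbox[of a b s f D] assms by (simp add: cbox_interval)

text \<open>A curve is seen in one chart only on a piece of its parameter interval, so continuity is
  checked on relatively open pieces.\<close>

lemma continuous_on_open_pieces:
  assumes "\<And>s. s \<in> T \<Longrightarrow> \<exists>J. s \<in> J \<and> openin (top_of_set T) J \<and> continuous_on J f"
  shows "continuous_on T f"
  unfolding continuous_on_def
proof
  fix s assume s: "s \<in> T"
  then obtain J where J: "s \<in> J" "openin (top_of_set T) J" "continuous_on J f"
    using assms by blast
  then obtain V where V: "open V" "J = T \<inter> V"
    by (auto simp: openin_open)
  have "at s within T = at s within J"
    using J V s by (intro at_within_nhd[where S=V]) auto
  then show "(f \<longlongrightarrow> f s) (at s within T)"
    using J by (simp add: continuous_on_def)
qed

section \<open>Curves seen through the charts of an atlas\<close>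

locale atlas =
  fixes \<A> :: "('a::{t2_space,second_countable_topology}, 'e::euclidean_space) chart set"
  assumes smooth_atlas: "smooth_atlas \<A>"
begin

lemma open_domain: "c \<in> \<A> \<Longrightarrow> open (fst c)"
  and open_chart_image: "c \<in> \<A> \<Longrightarrow> open (snd c ` fst c)"
  and chart_homeomorphism: "c \<in> \<A> \<Longrightarrow> homeomorphism (fst c) (snd c ` fst c) (snd c) (chart_inv c)"
  using smooth_atlas unfolding smooth_atlas_def by blast+

lemma continuous_on_chart: "c \<in> \<A> \<Longrightarrow> continuous_on (fst c) (snd c)"
  and continuous_on_chart_inv: "c \<in> \<A> \<Longrightarrow> continuous_on (snd c ` fst c) (chart_inv c)"
  and chart_inv_chart: "c \<in> \<A> \<Longrightarrow> x \<in> fst c \<Longrightarrow> chart_inv c (snd c x) = x"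
  using chart_homeomorphism unfolding homeomorphism_def by blast+

lemma chart_chart_inv: "c \<in> \<A> \<Longrightarrow> y \<in> snd c ` fst c \<Longrightarrow> snd c (chart_inv c y) = y"
  and chart_inv_domain: "c \<in> \<A> \<Longrightarrow> y \<in> snd c ` fst c \<Longrightarrow> chart_inv c y \<in> fst c"
  using chart_homeomorphism unfolding homeomorphism_def by blast+

lemma open_chart_image_subset:
  assumes "c \<in> \<A>" "open S" "S \<subseteq> fst c"
  shows "open (snd c ` S)"
proof -
  have "openin (top_of_set (fst c)) S"
    using assms open_domain by (simp add: openin_open_eq)
  then have "openin (top_of_set (snd c ` fst c)) (snd c ` S)"
    by (rule homeomorphism_imp_open_map[OF chart_homeomorphism[OF assms(1)]])
  then show ?thesis
    using open_chart_image[OF assms(1)] by (simp add: openin_open_eq)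
qed

lemma open_chart_inv_image:
  assumes "c \<in> \<A>" "open S" "S \<subseteq> snd c ` fst c"
  shows "open (chart_inv c ` S)"
proof -
  have "openin (top_of_set (snd c ` fst c)) S"
    using assms open_chart_image by (simp add: openin_open_eq)
  then have "openin (top_of_set (fst c)) (chart_inv c ` S)"
    by (rule homeomorphism_imp_open_map[OF homeomorphism_symD[OF chart_homeomorphism[OF assms(1)]]])
  then show ?thesis
    using open_domain[OF assms(1)] by (simp add: openin_open_eq)
qed

lemma chart_exists: obtains c where "c \<in> \<A>" "x \<in> fst c"
  using smooth_atlas unfolding smooth_atlas_def by blast

lemma chart_at: "chart_at \<A> x \<in> \<A>" "x \<in> fst (chart_at \<A> x)"
proof -
  have "\<exists>c. c \<in> \<A> \<and> x \<in> fst c"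
    by (meson chart_exists)
  then have "chart_at \<A> x \<in> \<A> \<and> x \<in> fst (chart_at \<A> x)"
    unfolding chart_at_def by (rule someI_ex)
  then show "chart_at \<A> x \<in> \<A>" "x \<in> fst (chart_at \<A> x)"
    by auto
qed

lemma C1_transition:
  assumes "c \<in> \<A>" "d \<in> \<A>"
  shows "C_on 1 (snd d \<circ> chart_inv c) (snd c ` (fst c \<inter> fst d))"
  using smooth_atlas assms unfolding smooth_atlas_def smooth_on_def by blast

lemma transition_differentiable:
  assumes "c \<in> \<A>" "d \<in> \<A>" "x \<in> fst c" "x \<in> fst d"
  shows "(snd d \<circ> chart_inv c) differentiable (at (snd c x))"
  using C1_transition[OF assms(1,2)] assms(3,4) by (blast intro: C_on_1_differentiable)

text \<open>Chain rule for \<open>f \<circ> \<gamma>\<close> written as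
  \<open>(f \<circ> chart_inv c) \<circ> (snd c \<circ> \<gamma>)\<close>. The two agree only while
  the curve is in the domain of \<open>c\<close>, hence the passage through an eventual equality
  near \<open>s\<close>.\<close>

lemma has_vector_derivative_chart_curve:
  fixes f :: "'a \<Rightarrow> 'z::real_normed_vector"
  assumes "c \<in> \<A>" "\<gamma> s \<in> fst c" "continuous_on T \<gamma>" "s \<in> T"
    and f: "(f \<circ> chart_inv c) differentiable (at (snd c (\<gamma> s)))"
    and D: "((snd c \<circ> \<gamma>) has_vector_derivative D) (at s within T)"
  shows "((f \<circ> \<gamma>) has_vector_derivative
    frechet_derivative (f \<circ> chart_inv c) (at (snd c (\<gamma> s))) D) (at s within T)"
proof -
  let ?L = "frechet_derivative (f \<circ> chart_inv c) (at (snd c (\<gamma> s)))"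
  have L: "((f \<circ> chart_inv c) has_derivative ?L) (at ((snd c \<circ> \<gamma>) s))"
    using f by (simp add: frechet_derivative_works)
  have "((f \<circ> chart_inv c) \<circ> (snd c \<circ> \<gamma>) has_derivative ?L \<circ> (\<lambda>h. h *\<^sub>R D)) (at s within T)"
    by (rule diff_chain_within[OF D[unfolded has_vector_derivative_def] has_derivative_at_withinI[OF L]])
  moreover have "?L \<circ> (\<lambda>h. h *\<^sub>R D) = (\<lambda>h. h *\<^sub>R ?L D)"
    using linear_frechet_derivative[OF f] by (auto simp: linear_cmul)
  ultimately have 1: "((f \<circ> chart_inv c) \<circ> (snd c \<circ> \<gamma>) has_vector_derivative ?L D) (at s within T)"
    by (simp add: has_vector_derivative_def)
  have "eventually (\<lambda>r. \<gamma> r \<in> fst c) (at s within T)"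
    using assms open_domain by (intro eventually_preimage_open) auto
  then have 2: "eventually (\<lambda>r. ((f \<circ> chart_inv c) \<circ> (snd c \<circ> \<gamma>)) r = (f \<circ> \<gamma>) r) (at s within T)"
    by eventually_elim (simp add: chart_inv_chart assms(1))
  have 3: "((f \<circ> chart_inv c) \<circ> (snd c \<circ> \<gamma>)) s = (f \<circ> \<gamma>) s"
    using assms(1,2) by (simp add: chart_inv_chart)
  show ?thesis
    unfolding has_vector_derivative_def
    by (rule has_derivative_transform_eventually[OF 1[unfolded has_vector_derivative_def] 2 3 \<open>s \<in> T\<close>])
qed

lemma C1_curve_continuous: "C1_curve \<A> a b \<gamma> \<Longrightarrow> continuous_on {a..b} \<gamma>"
  by (simp add: C1_curve_def)

lemma C1_curve_has_vector_derivative: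
  assumes "C1_curve \<A> a b \<gamma>" "s \<in> {a..b}" "c \<in> \<A>" "\<gamma> s \<in> fst c"
  shows "((snd c \<circ> \<gamma>) has_vector_derivative velocity \<A> a b \<gamma> s c) (at s within {a..b})"
  using assms by (auto simp: C1_curve_def Let_def velocity_def vector_derivative_works[symmetric])

lemma velocity_eq:
  assumes "c \<in> \<A>" "\<gamma> s \<in> fst c" "a < b" "s \<in> {a..b}"
    and "((snd c \<circ> \<gamma>) has_vector_derivative D) (at s within {a..b})"
  shows "velocity \<A> a b \<gamma> s c = D"
  using assms by (simp add: velocity_def vector_derivative_within_ivl)

lemma C1_curve_velocity_continuous:
  assumes "C1_curve \<A> a b \<gamma>" "c \<in> \<A>"
  shows "continuous_on {s \<in> {a..b}. \<gamma> s \<in> fst c} (\<lambda>s. velocity \<A> a b \<gamma> s c)"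
proof -
  have "continuous_on {s \<in> {a..b}. \<gamma> s \<in> fst c}
      (\<lambda>s. vector_derivative (snd c \<circ> \<gamma>) (at s within {a..b}))"
    using assms by (auto simp: C1_curve_def Let_def)
  then show ?thesis
    by (rule continuous_on_eq) (use assms in \<open>auto simp: velocity_def\<close>)
qed

lemma openin_curve_preimage:
  assumes "continuous_on T \<gamma>" "open V"
  shows "openin (top_of_set T) {s \<in> T. \<gamma> s \<in> V}"
  using continuous_openin_preimage_gen[OF assms] by (simp add: vimage_def Int_def)

text \<open>The candidate \<open>D\<close> for the derivative may depend on the piece
  \<open>J\<close>. This matters when a curve is mapped by a flow: its coordinates before the map
  come from a chart that has to be changed along the curve.\<close>

lemma C1_curveI:
  assumes "a < b" "continuous_on {a..b} \<gamma>"
    and *: "\<And>d s. d \<in> \<A> \<Longrightarrow> s \<in> {a..b} \<Longrightarrow> \<gamma> s \<in> fst d \<Longrightarrow> \<exists>J D. s \<in> J \<and> openin (top_of_set {a..b}) J \<and>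
      continuous_on J D \<and> (\<forall>r\<in>J. ((snd d \<circ> \<gamma>) has_vector_derivative D r) (at r within {a..b}))"
  shows "C1_curve \<A> a b \<gamma>"
  unfolding C1_curve_def Let_def
proof (intro conjI ballI)
  show "continuous_on {a..b} \<gamma>"
    by fact
next
  fix d s assume "d \<in> \<A>" and s: "s \<in> {s \<in> {a..b}. \<gamma> s \<in> fst d}"
  then obtain J D where "s \<in> J" "\<forall>r\<in>J. ((snd d \<circ> \<gamma>) has_vector_derivative D r) (at r within {a..b})"
    using *[of d s] by auto
  then show "(snd d \<circ> \<gamma>) differentiable (at s within {a..b})"
    by (auto simp: has_vector_derivative_def differentiable_def)
next
  fix d assume d: "d \<in> \<A>"
  let ?T = "{s \<in> {a..b}. \<gamma> s \<in> fst d}"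
  show "continuous_on ?T (\<lambda>s. vector_derivative (snd d \<circ> \<gamma>) (at s within {a..b}))"
  proof (rule continuous_on_open_pieces)
    fix s assume s: "s \<in> ?T"
    then obtain J D where J: "s \<in> J" "openin (top_of_set {a..b}) J" "continuous_on J D"
      "\<forall>r\<in>J. ((snd d \<circ> \<gamma>) has_vector_derivative D r) (at r within {a..b})"
      using *[OF d, of s] by auto
    have "continuous_on J (\<lambda>s. vector_derivative (snd d \<circ> \<gamma>) (at s within {a..b}))"
      using J(3)
    proof (rule continuous_on_eq)
      fix r assume r: "r \<in> J"
      then have "r \<in> {a..b}"
        using J(2) openin_imp_subset by blast
      then show "D r = vector_derivative (snd d \<circ> \<gamma>) (at r within {a..b})"
        using J(4) r \<open>a < b\<close> by (metis vector_derivative_within_ivl)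
    qed
    then have "continuous_on (?T \<inter> J) (\<lambda>s. vector_derivative (snd d \<circ> \<gamma>) (at s within {a..b}))"
      by (rule continuous_on_subset) auto
    moreover have "openin (top_of_set ?T) (?T \<inter> J)"
    proof -
      obtain V where "open V" "J = {a..b} \<inter> V"
        using J(2) by (auto simp: openin_open)
      then show ?thesis
        unfolding openin_open by (intro exI[of _ V]) auto
    qed
    ultimately show "\<exists>J. s \<in> J \<and> openin (top_of_set ?T) J \<and>
        continuous_on J (\<lambda>s. vector_derivative (snd d \<circ> \<gamma>) (at s within {a..b}))"
      using s J(1) by (intro exI[of _ "?T \<inter> J"]) simp
  qed
qed

text \<open>Serves two parametrisations from a Euclidean space: inverse charts and singular
  simplices of dimension one. Since \<open>V\<close> is open, ordinary Frechet derivatives of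
  \<open>f\<close> are available also at the images of the end points.\<close>

lemma C1_curve_compose:
  fixes f :: "'p::euclidean_space \<Rightarrow> 'a" and p :: "real \<Rightarrow> 'p"
  assumes "a < b" "open V" "continuous_on V f"
    and C1: "\<And>d. d \<in> \<A> \<Longrightarrow> C_on 1 (snd d \<circ> f) (V \<inter> f -` fst d)"
    and p: "p ` {a..b} \<subseteq> V" "continuous_on {a..b} p'"
      "\<And>s. s \<in> {a..b} \<Longrightarrow> (p has_vector_derivative p' s) (at s within {a..b})"
  shows "C1_curve \<A> a b (f \<circ> p)"
    and "\<And>s d. s \<in> {a..b} \<Longrightarrow> d \<in> \<A> \<Longrightarrow> f (p s) \<in> fst d \<Longrightarrow>
      velocity \<A> a b (f \<circ> p) s d = frechet_derivative (snd d \<circ> f) (at (p s)) (p' s)"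
proof -
  have p_cont: "continuous_on {a..b} p"
    unfolding continuous_on_eq_continuous_within using p(3) by (blast intro: has_vector_derivative_continuous)
  then have cont: "continuous_on {a..b} (f \<circ> p)"
    by (intro continuous_on_compose p_cont continuous_on_subset[OF assms(3) p(1)])
  have der: "((snd d \<circ> (f \<circ> p)) has_vector_derivative
      frechet_derivative (snd d \<circ> f) (at (p s)) (p' s)) (at s within {a..b})"
    if "s \<in> {a..b}" "d \<in> \<A>" "f (p s) \<in> fst d" for s d
  proof -
    have diff: "(snd d \<circ> f) differentiable (at (p s))"
      using C1[OF that(2)] by (rule C_on_1_differentiable) (use that p(1) in blast)
    then have L: "((snd d \<circ> f) has_derivative frechet_derivative (snd d \<circ> f) (at (p s))) (at (p s) within p ` {a..b})"
      by (simp add: frechet_derivative_works has_derivative_at_withinI)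
    have "((snd d \<circ> f) \<circ> p has_derivative frechet_derivative (snd d \<circ> f) (at (p s)) \<circ> (\<lambda>h. h *\<^sub>R p' s))
        (at s within {a..b})"
      by (rule diff_chain_within[OF p(3)[OF that(1), unfolded has_vector_derivative_def] L])
    moreover have "frechet_derivative (snd d \<circ> f) (at (p s)) \<circ> (\<lambda>h. h *\<^sub>R p' s) =
        (\<lambda>h. h *\<^sub>R frechet_derivative (snd d \<circ> f) (at (p s)) (p' s))"
      using linear_frechet_derivative[OF diff] by (auto simp: linear_cmul)
    ultimately show ?thesis
      by (simp add: has_vector_derivative_def comp_assoc)
  qed
  show "C1_curve \<A> a b (f \<circ> p)"
  proof (rule C1_curveI[OF \<open>a < b\<close> cont])
    fix d s assume d: "d \<in> \<A>" and s: "s \<in> {a..b}" "(f \<circ> p) s \<in> fst d"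
    let ?J = "{s \<in> {a..b}. (f \<circ> p) s \<in> fst d}"
    let ?D = "\<lambda>s. frechet_derivative (snd d \<circ> f) (at (p s)) (p' s)"
    have "continuous_on ?J ?D"
      using p(1) by (intro C_on_1_continuous_on_derivative[OF C1[OF d]])
        (auto intro: continuous_on_subset[OF p_cont] continuous_on_subset[OF p(2)])
    moreover have "openin (top_of_set {a..b}) ?J"
      using cont d by (intro openin_curve_preimage open_domain) auto
    ultimately show "\<exists>J D. s \<in> J \<and> openin (top_of_set {a..b}) J \<and> continuous_on J D \<and>
        (\<forall>r\<in>J. ((snd d \<circ> (f \<circ> p)) has_vector_derivative D r) (at r within {a..b}))"
      using s d der by (intro exI[of _ ?J] exI[of _ ?D]) auto
  qed
  show "velocity \<A> a b (f \<circ> p) s d = frechet_derivative (snd d \<circ> f) (at (p s)) (p' s)"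
    if "s \<in> {a..b}" "d \<in> \<A>" "f (p s) \<in> fst d" for s d
    using that der[OF that] \<open>a < b\<close> by (intro velocity_eq) auto
qed

lemma C1_curve_chart:
  assumes "a < b" "c \<in> \<A>"
    and p: "p ` {a..b} \<subseteq> snd c ` fst c" "continuous_on {a..b} p'"
      "\<And>s. s \<in> {a..b} \<Longrightarrow> (p has_vector_derivative p' s) (at s within {a..b})"
  shows "C1_curve \<A> a b (chart_inv c \<circ> p)"
    and "s \<in> {a..b} \<Longrightarrow> velocity \<A> a b (chart_inv c \<circ> p) s c = p' s"
proof -
  have C1: "C_on 1 (snd d \<circ> chart_inv c) (snd c ` fst c \<inter> chart_inv c -` fst d)" if "d \<in> \<A>" for d
  proof -
    have "snd c ` fst c \<inter> chart_inv c -` fst d = snd c ` (fst c \<inter> fst d)"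
      using chart_inv_chart[OF assms(2)] by auto
    then show ?thesis
      using C1_transition[OF assms(2) that] by simp
  qed
  show "C1_curve \<A> a b (chart_inv c \<circ> p)"
    by (rule C1_curve_compose[OF assms(1) open_chart_image[OF assms(2)] continuous_on_chart_inv[OF assms(2)] C1 p])
  assume s: "s \<in> {a..b}"
  have ps: "p s \<in> snd c ` fst c"
    using p(1) s by blast
  \<comment> \<open>The change of coordinates from \<open>c\<close> to itself is the identity on the
    chart image; as that set is open, this determines the derivative.\<close>
  have "((\<lambda>y. y) has_derivative (\<lambda>y. y)) (at (p s))"
    by simp
  then have "((snd c \<circ> chart_inv c) has_derivative (\<lambda>y. y)) (at (p s))"
    by (rule has_derivative_transform_within_open[OF _ open_chart_image[OF assms(2)] ps])
      (simp add: chart_chart_inv assms(2))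
  then have "frechet_derivative (snd c \<circ> chart_inv c) (at (p s)) = (\<lambda>y. y)"
    by (rule frechet_derivative_at[symmetric])
  moreover have "chart_inv c (p s) \<in> fst c"
    using ps chart_inv_domain assms(2) by blast
  ultimately show "velocity \<A> a b (chart_inv c \<circ> p) s c = p' s"
    using C1_curve_compose(2)[OF assms(1) open_chart_image[OF assms(2)]
        continuous_on_chart_inv[OF assms(2)] C1 p s assms(2)] by simp
qed

lemma velocity_tangent:
  assumes "C1_curve \<A> a b \<gamma>" "a < b" "s \<in> {a..b}"
  shows "velocity \<A> a b \<gamma> s \<in> tangent_space \<A> (\<gamma> s)"
proof -
  have 1: "velocity \<A> a b \<gamma> s d =
      frechet_derivative (snd d \<circ> chart_inv c) (at (snd c (\<gamma> s))) (velocity \<A> a b \<gamma> s c)"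
    if "c \<in> \<A>" "d \<in> \<A>" "\<gamma> s \<in> fst c" "\<gamma> s \<in> fst d" for c d
    by (rule velocity_eq[OF that(2,4) assms(2,3) has_vector_derivative_chart_curve[OF that(1,3)
          C1_curve_continuous[OF assms(1)] assms(3) transition_differentiable[OF that]
          C1_curve_has_vector_derivative[OF assms(1,3) that(1,3)]]])
  have 2: "velocity \<A> a b \<gamma> s c = 0" if "\<not> (c \<in> \<A> \<and> \<gamma> s \<in> fst c)" for c
    using that by (auto simp: velocity_def)
  show ?thesis
    unfolding tangent_space_def
  proof (intro CollectI conjI ballI allI impI)
    fix c d assume "c \<in> \<A>" "d \<in> \<A>" "\<gamma> s \<in> fst c \<and> \<gamma> s \<in> fst d"
    then show "velocity \<A> a b \<gamma> s d =
        frechet_derivative (snd d \<circ> chart_inv c) (at (snd c (\<gamma> s))) (velocity \<A> a b \<gamma> s c)"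
      by (intro 1) auto
  qed (rule 2)
qed

text \<open>\<open>tangent_map\<close> reads its argument in the chart \<open>chart_at\<close> of
  one point, while continuity of the velocity needs a chart that works on a whole piece of the
  curve. The derivative is therefore computed for every source chart \<open>c\<close>, and only the
  last identity specialises to \<open>chart_at\<close>.\<close>

lemma C1_map_curve:
  assumes "a < b" "C1_curve \<A> a b \<gamma>" "open S" "C1_map_on \<A> S f" "\<gamma> ` {a..b} \<subseteq> S"
  shows "C1_curve \<A> a b (f \<circ> \<gamma>)"
    and "s \<in> {a..b} \<Longrightarrow> velocity \<A> a b (f \<circ> \<gamma>) s = tangent_map \<A> f (\<gamma> s) (velocity \<A> a b \<gamma> s)"
proof -
  have cont: "continuous_on {a..b} \<gamma>"
    using assms(2) by (rule C1_curve_continuous)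
  have f_cont: "continuous_on S f"
    using assms(4) by (simp add: C1_map_on_def)
  have cont': "continuous_on {a..b} (f \<circ> \<gamma>)"
    by (intro continuous_on_compose cont continuous_on_subset[OF f_cont assms(5)])
  have C1: "C_on 1 (snd d \<circ> f \<circ> chart_inv c) (snd c ` (S \<inter> fst c \<inter> f -` fst d))"
    if "c \<in> \<A>" "d \<in> \<A>" for c d
    using assms(4) that unfolding C1_map_on_def by blast
  have der: "((snd d \<circ> (f \<circ> \<gamma>)) has_vector_derivative
      frechet_derivative (snd d \<circ> f \<circ> chart_inv c) (at (snd c (\<gamma> s))) (velocity \<A> a b \<gamma> s c))
      (at s within {a..b})"
    if "c \<in> \<A>" "d \<in> \<A>" "s \<in> {a..b}" "\<gamma> s \<in> fst c" "f (\<gamma> s) \<in> fst d" for c d s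
  proof -
    have "((snd d \<circ> f) \<circ> chart_inv c) differentiable (at (snd c (\<gamma> s)))"
      using C1[OF that(1,2)] by (rule C_on_1_differentiable) (use that assms(5) in blast)
    then show ?thesis
      using has_vector_derivative_chart_curve[OF that(1,4) cont that(3), of "snd d \<circ> f"]
        C1_curve_has_vector_derivative[OF assms(2) that(3,1,4)] by (simp add: comp_assoc)
  qed
  show "C1_curve \<A> a b (f \<circ> \<gamma>)"
  proof (rule C1_curveI[OF \<open>a < b\<close> cont'])
    fix d s assume d: "d \<in> \<A>" and s: "s \<in> {a..b}" "(f \<circ> \<gamma>) s \<in> fst d"
    obtain c where c: "c \<in> \<A>" "\<gamma> s \<in> fst c"
      by (meson chart_exists)
    let ?J = "{s \<in> {a..b}. \<gamma> s \<in> fst c} \<inter> {s \<in> {a..b}. (f \<circ> \<gamma>) s \<in> fst d}"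
    let ?D = "\<lambda>s. frechet_derivative (snd d \<circ> f \<circ> chart_inv c) (at (snd c (\<gamma> s))) (velocity \<A> a b \<gamma> s c)"
    have "continuous_on ?J (\<lambda>s. snd c (\<gamma> s))"
      by (rule continuous_on_compose2[OF continuous_on_chart[OF c(1)] continuous_on_subset[OF cont]]) auto
    moreover have "continuous_on ?J (\<lambda>s. velocity \<A> a b \<gamma> s c)"
      by (rule continuous_on_subset[OF C1_curve_velocity_continuous[OF assms(2) c(1)]]) auto
    ultimately have "continuous_on ?J ?D"
      by (rule C_on_1_continuous_on_derivative[OF C1[OF c(1) d]]) (use assms(5) in \<open>auto intro!: imageI\<close>)
    moreover have "openin (top_of_set {a..b}) ?J"
      using cont cont' c d by (intro openin_Int openin_curve_preimage open_domain) auto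
    ultimately show "\<exists>J D. s \<in> J \<and> openin (top_of_set {a..b}) J \<and> continuous_on J D \<and>
        (\<forall>r\<in>J. ((snd d \<circ> (f \<circ> \<gamma>)) has_vector_derivative D r) (at r within {a..b}))"
      using s c(2) der[OF c(1) d] by (intro exI[of _ ?J] exI[of _ ?D]) simp
  qed
  assume s: "s \<in> {a..b}"
  show "velocity \<A> a b (f \<circ> \<gamma>) s = tangent_map \<A> f (\<gamma> s) (velocity \<A> a b \<gamma> s)"
  proof
    fix d
    show "velocity \<A> a b (f \<circ> \<gamma>) s d = tangent_map \<A> f (\<gamma> s) (velocity \<A> a b \<gamma> s) d"
    proof (cases "d \<in> \<A> \<and> f (\<gamma> s) \<in> fst d")
      case True
      then have "velocity \<A> a b (f \<circ> \<gamma>) s d = frechet_derivative (snd d \<circ> f \<circ> chart_inv (chart_at \<A> (\<gamma> s)))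
          (at (snd (chart_at \<A> (\<gamma> s)) (\<gamma> s))) (velocity \<A> a b \<gamma> s (chart_at \<A> (\<gamma> s)))"
        using \<open>a < b\<close> s by (intro velocity_eq[OF _ _ _ _ der] chart_at) auto
      then show ?thesis
        using True by (simp add: tangent_map_def Let_def)
    next
      case False
      then show ?thesis
        by (auto simp: velocity_def tangent_map_def Let_def)
    qed
  qed
qed

section \<open>Tangent vectors in coordinates\<close>

lemma tangent_space_combine:
  assumes "u \<in> tangent_space \<A> x" "v \<in> tangent_space \<A> x"
  shows "(\<lambda>c. a *\<^sub>R u c + b *\<^sub>R v c) \<in> tangent_space \<A> x"
  unfolding tangent_space_def
proof (intro CollectI conjI ballI allI impI)
  fix c d assume cd: "c \<in> \<A>" "d \<in> \<A>" "x \<in> fst c \<and> x \<in> fst d"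
  let ?L = "frechet_derivative (snd d \<circ> chart_inv c) (at (snd c x))"
  have "linear ?L"
    using cd by (intro linear_frechet_derivative transition_differentiable) auto
  moreover have "u d = ?L (u c)" "v d = ?L (v c)"
    using assms cd unfolding tangent_space_def by blast+
  ultimately show "a *\<^sub>R u d + b *\<^sub>R v d = ?L (a *\<^sub>R u c + b *\<^sub>R v c)"
    by (simp add: linear_add linear_cmul)
next
  fix c assume "\<not> (c \<in> \<A> \<and> x \<in> fst c)"
  then have "u c = 0" "v c = 0"
    using assms unfolding tangent_space_def by blast+
  then show "a *\<^sub>R u c + b *\<^sub>R v c = 0"
    by simp
qed

lemma tangent_space_zero: "(\<lambda>_. 0) \<in> tangent_space \<A> x"
  unfolding tangent_space_def
proof (intro CollectI conjI ballI allI impI)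
  fix c d assume cd: "c \<in> \<A>" "d \<in> \<A>" "x \<in> fst c \<and> x \<in> fst d"
  then have "linear (frechet_derivative (snd d \<circ> chart_inv c) (at (snd c x)))"
    by (intro linear_frechet_derivative transition_differentiable) auto
  then show "0 = frechet_derivative (snd d \<circ> chart_inv c) (at (snd c x)) 0"
    by (simp add: linear_0)
qed simp

lemma tangent_space_scale:
  "v \<in> tangent_space \<A> x \<Longrightarrow> (\<lambda>c. a *\<^sub>R v c) \<in> tangent_space \<A> x"
  using tangent_space_combine[of v x v a 0] by simp

lemma tangent_space_sum:
  assumes "finite I" "\<And>i. i \<in> I \<Longrightarrow> e i \<in> tangent_space \<A> x"
  shows "(\<lambda>c. \<Sum>i\<in>I. a i *\<^sub>R e i c) \<in> tangent_space \<A> x"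
  using assms
proof (induction I rule: finite_induct)
  case empty
  then show ?case by (simp add: tangent_space_zero)
next
  case (insert i I)
  then show ?case
    using tangent_space_combine[of "e i" x "\<lambda>c. \<Sum>i\<in>I. a i *\<^sub>R e i c" "a i" 1] by simp
qed

text \<open>The cocycle rule for changes of coordinates: the change from \<open>c\<close> to
  \<open>d'\<close> factors through \<open>d\<close> on the chart image of
  \<open>fst c \<inter> fst d\<close>, and the chain rule applies.\<close>

lemma coord_tvec_tangent:
  assumes "c \<in> \<A>" "x \<in> fst c"
  shows "coord_tvec \<A> c x u \<in> tangent_space \<A> x"
  unfolding tangent_space_def
proof (intro CollectI conjI ballI allI impI)
  fix d d' assume d: "d \<in> \<A>" "d' \<in> \<A>" "x \<in> fst d \<and> x \<in> fst d'"
  let ?S = "snd c ` (fst c \<inter> fst d)"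
  have diffs: "(snd d' \<circ> chart_inv d) differentiable (at ((snd d \<circ> chart_inv c) (snd c x)))"
      "(snd d \<circ> chart_inv c) differentiable (at (snd c x))"
    using assms d by (auto simp: chart_inv_chart intro!: transition_differentiable)
  then have "((snd d' \<circ> chart_inv d) \<circ> (snd d \<circ> chart_inv c) has_derivative
      frechet_derivative (snd d' \<circ> chart_inv d) (at ((snd d \<circ> chart_inv c) (snd c x))) \<circ>
      frechet_derivative (snd d \<circ> chart_inv c) (at (snd c x))) (at (snd c x))"
    by (intro diff_chain_at) (simp_all add: frechet_derivative_works)
  then have "((snd d' \<circ> chart_inv c) has_derivative
      frechet_derivative (snd d' \<circ> chart_inv d) (at ((snd d \<circ> chart_inv c) (snd c x))) \<circ>
      frechet_derivative (snd d \<circ> chart_inv c) (at (snd c x))) (at (snd c x))"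
  proof (rule has_derivative_transform_within_open)
    show "open ?S"
      using assms d by (intro open_chart_image_subset open_Int open_domain) auto
    show "snd c x \<in> ?S"
      using assms d by auto
    show "((snd d' \<circ> chart_inv d) \<circ> (snd d \<circ> chart_inv c)) y = (snd d' \<circ> chart_inv c) y" if "y \<in> ?S" for y
      using that assms(1) d by (auto simp: chart_inv_chart)
  qed
  then have "frechet_derivative (snd d' \<circ> chart_inv c) (at (snd c x)) =
      frechet_derivative (snd d' \<circ> chart_inv d) (at ((snd d \<circ> chart_inv c) (snd c x))) \<circ>
      frechet_derivative (snd d \<circ> chart_inv c) (at (snd c x))"
    by (rule frechet_derivative_at[symmetric])
  then show "coord_tvec \<A> c x u d' =
      frechet_derivative (snd d' \<circ> chart_inv d) (at (snd d x)) (coord_tvec \<A> c x u d)"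
    using assms d by (simp add: coord_tvec_def chart_inv_chart)
qed (auto simp: coord_tvec_def)

text \<open>One coordinate vector determines a tangent vector. The regularity of the metric is
  stated for coordinate vectors, and this transfers it to arbitrary tangent vectors.\<close>

lemma tangent_vector_coord:
  assumes "v \<in> tangent_space \<A> x" "c \<in> \<A>" "x \<in> fst c"
  shows "v = coord_tvec \<A> c x (v c)"
proof
  fix d
  show "v d = coord_tvec \<A> c x (v c) d"
  proof (cases "d \<in> \<A> \<and> x \<in> fst d")
    case True
    then have "v d = frechet_derivative (snd d \<circ> chart_inv c) (at (snd c x)) (v c)"
      using assms unfolding tangent_space_def by blast
    then show ?thesis
      unfolding coord_tvec_def if_P[OF True] .
  next
    case False
    then have "v d = 0"
      using assms(1) unfolding tangent_space_def by blast
    then show ?thesis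
      unfolding coord_tvec_def if_not_P[OF False] .
  qed
qed

lemma coord_tvec_combine:
  assumes "c \<in> \<A>" "x \<in> fst c"
  shows "coord_tvec \<A> c x u = (\<lambda>d. \<Sum>b\<in>Basis. (u \<bullet> b) *\<^sub>R coord_tvec \<A> c x b d)"
proof
  fix d
  show "coord_tvec \<A> c x u d = (\<Sum>b\<in>Basis. (u \<bullet> b) *\<^sub>R coord_tvec \<A> c x b d)"
  proof (cases "d \<in> \<A> \<and> x \<in> fst d")
    case True
    then show ?thesis
      using frechet_derivative_combine[OF transition_differentiable[OF assms(1) _ assms(2)], of d u]
      by (simp add: coord_tvec_def)
  next
    case False
    then show ?thesis
      by (simp only: coord_tvec_def if_False scaleR_zero_right sum.neutral_const)
  qed
qed

section \<open>Restriction and affine reparametrisation of curves\<close>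

lemma vector_derivative_within_cong:
  assumes "\<And>r. r \<in> T \<Longrightarrow> f r = h r" "s \<in> T"
  shows "vector_derivative f (at s within T) = vector_derivative h (at s within T)"
proof -
  have "(f has_vector_derivative D) (at s within T) \<longleftrightarrow> (h has_vector_derivative D) (at s within T)" for D
    using assms by (metis has_vector_derivative_transform)
  then show ?thesis
    by (simp add: vector_derivative_def)
qed

lemma velocity_cong:
  assumes "\<And>r. r \<in> {a..b} \<Longrightarrow> \<gamma> r = \<gamma>' r" "s \<in> {a..b}"
  shows "velocity \<A> a b \<gamma> s = velocity \<A> a b \<gamma>' s"
proof
  fix c :: "('a, 'e) chart"
  have "vector_derivative (snd c \<circ> \<gamma>) (at s within {a..b}) = vector_derivative (snd c \<circ> \<gamma>') (at s within {a..b})"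
    using assms by (intro vector_derivative_within_cong) auto
  then show "velocity \<A> a b \<gamma> s c = velocity \<A> a b \<gamma>' s c"
    using assms by (simp add: velocity_def)
qed

lemma C1_curve_velocityI:
  assumes "a < b" "continuous_on {a..b} \<gamma>"
    and "\<And>d. d \<in> \<A> \<Longrightarrow> continuous_on {s \<in> {a..b}. \<gamma> s \<in> fst d} (\<lambda>s. D s d)"
    and "\<And>d s. d \<in> \<A> \<Longrightarrow> s \<in> {a..b} \<Longrightarrow> \<gamma> s \<in> fst d \<Longrightarrow>
      ((snd d \<circ> \<gamma>) has_vector_derivative D s d) (at s within {a..b})"
  shows "C1_curve \<A> a b \<gamma>"
proof (rule C1_curveI[OF assms(1,2)])
  fix d s assume d: "d \<in> \<A>" and s: "s \<in> {a..b}" "\<gamma> s \<in> fst d"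
  let ?J = "{s \<in> {a..b}. \<gamma> s \<in> fst d}"
  have "openin (top_of_set {a..b}) ?J"
    using assms(2) d by (intro openin_curve_preimage open_domain) auto
  then show "\<exists>J D. s \<in> J \<and> openin (top_of_set {a..b}) J \<and> continuous_on J D \<and>
      (\<forall>r\<in>J. ((snd d \<circ> \<gamma>) has_vector_derivative D r) (at r within {a..b}))"
    using s assms(3)[OF d] assms(4)[OF d] by (intro exI[of _ ?J] exI[of _ "\<lambda>s. D s d"]) simp
qed

text \<open>With one-sided derivatives at the ends, only the values on the closed interval count;
  this allows curves to be spliced from different formulas.\<close>

lemma C1_curve_cong:
  assumes "a < b" "C1_curve \<A> a b \<gamma>" "\<And>r. r \<in> {a..b} \<Longrightarrow> \<gamma>' r = \<gamma> r"
  shows "C1_curve \<A> a b \<gamma>'"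
proof (rule C1_curve_velocityI[OF assms(1), where D="velocity \<A> a b \<gamma>"])
  show "continuous_on {a..b} \<gamma>'"
    using C1_curve_continuous[OF assms(2)] by (rule continuous_on_eq) (simp add: assms(3))
  show "continuous_on {s \<in> {a..b}. \<gamma>' s \<in> fst d} (\<lambda>s. velocity \<A> a b \<gamma> s d)" if "d \<in> \<A>" for d
    using C1_curve_velocity_continuous[OF assms(2) that] assms(3)
    by (auto elim!: continuous_on_subset)
  show "((snd d \<circ> \<gamma>') has_vector_derivative velocity \<A> a b \<gamma> s d) (at s within {a..b})"
    if "d \<in> \<A>" "s \<in> {a..b}" "\<gamma>' s \<in> fst d" for d s
  proof (rule has_vector_derivative_transform[OF that(2)])
    show "((snd d \<circ> \<gamma>) has_vector_derivative velocity \<A> a b \<gamma> s d) (at s within {a..b})"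
      using that assms(3) by (intro C1_curve_has_vector_derivative[OF assms(2)]) auto
  qed (simp add: assms(3))
qed

lemma C1_curve_subinterval:
  assumes "C1_curve \<A> a b \<gamma>" "a \<le> a'" "a' < b'" "b' \<le> b"
  shows "C1_curve \<A> a' b' \<gamma>"
    and "s \<in> {a'..b'} \<Longrightarrow> velocity \<A> a' b' \<gamma> s = velocity \<A> a b \<gamma> s"
proof -
  have sub: "{a'..b'} \<subseteq> {a..b}"
    using assms by auto
  have der: "((snd d \<circ> \<gamma>) has_vector_derivative velocity \<A> a b \<gamma> s d) (at s within {a'..b'})"
    if "d \<in> \<A>" "s \<in> {a'..b'}" "\<gamma> s \<in> fst d" for d s
    using C1_curve_has_vector_derivative[OF assms(1) _ that(1,3)] that(2) sub
    by (meson has_vector_derivative_within_subset subsetD)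
  show "C1_curve \<A> a' b' \<gamma>"
  proof (rule C1_curve_velocityI[OF assms(3) _ _ der])
    show "continuous_on {a'..b'} \<gamma>"
      using C1_curve_continuous[OF assms(1)] sub by (rule continuous_on_subset)
    show "continuous_on {s \<in> {a'..b'}. \<gamma> s \<in> fst d} (\<lambda>s. velocity \<A> a b \<gamma> s d)" if "d \<in> \<A>" for d
      using C1_curve_velocity_continuous[OF assms(1) that] by (rule continuous_on_subset) (use sub in auto)
  qed
  show "velocity \<A> a' b' \<gamma> s = velocity \<A> a b \<gamma> s" if s: "s \<in> {a'..b'}"
  proof
    fix d
    show "velocity \<A> a' b' \<gamma> s d = velocity \<A> a b \<gamma> s d"
    proof (cases "d \<in> \<A> \<and> \<gamma> s \<in> fst d")
      case True
      then show ?thesis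
        using velocity_eq[OF _ _ assms(3) s der] s by blast
    next
      case False
      then show ?thesis
        by (auto simp: velocity_def)
    qed
  qed
qed

text \<open>Covers the two reparametrisations used for lengths: the shift that makes two curves abut
  and, with \<open>m = -1\<close>, the reversal of a curve.\<close>

lemma C1_curve_affine:
  assumes "C1_curve \<A> a b \<gamma>" "a' < b'" "\<And>s. s \<in> {a'..b'} \<Longrightarrow> m * s + k \<in> {a..b}"
  shows "C1_curve \<A> a' b' (\<lambda>s. \<gamma> (m * s + k))"
    and "s \<in> {a'..b'} \<Longrightarrow>
      velocity \<A> a' b' (\<lambda>s. \<gamma> (m * s + k)) s = (\<lambda>c. m *\<^sub>R velocity \<A> a b \<gamma> (m * s + k) c)"
proof -
  let ?p = "\<lambda>s. m * s + k"
  have der: "((snd d \<circ> (\<lambda>s. \<gamma> (?p s))) has_vector_derivative m *\<^sub>R velocity \<A> a b \<gamma> (?p s) d)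
      (at s within {a'..b'})" if "d \<in> \<A>" "s \<in> {a'..b'}" "\<gamma> (?p s) \<in> fst d" for d s
  proof -
    have "(?p has_vector_derivative m) (at s within {a'..b'})"
      by (auto intro!: derivative_eq_intros simp: has_real_derivative_iff_has_vector_derivative[symmetric])
    moreover have "((snd d \<circ> \<gamma>) has_vector_derivative velocity \<A> a b \<gamma> (?p s) d) (at (?p s) within ?p ` {a'..b'})"
      using C1_curve_has_vector_derivative[OF assms(1) assms(3)[OF that(2)] that(1,3)]
      by (rule has_vector_derivative_within_subset) (use assms(3) in auto)
    ultimately have "((snd d \<circ> \<gamma>) \<circ> ?p has_vector_derivative m *\<^sub>R velocity \<A> a b \<gamma> (?p s) d) (at s within {a'..b'})"
      by (rule vector_diff_chain_within)
    then show ?thesis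
      by (simp add: comp_def)
  qed
  have p: "continuous_on T ?p" for T
    by (intro continuous_intros)
  show "C1_curve \<A> a' b' (\<lambda>s. \<gamma> (m * s + k))"
  proof (rule C1_curve_velocityI[OF assms(2) _ _ der])
    show "continuous_on {a'..b'} (\<lambda>s. \<gamma> (?p s))"
      by (rule continuous_on_compose2[OF C1_curve_continuous[OF assms(1)] p]) (use assms(3) in auto)
    show "continuous_on {s \<in> {a'..b'}. \<gamma> (?p s) \<in> fst d} (\<lambda>s. m *\<^sub>R velocity \<A> a b \<gamma> (?p s) d)"
      if "d \<in> \<A>" for d
      by (intro continuous_intros continuous_on_compose2[OF C1_curve_velocity_continuous[OF assms(1) that] p])
        (use assms(3) in auto)
  qed
  show "velocity \<A> a' b' (\<lambda>s. \<gamma> (?p s)) s = (\<lambda>c. m *\<^sub>R velocity \<A> a b \<gamma> (?p s) c)"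
    if s: "s \<in> {a'..b'}"
  proof
    fix d
    show "velocity \<A> a' b' (\<lambda>s. \<gamma> (?p s)) s d = m *\<^sub>R velocity \<A> a b \<gamma> (?p s) d"
    proof (cases "d \<in> \<A> \<and> \<gamma> (?p s) \<in> fst d")
      case True
      then show ?thesis
        using velocity_eq[OF _ _ assms(2) s der] s by blast
    next
      case False
      then show ?thesis
        by (auto simp: velocity_def)
    qed
  qed
qed

lemma chart_neighbourhood:
  assumes "open S" "x \<in> S"
  obtains c r where "c \<in> \<A>" "x \<in> fst c" "0 < r" "cball (snd c x) r \<subseteq> snd c ` (fst c \<inter> S)"
proof -
  obtain c where c: "c \<in> \<A>" "x \<in> fst c"
    by (meson chart_exists)
  have "open (snd c ` (fst c \<inter> S))"
    using c assms by (intro open_chart_image_subset open_Int open_domain) auto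
  then obtain r where "0 < r" "cball (snd c x) r \<subseteq> snd c ` (fst c \<inter> S)"
    using c assms open_contains_cball[of "snd c ` (fst c \<inter> S)"] by blast
  then show thesis
    using that c by blast
qed

lemma chart_inv_ball:
  assumes "c \<in> \<A>" "x \<in> fst c" "0 < r" "cball (snd c x) r \<subseteq> snd c ` (fst c \<inter> S)"
  shows "open (chart_inv c ` ball (snd c x) r)" "x \<in> chart_inv c ` ball (snd c x) r"
    "compact (chart_inv c ` cball (snd c x) r)" "chart_inv c ` cball (snd c x) r \<subseteq> S"
    "connected (chart_inv c ` ball (snd c x) r)"
proof -
  have sub: "cball (snd c x) r \<subseteq> snd c ` fst c" "ball (snd c x) r \<subseteq> snd c ` fst c"
    using assms(4) ball_subset_cball by blast+
  show "open (chart_inv c ` ball (snd c x) r)"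
    by (rule open_chart_inv_image[OF assms(1) open_ball sub(2)])
  show "x \<in> chart_inv c ` ball (snd c x) r"
    using assms(3) chart_inv_chart[OF assms(1,2)] by (intro image_eqI[where x="snd c x"]) auto
  show "compact (chart_inv c ` cball (snd c x) r)"
    by (rule compact_continuous_image[OF continuous_on_subset[OF continuous_on_chart_inv[OF assms(1)] sub(1)] compact_cball])
  show "chart_inv c ` cball (snd c x) r \<subseteq> S"
  proof
    fix z assume "z \<in> chart_inv c ` cball (snd c x) r"
    then obtain y where "z = chart_inv c (snd c y)" "y \<in> fst c" "y \<in> S"
      using assms(4) by blast
    then show "z \<in> S"
      using chart_inv_chart[OF assms(1)] by simp
  qed
  show "connected (chart_inv c ` ball (snd c x) r)"
    by (rule connected_continuous_image[OF continuous_on_subset[OF continuous_on_chart_inv[OF assms(1)] sub(2)] connected_ball])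
qed

lemma compact_neighbourhood:
  fixes x :: 'a
  assumes "open S" "x \<in> S"
  obtains V C where "open V" "x \<in> V" "V \<subseteq> C" "compact C" "C \<subseteq> S"
proof -
  obtain c r where c: "c \<in> \<A>" "x \<in> fst c" "0 < r" "cball (snd c x) r \<subseteq> snd c ` (fst c \<inter> S)"
    by (rule chart_neighbourhood[OF assms])
  show thesis
    using chart_inv_ball[OF c] by (intro that[of "chart_inv c ` ball (snd c x) r" "chart_inv c ` cball (snd c x) r"]) auto
qed

end

section \<open>Lengths of curves\<close>

text \<open>The set whose infimum is \<open>riemannian_dist\<close>. Its elements, unlike the
  infimum, can simply be added along concatenated curves, and existence of a connecting curve
  becomes a separate question: the infimum of an empty set of reals carries no information.\<close>

definition path_lengths ::
  "('a::topological_space, 'e::euclidean_space) chart set \<Rightarrow> ('a, 'e) metric \<Rightarrow> 'a \<Rightarrow> 'a \<Rightarrow> real set" where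
  "path_lengths \<A> g x y =
     {(\<Sum>i<n. curve_length \<A> g (ts i) (ts (Suc i)) \<sigma>) |(n::nat) ts \<sigma>.
        (\<forall>i<n. ts i < ts (Suc i) \<and> C1_curve \<A> (ts i) (ts (Suc i)) \<sigma>) \<and>
        \<sigma> (ts 0) = x \<and> \<sigma> (ts n) = y}"

section \<open>Norms, speeds and lengths in a chart\<close>

locale riemannian = atlas \<A>
  for \<A> :: "('a::{t2_space,second_countable_topology}, 'e::euclidean_space) chart set" +
  fixes g :: "('a, 'e) metric"
  assumes riemannian_metric: "riemannian_metric \<A> g"
begin

lemma metric_sym:
    "u \<in> tangent_space \<A> x \<Longrightarrow> v \<in> tangent_space \<A> x \<Longrightarrow> g x u v = g x v u"
  and metric_linear:
    "u \<in> tangent_space \<A> x \<Longrightarrow> v \<in> tangent_space \<A> x \<Longrightarrow> w \<in> tangent_space \<A> x \<Longrightarrow>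
      g x (\<lambda>c. a *\<^sub>R u c + b *\<^sub>R v c) w = a * g x u w + b * g x v w"
  and metric_positive:
    "v \<in> tangent_space \<A> x \<Longrightarrow> v \<noteq> (\<lambda>_. 0) \<Longrightarrow> 0 < g x v v"
  using riemannian_metric unfolding riemannian_metric_def by blast+

lemma metric_scale:
  "v \<in> tangent_space \<A> x \<Longrightarrow> w \<in> tangent_space \<A> x \<Longrightarrow> g x (\<lambda>c. a *\<^sub>R v c) w = a * g x v w"
  using metric_linear[of v x v w a 0] by simp

lemma metric_zero: "w \<in> tangent_space \<A> x \<Longrightarrow> g x (\<lambda>_. 0) w = 0"
  using metric_scale[of w x w 0] by simp

lemma metric_nonneg: "v \<in> tangent_space \<A> x \<Longrightarrow> 0 \<le> g x v v"
  using metric_positive[of v x] metric_zero[of v x] by (cases "v = (\<lambda>_. 0)") auto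

lemma metric_sum:
  assumes "finite I" "\<And>i. i \<in> I \<Longrightarrow> e i \<in> tangent_space \<A> x" "w \<in> tangent_space \<A> x"
  shows "g x (\<lambda>c. \<Sum>i\<in>I. a i *\<^sub>R e i c) w = (\<Sum>i\<in>I. a i * g x (e i) w)"
  using assms
proof (induction I rule: finite_induct)
  case empty
  then show ?case by (simp add: metric_zero)
next
  case (insert i I)
  then show ?case
    using metric_linear[of "e i" x "\<lambda>c. \<Sum>i\<in>I. a i *\<^sub>R e i c" w "a i" 1]
      tangent_space_sum[of I e x a] by simp
qed

lemma tnorm_nonneg: "v \<in> tangent_space \<A> x \<Longrightarrow> 0 \<le> tnorm g x v"
  by (simp add: tnorm_def metric_nonneg)

lemma tnorm_scale:
  assumes "v \<in> tangent_space \<A> x"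
  shows "tnorm g x (\<lambda>c. a *\<^sub>R v c) = \<bar>a\<bar> * tnorm g x v"
proof -
  have "g x (\<lambda>c. a *\<^sub>R v c) (\<lambda>c. a *\<^sub>R v c) = a * (a * g x v v)"
    using assms metric_sym[OF assms tangent_space_scale[OF assms]]
    by (simp add: metric_scale tangent_space_scale)
  then show ?thesis
    by (simp add: tnorm_def real_sqrt_mult mult.assoc[symmetric])
qed

text \<open>The squared norm of the tangent vector with coordinates \<open>w\<close> in the chart
  \<open>c\<close>, that is, the sum of g_ij w_i w_j at \<open>y\<close>. In this form it is jointly
  continuous in the point and the vector.\<close>

definition quad :: "('a, 'e) chart \<Rightarrow> 'e \<Rightarrow> 'e \<Rightarrow> real" where
  "quad c y w = (\<Sum>i\<in>Basis. \<Sum>j\<in>Basis. (w \<bullet> i) * (w \<bullet> j) *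
     g (chart_inv c y) (coord_tvec \<A> c (chart_inv c y) i) (coord_tvec \<A> c (chart_inv c y) j))"

lemma quad_eq:
  assumes "c \<in> \<A>" "x \<in> fst c" "v \<in> tangent_space \<A> x"
  shows "g x v v = quad c (snd c x) (v c)"
proof -
  let ?e = "coord_tvec \<A> c x"
  have e: "?e u \<in> tangent_space \<A> x" for u
    using assms(1,2) by (rule coord_tvec_tangent)
  have v: "v = (\<lambda>d. \<Sum>b\<in>Basis. (v c \<bullet> b) *\<^sub>R ?e b d)"
    using tangent_vector_coord[OF assms(3,1,2)] coord_tvec_combine[OF assms(1,2), of "v c"] by simp
  have 1: "g x v w = (\<Sum>i\<in>Basis. (v c \<bullet> i) * g x (?e i) w)" if "w \<in> tangent_space \<A> x" for w
  proof -
    have "g x (\<lambda>d. \<Sum>b\<in>Basis. (v c \<bullet> b) *\<^sub>R ?e b d) w = (\<Sum>i\<in>Basis. (v c \<bullet> i) * g x (?e i) w)"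
      by (rule metric_sum[OF finite_Basis e that])
    then show ?thesis
      unfolding v[symmetric] .
  qed
  then have "g x v v = (\<Sum>i\<in>Basis. (v c \<bullet> i) * g x v (?e i))"
    using assms(3) metric_sym[OF assms(3) e] by simp
  also have "\<dots> = (\<Sum>i\<in>Basis. (v c \<bullet> i) * (\<Sum>j\<in>Basis. (v c \<bullet> j) * g x (?e j) (?e i)))"
    by (simp add: 1 e)
  also have "\<dots> = (\<Sum>i\<in>Basis. \<Sum>j\<in>Basis. (v c \<bullet> i) * (v c \<bullet> j) * g x (?e i) (?e j))"
    using metric_sym[OF e e] by (simp add: sum_distrib_left mult.assoc)
  finally show ?thesis
    using assms by (simp add: quad_def chart_inv_chart)
qed

lemma continuous_on_quad:
  assumes "c \<in> \<A>" "continuous_on T p" "continuous_on T w" "p ` T \<subseteq> snd c ` fst c"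
  shows "continuous_on T (\<lambda>s. quad c (p s) (w s))"
proof -
  have polar: "smooth_on (\<lambda>y. g (chart_inv c y) (coord_tvec \<A> c (chart_inv c y) u)
      (coord_tvec \<A> c (chart_inv c y) v)) (snd c ` fst c)" for u v
    using riemannian_metric assms(1) unfolding riemannian_metric_def by blast
  have "continuous_on (snd c ` fst c) (\<lambda>y. g (chart_inv c y) (coord_tvec \<A> c (chart_inv c y) u)
      (coord_tvec \<A> c (chart_inv c y) v))" for u v
    using polar[of u v, unfolded smooth_on_def, THEN spec, of 0] unfolding C_on.simps .
  then have "continuous_on T (\<lambda>s. g (chart_inv c (p s)) (coord_tvec \<A> c (chart_inv c (p s)) u)
      (coord_tvec \<A> c (chart_inv c (p s)) v))" for u v
    using assms(2,4) by (rule continuous_on_compose2)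
  then show ?thesis
    unfolding quad_def by (intro continuous_on_sum continuous_on_mult continuous_on_inner
        continuous_on_const assms(3))
qed

definition speed :: "real \<Rightarrow> real \<Rightarrow> (real \<Rightarrow> 'a) \<Rightarrow> real \<Rightarrow> real" where
  "speed a b \<gamma> s = tnorm g (\<gamma> s) (velocity \<A> a b \<gamma> s)"

lemma curve_length_speed: "curve_length \<A> g a b \<gamma> = integral {a..b} (speed a b \<gamma>)"
  by (simp add: curve_length_def speed_def[abs_def])

lemma speed_eq:
  assumes "C1_curve \<A> a b \<gamma>" "a < b" "s \<in> {a..b}" "c \<in> \<A>" "\<gamma> s \<in> fst c"
  shows "speed a b \<gamma> s = sqrt (quad c (snd c (\<gamma> s)) (velocity \<A> a b \<gamma> s c))"
  using quad_eq[OF assms(4,5) velocity_tangent[OF assms(1-3)]] by (simp add: speed_def tnorm_def)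

lemma speed_nonneg:
  assumes "C1_curve \<A> a b \<gamma>" "a < b" "s \<in> {a..b}"
  shows "0 \<le> speed a b \<gamma> s"
  unfolding speed_def by (rule tnorm_nonneg[OF velocity_tangent[OF assms]])

lemma continuous_on_speed:
  assumes "C1_curve \<A> a b \<gamma>" "a < b"
  shows "continuous_on {a..b} (speed a b \<gamma>)"
proof (rule continuous_on_open_pieces)
  fix s assume s: "s \<in> {a..b}"
  obtain c where c: "c \<in> \<A>" "\<gamma> s \<in> fst c"
    by (meson chart_exists)
  let ?J = "{s \<in> {a..b}. \<gamma> s \<in> fst c}"
  have "continuous_on ?J (\<lambda>s. snd c (\<gamma> s))"
    by (rule continuous_on_compose2[OF continuous_on_chart[OF c(1)]
          continuous_on_subset[OF C1_curve_continuous[OF assms(1)]]]) auto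
  then have "continuous_on ?J (\<lambda>s. sqrt (quad c (snd c (\<gamma> s)) (velocity \<A> a b \<gamma> s c)))"
    by (intro continuous_intros continuous_on_quad[OF c(1)] C1_curve_velocity_continuous[OF assms(1) c(1)]) auto
  then have "continuous_on ?J (speed a b \<gamma>)"
    by (rule continuous_on_eq) (use speed_eq[OF assms _ c(1)] in auto)
  moreover have "openin (top_of_set {a..b}) ?J"
    using C1_curve_continuous[OF assms(1)] open_domain[OF c(1)] by (rule openin_curve_preimage)
  ultimately show "\<exists>J. s \<in> J \<and> openin (top_of_set {a..b}) J \<and> continuous_on J (speed a b \<gamma>)"
    using s c by (intro exI[of _ ?J]) simp
qed

lemma speed_has_integral:
  assumes "C1_curve \<A> a b \<gamma>" "a < b"
  shows "(speed a b \<gamma> has_integral curve_length \<A> g a b \<gamma>) {a..b}"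
  unfolding curve_length_speed
  using integrable_continuous_interval[OF continuous_on_speed[OF assms]] by (rule integrable_integral)

lemma curve_length_nonneg:
  assumes "C1_curve \<A> a b \<gamma>" "a < b"
  shows "0 \<le> curve_length \<A> g a b \<gamma>"
  by (rule has_integral_nonneg[OF speed_has_integral[OF assms] speed_nonneg[OF assms]])

lemma curve_length_cong:
  assumes "\<And>r. r \<in> {a..b} \<Longrightarrow> \<gamma>' r = \<gamma> r"
  shows "curve_length \<A> g a b \<gamma>' = curve_length \<A> g a b \<gamma>"
  unfolding curve_length_def
proof (rule integral_cong)
  fix s assume s: "s \<in> {a..b}"
  then show "tnorm g (\<gamma>' s) (velocity \<A> a b \<gamma>' s) = tnorm g (\<gamma> s) (velocity \<A> a b \<gamma> s)"
    using assms[OF s] velocity_cong[OF assms s] by simp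
qed

lemma curve_length_subinterval:
  assumes "C1_curve \<A> a b \<gamma>" "a \<le> a'" "a' < b'" "b' \<le> b"
  shows "curve_length \<A> g a' b' \<gamma> \<le> curve_length \<A> g a b \<gamma>"
proof -
  have "integral {a'..b'} (speed a' b' \<gamma>) = integral {a'..b'} (speed a b \<gamma>)"
    by (rule integral_cong) (simp add: speed_def C1_curve_subinterval(2)[OF assms])
  also have "\<dots> \<le> integral {a..b} (speed a b \<gamma>)"
  proof (rule integral_subset_le)
    show "{a'..b'} \<subseteq> {a..b}"
      using assms by auto
    then show "speed a b \<gamma> integrable_on {a'..b'}"
      using assms by (intro integrable_continuous_interval continuous_on_subset[OF continuous_on_speed]) auto
    show "speed a b \<gamma> integrable_on {a..b}"
      using assms by (intro integrable_continuous_interval continuous_on_speed) auto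
    show "\<forall>x\<in>{a..b}. 0 \<le> speed a b \<gamma> x"
      using assms by (intro ballI speed_nonneg) auto
  qed
  finally show ?thesis
    by (simp add: curve_length_speed)
qed

text \<open>An isometry of the parameter line only relocates the speed: the factor
  \<open>\<bar>m\<bar>\<close> acquired by the velocity is one, and so is the Jacobian of the
  substitution.\<close>

lemma curve_length_affine:
  assumes "C1_curve \<A> a b \<gamma>" "a < b" "a' < b'" "\<bar>m\<bar> = 1" "(\<lambda>s. m * s + k) ` {a'..b'} = {a..b}"
  shows "curve_length \<A> g a' b' (\<lambda>s. \<gamma> (m * s + k)) = curve_length \<A> g a b \<gamma>"
proof -
  let ?\<gamma> = "\<lambda>s. \<gamma> (m * s + k)"
  have p: "m * s + k \<in> {a..b}" if "s \<in> {a'..b'}" for s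
    using assms(5) that by blast
  have sp: "speed a' b' ?\<gamma> s = speed a b \<gamma> (m * s + k)" if s: "s \<in> {a'..b'}" for s
    using C1_curve_affine(2)[OF assms(1,3) p s] tnorm_scale[OF velocity_tangent[OF assms(1,2) p[OF s]]] assms(4)
    by (simp add: speed_def)
  have mm: "m * m = 1"
    using abs_mult_self_eq[of m] assms(4) by simp
  then have m0: "m \<noteq> 0" "1 / m = m"
    by (auto simp: divide_simps)
  have "(\<lambda>x. (1 / m) *\<^sub>R x + - ((1 / m) *\<^sub>R k)) ` cbox a b = {a'..b'}"
  proof -
    have "(\<lambda>x. (1 / m) *\<^sub>R x + - ((1 / m) *\<^sub>R k)) ` (\<lambda>s. m * s + k) ` {a'..b'} = {a'..b'}"
      by (simp add: image_image m0 ring_distribs mm flip: mult.assoc)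
    then show ?thesis
      using assms(5) by (simp add: cbox_interval)
  qed
  then have "((\<lambda>x. speed a b \<gamma> (m *\<^sub>R x + k)) has_integral curve_length \<A> g a b \<gamma>) {a'..b'}"
    using has_integral_affinity[of "speed a b \<gamma>" "curve_length \<A> g a b \<gamma>" a b m k]
      speed_has_integral[OF assms(1,2)] m0 assms(4) by (simp add: cbox_interval)
  then have "(speed a' b' ?\<gamma> has_integral curve_length \<A> g a b \<gamma>) {a'..b'}"
    by (rule has_integral_eq[rotated]) (simp add: sp)
  then show ?thesis
    unfolding curve_length_speed[of a' b'] by (rule integral_unique)
qed

section \<open>Concatenation of curves and the Riemannian distance\<close>

lemma path_lengths_refl: "0 \<in> path_lengths \<A> g x x"
  unfolding path_lengths_def by (rule CollectI, rule exI[of _ "0::nat"]) auto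

text \<open>A piecewise curve is one map with increasing break points, so the appended curve has to
  be shifted to start where the old parameter interval ends.\<close>

lemma path_lengths_append:
  assumes "L \<in> path_lengths \<A> g x y" "C1_curve \<A> a b \<tau>" "a < b" "\<tau> a = y" "\<tau> b = z"
  shows "L + curve_length \<A> g a b \<tau> \<in> path_lengths \<A> g x z"
proof -
  obtain n :: nat and ts \<sigma> where L: "L = (\<Sum>i<n. curve_length \<A> g (ts i) (ts (Suc i)) \<sigma>)"
    and seg: "\<And>i. i < n \<Longrightarrow> ts i < ts (Suc i)" "\<And>i. i < n \<Longrightarrow> C1_curve \<A> (ts i) (ts (Suc i)) \<sigma>"
    and ends: "\<sigma> (ts 0) = x" "\<sigma> (ts n) = y"
    using assms(1) unfolding path_lengths_def by blast
  have mono: "ts i \<le> ts n" if "i \<le> n" for i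
    using that
  proof (induction rule: inc_induct)
    case (step i)
    then show ?case
      using seg(1)[of i] by simp
  qed simp
  \<comment> \<open>The shift by \<open>k\<close> moves the start \<open>a\<close> of
    \<open>\<tau>\<close> to the last break point \<open>ts n\<close>; its end then becomes
    \<open>b - k\<close>.\<close>
  define k where "k = a - ts n"
  define \<tau>' where "\<tau>' s = \<tau> (1 * s + k)" for s
  define ts' where "ts' = ts(Suc n := b - k)"
  define \<sigma>' where "\<sigma>' s = (if s \<le> ts n then \<sigma> s else \<tau>' s)" for s
  have ab: "ts n < b - k"
    using assms(3) by (simp add: k_def)
  have img: "(\<lambda>s. 1 * s + k) ` {ts n..b - k} = {a..b}"
    by (auto simp: k_def image_iff intro: bexI[of _ "_ - a + ts n"])
  have \<tau>': "C1_curve \<A> (ts n) (b - k) \<tau>'"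
    unfolding \<tau>'_def using C1_curve_affine(1)[OF assms(2) ab, of 1 k] img by blast
  have len: "curve_length \<A> g (ts n) (b - k) \<tau>' = curve_length \<A> g a b \<tau>"
    unfolding \<tau>'_def by (rule curve_length_affine[OF assms(2,3) ab _ img]) simp
  have old: "\<sigma>' r = \<sigma> r" if "i < n" "r \<in> {ts i..ts (Suc i)}" for i r
    using mono[of "Suc i"] that by (simp add: \<sigma>'_def)
  \<comment> \<open>At the common break point \<open>\<sigma>'\<close> is given by
    \<open>\<sigma>\<close>, but both curves pass through \<open>y\<close> there, so it agrees with
    \<open>\<tau>'\<close> on the whole closed interval.\<close>
  have new: "\<sigma>' r = \<tau>' r" if "r \<in> {ts n..b - k}" for r
    using that ends(2) assms(4) by (cases "r = ts n") (auto simp: \<sigma>'_def \<tau>'_def k_def)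
  have "(\<Sum>i<Suc n. curve_length \<A> g (ts' i) (ts' (Suc i)) \<sigma>') = L + curve_length \<A> g a b \<tau>"
  proof -
    have "(\<Sum>i<n. curve_length \<A> g (ts' i) (ts' (Suc i)) \<sigma>') = L"
      unfolding L by (rule sum.cong[OF refl]) (use old in \<open>auto simp: ts'_def intro!: curve_length_cong\<close>)
    moreover have "curve_length \<A> g (ts' n) (ts' (Suc n)) \<sigma>' = curve_length \<A> g (ts n) (b - k) \<tau>'"
      using new by (auto simp: ts'_def intro!: curve_length_cong)
    ultimately show ?thesis
      using len by simp
  qed
  moreover have "ts' i < ts' (Suc i) \<and> C1_curve \<A> (ts' i) (ts' (Suc i)) \<sigma>'" if "i < Suc n" for i
  proof (cases "i = n")
    case True
    then show ?thesis
      using C1_curve_cong[OF ab \<tau>' new] ab by (simp add: ts'_def)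
  next
    case False
    then have i: "i < n"
      using that by simp
    then show ?thesis
      using C1_curve_cong[OF seg(1)[OF i] seg(2)[OF i] old[OF i]] seg(1)[OF i] by (simp add: ts'_def)
  qed
  moreover have "\<sigma>' (ts' 0) = x"
    using mono[of 0] ends by (simp add: \<sigma>'_def ts'_def)
  moreover have "\<sigma>' (ts' (Suc n)) = z"
    using new[of "b - k"] ab assms(5) by (simp add: ts'_def \<tau>'_def)
  ultimately show ?thesis
    unfolding path_lengths_def
    by (intro CollectI exI[of _ "Suc n"] exI[of _ ts'] exI[of _ \<sigma>']) simp
qed

lemma riemannian_dist_le:
  assumes "L \<in> path_lengths \<A> g x y"
  shows "riemannian_dist \<A> g x y \<le> L"
proof -
  have "0 \<le> l" if "l \<in> path_lengths \<A> g x y" for l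
    using that unfolding path_lengths_def by (auto intro!: sum_nonneg curve_length_nonneg)
  then have "bdd_below (path_lengths \<A> g x y)"
    by (meson bdd_belowI)
  then have "Inf (path_lengths \<A> g x y) \<le> L"
    using assms by (intro cInf_lower) auto
  then show ?thesis
    by (simp add: riemannian_dist_def path_lengths_def)
qed

text \<open>The curve is traversed backwards when \<open>r < s\<close>.\<close>

lemma path_lengths_along_curve:
  assumes "L \<in> path_lengths \<A> g x (\<gamma> s)" "C1_curve \<A> a b \<gamma>" "a < b" "s \<in> {a..b}" "r \<in> {a..b}"
  shows "\<exists>L'\<in>path_lengths \<A> g x (\<gamma> r). L' \<le> L + curve_length \<A> g a b \<gamma>"
proof (cases s r rule: linorder_cases)
  case equal
  then show ?thesis
    using assms curve_length_nonneg[OF assms(2,3)] by (intro bexI[of _ L]) auto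
next
  case less
  have "L + curve_length \<A> g s r \<gamma> \<in> path_lengths \<A> g x (\<gamma> r)"
    using assms less by (intro path_lengths_append[OF assms(1) C1_curve_subinterval(1)[OF assms(2)]]) auto
  moreover have "curve_length \<A> g s r \<gamma> \<le> curve_length \<A> g a b \<gamma>"
    using assms less by (intro curve_length_subinterval) auto
  ultimately show ?thesis
    by (intro bexI) auto
next
  case greater
  have sub: "C1_curve \<A> r s \<gamma>"
    using assms greater by (intro C1_curve_subinterval(1)[OF assms(2)]) auto
  have img: "(\<lambda>u. - 1 * u + 0) ` {-s..-r} = {r..s}"
    by (auto simp: image_iff intro: bexI[of _ "- _"])
  have "C1_curve \<A> (-s) (-r) (\<lambda>u. \<gamma> (- 1 * u + 0))"
    using C1_curve_affine(1)[OF sub, of "-s" "-r" "-1" 0] greater by simp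
  then have "L + curve_length \<A> g (-s) (-r) (\<lambda>u. \<gamma> (- 1 * u + 0)) \<in> path_lengths \<A> g x (\<gamma> r)"
    using greater by (intro path_lengths_append[OF assms(1)]) auto
  moreover have "curve_length \<A> g (-s) (-r) (\<lambda>u. \<gamma> (- 1 * u + 0)) = curve_length \<A> g r s \<gamma>"
    using greater by (intro curve_length_affine[OF sub _ _ _ img]) auto
  moreover have "curve_length \<A> g r s \<gamma> \<le> curve_length \<A> g a b \<gamma>"
    using assms greater by (intro curve_length_subinterval) auto
  ultimately show ?thesis
    by (intro bexI) auto
qed

text \<open>The curves are straight segments in a chart ball. Their squared speed is
  \<open>quad\<close> at a point of the closed ball and a difference of two points of the ball, of
  norm at most \<open>2 * r\<close>. On this compact set \<open>quad\<close> is bounded by some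
  \<open>K\<close>, whence the common bound \<open>sqrt K\<close>.\<close>

lemma segment_neighbourhood:
  fixes x :: 'a
  obtains N M where "open N" "x \<in> N"
    "\<And>y z. y \<in> N \<Longrightarrow> z \<in> N \<Longrightarrow> \<exists>\<tau>. C1_curve \<A> 0 1 \<tau> \<and> \<tau> 0 = y \<and> \<tau> 1 = z \<and> curve_length \<A> g 0 1 \<tau> \<le> M"
proof -
  obtain c r where c: "c \<in> \<A>" "x \<in> fst c" "0 < r" "cball (snd c x) r \<subseteq> snd c ` (fst c \<inter> UNIV)"
    by (rule chart_neighbourhood[of UNIV x]) auto
  let ?B = "ball (snd c x) r" and ?C = "cball (snd c x) r \<times> cball (0::'e) (2 * r)"
  have C_sub: "cball (snd c x) r \<subseteq> snd c ` fst c" and B_sub: "?B \<subseteq> snd c ` fst c"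
    using c(4) ball_subset_cball by auto
  have "continuous_on ?C (\<lambda>p. quad c (fst p) (snd p))"
    using C_sub by (intro continuous_on_quad[OF c(1)] continuous_intros) auto
  then have "bounded ((\<lambda>p. quad c (fst p) (snd p)) ` ?C)"
    by (intro compact_imp_bounded compact_continuous_image compact_Times compact_cball)
  then obtain K where "\<forall>q\<in>(\<lambda>p. quad c (fst p) (snd p)) ` ?C. \<bar>q\<bar> \<le> K"
    unfolding bounded_real ..
  then have K: "\<bar>quad c (fst p) (snd p)\<bar> \<le> K" if "p \<in> ?C" for p
    using that by auto
  show thesis
  proof (rule that[of "chart_inv c ` ?B" "sqrt K"])
    show "open (chart_inv c ` ?B)" "x \<in> chart_inv c ` ?B"
      using chart_inv_ball[OF c] by auto
  next
    fix y z assume "y \<in> chart_inv c ` ?B" "z \<in> chart_inv c ` ?B"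
    then obtain y' z' where y': "y' \<in> ?B" "y = chart_inv c y'" and z': "z' \<in> ?B" "z = chart_inv c z'"
      by blast
    define p where "p s = y' + s *\<^sub>R (z' - y')" for s :: real
    have p: "p s \<in> ?B" if "s \<in> {0..1}" for s
    proof -
      have "p s = (1 - s) *\<^sub>R y' + s *\<^sub>R z'"
        by (simp add: p_def algebra_simps)
      then show ?thesis
        using convexD_alt[OF convex_ball y'(1) z'(1), of s] that by simp
    qed
    have pI: "p ` {0..1} \<subseteq> snd c ` fst c"
      using p B_sub by blast
    have pd: "(p has_vector_derivative z' - y') (at s within {0..1})" for s
      unfolding p_def by (auto intro!: derivative_eq_intros)
    define \<tau> where "\<tau> = chart_inv c \<circ> p"
    have \<tau>: "C1_curve \<A> 0 1 \<tau>" "s \<in> {0..1} \<Longrightarrow> velocity \<A> 0 1 \<tau> s c = z' - y'" for s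
      unfolding \<tau>_def using C1_curve_chart[of 0 1 c p "\<lambda>_. z' - y'", OF _ c(1) pI _ pd] by auto
    have "speed 0 1 \<tau> s \<le> sqrt K" if s: "s \<in> {0..1}" for s
    proof -
      have ps: "p s \<in> snd c ` fst c"
        using pI s by blast
      have "\<tau> s \<in> fst c" "snd c (\<tau> s) = p s"
        using chart_inv_domain[OF c(1) ps] chart_chart_inv[OF c(1) ps] by (simp_all add: \<tau>_def)
      then have "speed 0 1 \<tau> s = sqrt (quad c (p s) (z' - y'))"
        using speed_eq[OF \<tau>(1) _ s c(1)] \<tau>(2)[OF s] by simp
      moreover have "norm (z' - y') \<le> 2 * r"
        using y'(1) z'(1) dist_triangle2[of z' y' "snd c x"] by (simp add: dist_norm[symmetric] dist_commute)
      then have "\<bar>quad c (p s) (z' - y')\<bar> \<le> K"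
        using K[of "(p s, z' - y')"] p[OF s] by simp
      ultimately show ?thesis
        by (simp add: abs_le_iff)
    qed
    then have "curve_length \<A> g 0 1 \<tau> \<le> sqrt K"
      using has_integral_le[OF speed_has_integral[OF \<tau>(1)], of "\<lambda>_. sqrt K" "sqrt K"]
        has_integral_const_real[of "sqrt K" 0 1] by simp
    then show "\<exists>\<tau>. C1_curve \<A> 0 1 \<tau> \<and> \<tau> 0 = y \<and> \<tau> 1 = z \<and> curve_length \<A> g 0 1 \<tau> \<le> sqrt K"
      using \<tau>(1) y' z' by (intro exI[of _ \<tau>]) (simp add: \<tau>_def p_def)
  qed
qed

text \<open>Reachability by piecewise C^1 curves is locally constant by the segments above, hence
  constant on a connected space.\<close>

lemma path_lengths_nonempty:
  assumes "connected (UNIV :: 'a set)"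
  shows "path_lengths \<A> g x y \<noteq> {}"
proof (rule connected_induction_simple[OF assms UNIV_I UNIV_I])
  show "path_lengths \<A> g x x \<noteq> {}"
    using path_lengths_refl by blast
next
  fix u :: 'a
  obtain N M where N: "open N" "u \<in> N"
    "\<And>y z. y \<in> N \<Longrightarrow> z \<in> N \<Longrightarrow> \<exists>\<tau>. C1_curve \<A> 0 1 \<tau> \<and> \<tau> 0 = y \<and> \<tau> 1 = z \<and> curve_length \<A> g 0 1 \<tau> \<le> M"
    by (rule segment_neighbourhood[where x=u]) (rule that)
  have 1: "path_lengths \<A> g x z \<noteq> {}" if yz: "y \<in> N" "z \<in> N" "path_lengths \<A> g x y \<noteq> {}" for y z
  proof -
    obtain \<tau> where "C1_curve \<A> 0 1 \<tau>" "\<tau> 0 = y" "\<tau> 1 = z"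
      using N(3)[OF yz(1,2)] by blast
    moreover obtain L where "L \<in> path_lengths \<A> g x y"
      using yz(3) by blast
    ultimately have "L + curve_length \<A> g 0 1 \<tau> \<in> path_lengths \<A> g x z"
      by (intro path_lengths_append[of L x y 0 1 \<tau> z]) auto
    then show ?thesis
      by blast
  qed
  show "\<exists>T. openin (top_of_set UNIV) T \<and> u \<in> T \<and>
      (\<forall>y\<in>T. \<forall>z\<in>T. path_lengths \<A> g x y \<noteq> {} \<longrightarrow> path_lengths \<A> g x z \<noteq> {})"
  proof (intro exI[of _ N] conjI ballI impI)
    show "openin (top_of_set UNIV) N"
      using N(1) by simp
  qed (rule N(2), rule 1)
qed

text \<open>Finitely many segment neighbourhoods cover \<open>C\<close>, and every point of one of
  them is reached through its centre at bounded cost. So compact sets are bounded for the Riemannian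
  distance, without any comparison of its topology with the given one.\<close>

lemma path_lengths_compact:
  assumes "connected (UNIV :: 'a set)" "compact C"
  obtains R where "\<And>z. z \<in> C \<Longrightarrow> \<exists>L\<in>path_lengths \<A> g x z. L \<le> R"
proof -
  define Q where "Q u N R \<longleftrightarrow> open N \<and> u \<in> N \<and> (\<forall>z\<in>N. \<exists>L\<in>path_lengths \<A> g x z. L \<le> R)" for u N R
  have "\<exists>N R. Q u N R" for u
  proof -
    obtain N M where N: "open N" "u \<in> N"
      "\<And>y z. y \<in> N \<Longrightarrow> z \<in> N \<Longrightarrow> \<exists>\<tau>. C1_curve \<A> 0 1 \<tau> \<and> \<tau> 0 = y \<and> \<tau> 1 = z \<and> curve_length \<A> g 0 1 \<tau> \<le> M"
      by (rule segment_neighbourhood[where x=u]) (rule that)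
    obtain L where L: "L \<in> path_lengths \<A> g x u"
      using path_lengths_nonempty[OF assms(1)] by blast
    have "\<exists>L'\<in>path_lengths \<A> g x z. L' \<le> L + M" if z: "z \<in> N" for z
    proof -
      obtain \<tau> where \<tau>: "C1_curve \<A> 0 1 \<tau>" "\<tau> 0 = u" "\<tau> 1 = z" "curve_length \<A> g 0 1 \<tau> \<le> M"
        using N(3)[OF N(2) z] by blast
      then show ?thesis
        using path_lengths_append[OF L \<tau>(1) _ \<tau>(2,3)] by (intro bexI) auto
    qed
    then show ?thesis
      using N(1,2) unfolding Q_def by (intro exI[of _ N] exI[of _ "L + M"]) auto
  qed
  then obtain N R where "\<And>u. Q u (N u) (R u)"
    by metis
  then have NR: "\<And>u. open (N u)" "\<And>u. u \<in> N u"
    "\<And>u z. z \<in> N u \<Longrightarrow> \<exists>L\<in>path_lengths \<A> g x z. L \<le> R u"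
    unfolding Q_def by blast+
  have "C \<subseteq> (\<Union>u\<in>C. N u)"
    using NR(2) by blast
  then obtain I where I: "finite I" "C \<subseteq> (\<Union>u\<in>I. N u)"
    by (rule compactE_image[OF assms(2) NR(1)])
  show thesis
  proof (rule that)
    fix z assume "z \<in> C"
    then obtain u where u: "u \<in> I" "z \<in> N u"
      using I(2) by blast
    then have "R u \<le> Max (R ` I)"
      using I(1) by simp
    then show "\<exists>L\<in>path_lengths \<A> g x z. L \<le> Max (R ` I)"
      using NR(3)[OF u(2)] by (meson order_trans)
  qed
qed

end

section \<open>Paths of the flow\<close>

text \<open>The almost sure part of \<open>partial_flow\<close> for a single \<open>\<omega>\<close>, without the convergence of
  the derivatives.\<close>

definition flow_path ::
  "('a::topological_space, 'e::euclidean_space) chart set \<Rightarrow> (real \<Rightarrow> 'a \<Rightarrow> 'a) \<Rightarrow> ('a \<Rightarrow> ereal) \<Rightarrow> bool" where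
  "flow_path \<A> f \<zeta> \<longleftrightarrow>
     (\<forall>x. 0 < \<zeta> x \<and> f 0 x = x) \<and>
     (\<forall>t\<ge>0. C1_diffeo_on \<A> {x. ereal t < \<zeta> x} (f t)) \<and>
     (\<forall>s\<ge>0. \<forall>c\<in>\<A>. \<forall>d\<in>\<A>. \<forall>C.
        compact C \<and> C \<subseteq> fst c \<and> C \<subseteq> {x. ereal s < \<zeta> x} \<and> f s ` C \<subseteq> fst d \<longrightarrow>
        (\<forall>\<epsilon>>0. eventually (\<lambda>t. C \<subseteq> {x. ereal t < \<zeta> x} \<and> f t ` C \<subseteq> fst d \<and>
           (\<forall>x\<in>C. norm (snd d (f t x) - snd d (f s x)) < \<epsilon>)) (at s within {0..})))"

lemma flow_path_initial: "flow_path \<A> f \<zeta> \<Longrightarrow> f 0 x = x"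
  and flow_path_lifetime_pos: "flow_path \<A> f \<zeta> \<Longrightarrow> 0 < \<zeta> x"
  and flow_path_diffeo: "flow_path \<A> f \<zeta> \<Longrightarrow> 0 \<le> t \<Longrightarrow> C1_diffeo_on \<A> {x. ereal t < \<zeta> x} (f t)"
  by (auto simp: flow_path_def)

lemma flow_path_domain_open: "flow_path \<A> f \<zeta> \<Longrightarrow> 0 \<le> t \<Longrightarrow> open {x. ereal t < \<zeta> x}"
  using flow_path_diffeo unfolding C1_diffeo_on_def by blast

lemma flow_path_C1_map: "flow_path \<A> f \<zeta> \<Longrightarrow> 0 \<le> t \<Longrightarrow> C1_map_on \<A> {x. ereal t < \<zeta> x} (f t)"
  using flow_path_diffeo unfolding C1_diffeo_on_def by blast

section \<open>Uniformity of a flow path in time and space\<close>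

context atlas
begin

text \<open>Continuity in time is given for compact sets inside charts. A compact neighbourhood of
  \<open>x\<close> that time \<open>s\<close> maps into a chart around \<open>f s x\<close> turns it
  into a statement about all nearby times and points. Half of the radius \<open>r\<close> pays for
  moving the point at time \<open>s\<close>, the other half for moving the time.\<close>

lemma flow_path_local:
  assumes flow: "flow_path \<A> f \<zeta>" and s: "0 \<le> s" "ereal s < \<zeta> x" and N: "open N" "f s x \<in> N"
  obtains \<delta> W where "0 < \<delta>" "open W" "x \<in> W"
    "\<And>t y. 0 \<le> t \<Longrightarrow> \<bar>t - s\<bar> < \<delta> \<Longrightarrow> y \<in> W \<Longrightarrow> ereal t < \<zeta> y \<and> f t y \<in> N"
proof -
  let ?S = "{y. ereal s < \<zeta> y}"
  obtain d r where d: "d \<in> \<A>" "f s x \<in> fst d" "0 < r" "cball (snd d (f s x)) r \<subseteq> snd d ` (fst d \<inter> N)"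
    by (rule chart_neighbourhood[OF N])
  have in_N: "z \<in> N" if "z \<in> fst d" "dist (snd d (f s x)) (snd d z) < r" for z
  proof -
    have "chart_inv d (snd d z) \<in> chart_inv d ` cball (snd d (f s x)) r"
      using that(2) by simp
    then show ?thesis
      using chart_inv_ball(4)[OF d] chart_inv_chart[OF d(1) that(1)] by auto
  qed
  obtain c where c: "c \<in> \<A>" "x \<in> fst c"
    by (meson chart_exists)
  let ?D = "fst d \<inter> snd d -` ball (snd d (f s x)) (r / 2)"
  have D: "open ?D"
    using continuous_on_chart[OF d(1)] open_domain[OF d(1)] open_ball by (rule continuous_open_preimage)
  have "continuous_on ?S (f s)"
    using flow_path_C1_map[OF flow s(1)] by (simp add: C1_map_on_def)
  then have "open (?S \<inter> f s -` ?D)"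
    using flow_path_domain_open[OF flow s(1)] D by (rule continuous_open_preimage)
  then have "open (fst c \<inter> (?S \<inter> f s -` ?D))" "x \<in> fst c \<inter> (?S \<inter> f s -` ?D)"
    using open_domain[OF c(1)] c d s by auto
  then obtain V C where VC: "open V" "x \<in> V" "V \<subseteq> C" "compact C" "C \<subseteq> fst c \<inter> (?S \<inter> f s -` ?D)"
    by (rule compact_neighbourhood)
  then have "compact C \<and> C \<subseteq> fst c \<and> C \<subseteq> ?S \<and> f s ` C \<subseteq> fst d"
    by auto
  then have "eventually (\<lambda>t. C \<subseteq> {x. ereal t < \<zeta> x} \<and> f t ` C \<subseteq> fst d \<and>
      (\<forall>x\<in>C. norm (snd d (f t x) - snd d (f s x)) < r / 2)) (at s within {0..})"
    using flow s(1) c(1) d(1,3) unfolding flow_path_def by (meson half_gt_zero)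
  then obtain \<delta> where \<delta>: "0 < \<delta>" and ev: "\<And>t. t \<in> {0..} \<Longrightarrow> t \<noteq> s \<Longrightarrow> dist t s < \<delta> \<Longrightarrow>
      C \<subseteq> {x. ereal t < \<zeta> x} \<and> f t ` C \<subseteq> fst d \<and>
      (\<forall>x\<in>C. norm (snd d (f t x) - snd d (f s x)) < r / 2)"
    unfolding eventually_at by blast
  show thesis
  proof (rule that[OF \<delta> VC(1,2)])
    fix t y assume t: "0 \<le> t" "\<bar>t - s\<bar> < \<delta>" and "y \<in> V"
    then have y: "y \<in> C" "ereal s < \<zeta> y" "f s y \<in> fst d" "dist (snd d (f s x)) (snd d (f s y)) < r / 2"
      using VC by auto
    show "ereal t < \<zeta> y \<and> f t y \<in> N"
    \<comment> \<open>The filter \<open>at s within {0..}\<close> leaves out \<open>s\<close>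
      itself; at that time the choice of the compact neighbourhood suffices.\<close>
    proof (cases "t = s")
      case True
      then show ?thesis
        using y in_N[of "f s y"] d(3) by simp
    next
      case False
      then have *: "C \<subseteq> {x. ereal t < \<zeta> x}" "f t ` C \<subseteq> fst d"
        "\<forall>x\<in>C. norm (snd d (f t x) - snd d (f s x)) < r / 2"
        using ev[of t] t by (auto simp: dist_real_def)
      have "dist (snd d (f s y)) (snd d (f t y)) < r / 2"
        using *(3) y(1) by (simp add: dist_norm norm_minus_commute)
      then have "dist (snd d (f s x)) (snd d (f t y)) < r"
        using y(4) dist_triangle[of "snd d (f s x)" "snd d (f t y)" "snd d (f s y)"] by simp
      then show ?thesis
        using * y(1) in_N[of "f t y"] by blast
    qed
  qed
qed

text \<open>Tube lemma: finitely many local neighbourhoods cover the compact set, and the least of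
  their time radii serves for all.\<close>

lemma flow_path_tube:
  assumes flow: "flow_path \<A> f \<zeta>" and K: "compact K" and s: "0 \<le> s"
    and sK: "\<And>x. x \<in> K \<Longrightarrow> ereal s < \<zeta> x \<and> f s x \<in> N" and N: "open N"
  obtains \<delta> where "0 < \<delta>" "\<And>t y. 0 \<le> t \<Longrightarrow> \<bar>t - s\<bar> < \<delta> \<Longrightarrow> y \<in> K \<Longrightarrow> ereal t < \<zeta> y \<and> f t y \<in> N"
proof -
  define Q where "Q x \<delta> W \<longleftrightarrow> 0 < \<delta> \<and> open W \<and> x \<in> W \<and>
    (\<forall>t y. 0 \<le> t \<longrightarrow> \<bar>t - s\<bar> < \<delta> \<longrightarrow> y \<in> W \<longrightarrow> ereal t < \<zeta> y \<and> f t y \<in> N)" for x \<delta> W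
  have "\<exists>\<delta> W. Q x \<delta> W" if "x \<in> K" for x
  proof -
    have 1: "ereal s < \<zeta> x" "f s x \<in> N"
      using sK[OF that] by auto
    show ?thesis
      by (rule flow_path_local[OF flow s(1) 1(1) N 1(2)]) (auto simp: Q_def)
  qed
  then obtain \<delta> W where Q: "\<And>x. x \<in> K \<Longrightarrow> Q x (\<delta> x) (W x)"
    by metis
  have W: "\<And>x. x \<in> K \<Longrightarrow> open (W x)" "K \<subseteq> (\<Union>x\<in>K. W x)"
    using Q unfolding Q_def by blast+
  obtain I where I: "I \<subseteq> K" "finite I" "K \<subseteq> (\<Union>x\<in>I. W x)"
    by (rule compactE_image[OF K W])
  \<comment> \<open>The inserted 1 keeps the minimum meaningful for an empty cover.\<close>
  define \<delta>0 where "\<delta>0 = Min (insert 1 (\<delta> ` I))"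
  show thesis
  proof (rule that[of \<delta>0])
    show "0 < \<delta>0"
      using I(1,2) Q unfolding \<delta>0_def Q_def by auto
    fix t y assume t: "0 \<le> t" "\<bar>t - s\<bar> < \<delta>0" and "y \<in> K"
    then obtain x where x: "x \<in> I" "y \<in> W x"
      using I(3) by blast
    then have "\<delta>0 \<le> \<delta> x"
      using I(2) unfolding \<delta>0_def by simp
    moreover have "Q x (\<delta> x) (W x)"
      using Q x(1) I(1) by blast
    ultimately show "ereal t < \<zeta> y \<and> f t y \<in> N"
      using t x(2) unfolding Q_def by simp
  qed
qed

text \<open>The tube grants all of \<open>K\<close> a common extra time, so the strict inequality
  survives the infimum.\<close>

lemma flow_path_lifetime_inf:
  assumes "flow_path \<A> f \<zeta>" "compact K" "0 \<le> s" "\<And>x. x \<in> K \<Longrightarrow> ereal s < \<zeta> x"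
  shows "ereal s < (INF x\<in>K. \<zeta> x)"
proof -
  obtain \<delta> where \<delta>: "0 < \<delta>" "\<And>t y. 0 \<le> t \<Longrightarrow> \<bar>t - s\<bar> < \<delta> \<Longrightarrow> y \<in> K \<Longrightarrow> ereal t < \<zeta> y \<and> f t y \<in> UNIV"
    by (rule flow_path_tube[OF assms(1-3), of UNIV]) (use assms(4) in auto)
  have "ereal (s + \<delta> / 2) \<le> (INF x\<in>K. \<zeta> x)"
    using \<delta>(1) \<delta>(2)[of "s + \<delta> / 2"] assms(3) by (intro INF_greatest less_imp_le) auto
  moreover have "ereal s < ereal (s + \<delta> / 2)"
    using \<delta>(1) by simp
  ultimately show ?thesis
    by (rule less_le_trans[rotated])
qed

text \<open>If nothing explodes, the domain is the set of all nonnegative times and all points, and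
  this is the joint continuity asked for by strong completeness.\<close>

lemma flow_path_continuous:
  assumes "flow_path \<A> f \<zeta>"
  shows "continuous_on {(t, x). 0 \<le> t \<and> ereal t < \<zeta> x} (\<lambda>(t, x). f t x)"
  unfolding continuous_on_topological
proof (intro ballI allI impI)
  fix p N assume p: "p \<in> {(t, x). 0 \<le> t \<and> ereal t < \<zeta> x}" "open N" "(case p of (t, x) \<Rightarrow> f t x) \<in> N"
  obtain s x where sx: "p = (s, x)"
    by (cases p)
  obtain \<delta> W where W: "0 < \<delta>" "open W" "x \<in> W"
    "\<And>t y. 0 \<le> t \<Longrightarrow> \<bar>t - s\<bar> < \<delta> \<Longrightarrow> y \<in> W \<Longrightarrow> ereal t < \<zeta> y \<and> f t y \<in> N"
    by (rule flow_path_local[OF assms, of s x N]) (use p sx in auto)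
  show "\<exists>A. open A \<and> p \<in> A \<and>
      (\<forall>q\<in>{(t, x). 0 \<le> t \<and> ereal t < \<zeta> x}. q \<in> A \<longrightarrow> (case q of (t, x) \<Rightarrow> f t x) \<in> N)"
  proof (intro exI[of _ "ball s \<delta> \<times> W"] conjI ballI impI)
    show "open (ball s \<delta> \<times> W)" "p \<in> ball s \<delta> \<times> W"
      using W sx by (auto intro: open_Times)
    fix q assume q: "q \<in> {(t, x). 0 \<le> t \<and> ereal t < \<zeta> x}" "q \<in> ball s \<delta> \<times> W"
    then show "(case q of (t, x) \<Rightarrow> f t x) \<in> N"
      using W(4)[of "fst q" "snd q"] by (auto simp: dist_real_def abs_minus_commute)
  qed
qed

lemma flow_path_compact_image:
  assumes "flow_path \<A> f \<zeta>" "compact K" "\<And>x. x \<in> K \<Longrightarrow> ereal T < \<zeta> x"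
  shows "compact ((\<lambda>(t, x). f t x) ` ({0..T} \<times> K))"
proof (rule compact_continuous_image)
  show "continuous_on ({0..T} \<times> K) (\<lambda>(t, x). f t x)"
  proof (rule continuous_on_subset[OF flow_path_continuous[OF assms(1)]], safe)
    fix t x assume "t \<in> {0..T}" "x \<in> K"
    then show "0 \<le> t" "ereal t < \<zeta> x"
      using assms(3)[of x] le_less_trans[of "ereal t" "ereal T"] by auto
  qed
qed (intro compact_Times compact_Icc assms(2))

lemma flow_path_continuous_time:
  assumes "flow_path \<A> f \<zeta>"
  shows "continuous_on {t. 0 \<le> t \<and> ereal t < \<zeta> x} (\<lambda>t. f t x)"
proof -
  have "continuous_on {t. 0 \<le> t \<and> ereal t < \<zeta> x} (\<lambda>t. (\<lambda>(t, x). f t x) (t, x))"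
    by (rule continuous_on_compose2[OF flow_path_continuous[OF assms]]) (auto intro!: continuous_intros)
  then show ?thesis
    by simp
qed

end

section \<open>Exit times for a fixed outcome\<close>

definition first_exit :: "'a::topological_space set \<Rightarrow> (real \<Rightarrow> 'a \<Rightarrow> 'a) \<Rightarrow> 'a set \<Rightarrow> ereal" where
  "first_exit U h K = (INF x\<in>K. INF t\<in>{t. 0 \<le> t \<and> h t x \<notin> closure U}. ereal t)"

lemma first_exit_nonneg: "0 \<le> first_exit U h K"
  unfolding first_exit_def by (intro INF_greatest) simp

lemma before_first_exit:
  assumes "ereal t < first_exit U h K" "0 \<le> t" "x \<in> K"
  shows "h t x \<in> closure U"
proof (rule ccontr)
  assume "h t x \<notin> closure U"
  then have "first_exit U h K \<le> ereal t"
    unfolding first_exit_def using assms(2,3) by (intro INF_lower2[OF assms(3)] INF_lower) auto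
  then show False
    using assms(1) by simp
qed

lemma first_exit_geI:
  assumes "\<And>t x. 0 \<le> t \<Longrightarrow> t < T \<Longrightarrow> x \<in> K \<Longrightarrow> h t x \<in> closure U"
  shows "ereal T \<le> first_exit U h K"
  unfolding first_exit_def using assms by (intro INF_greatest) (auto simp: not_less[symmetric])

lemma not_tendsto_infinity_bounded:
  fixes \<psi> :: "real \<Rightarrow> ereal"
  assumes "(\<psi> \<longlongrightarrow> \<infinity>) (at_left T)" "0 < T" "\<And>t. 0 \<le> t \<Longrightarrow> t < T \<Longrightarrow> \<psi> t \<le> ereal R"
  shows False
proof -
  have "eventually (\<lambda>t. t \<in> {0<..<T}) (at_left T)"
    using assms(2) by (rule eventually_at_left_real)
  then have "eventually (\<lambda>t. \<psi> t \<le> ereal R) (at_left T)"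
    by eventually_elim (use assms(3) in auto)
  then have "\<infinity> \<le> ereal R"
    by (rule tendsto_upperbound[OF assms(1)]) simp
  then show False
    by simp
qed

text \<open>\<open>f\<close> is a path of the flow with lifetimes \<open>\<zeta>\<close>, \<open>h\<close> a path of the cut-off flow that agrees
  with it up to the exit time \<open>first_exit U h K\<close>.\<close>

locale stopped_flow = riemannian +
  fixes f :: "real \<Rightarrow> 'a \<Rightarrow> 'a" and \<zeta> :: "'a \<Rightarrow> ereal" and h :: "real \<Rightarrow> 'a \<Rightarrow> 'a"
    and U K :: "'a set" and x0 :: 'a
  assumes flow: "flow_path \<A> f \<zeta>" and cut_flow: "flow_path \<A> h (\<lambda>_. \<infinity>)"
    and compact_K: "compact K" and K_nonempty: "K \<noteq> {}" and open_U: "open U"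
    and agree: "\<And>x t. x \<in> K \<Longrightarrow> 0 \<le> t \<Longrightarrow> ereal t < first_exit U h K \<Longrightarrow> ereal t < \<zeta> x \<and> h t x = f t x"
    and blowup: "(INF x\<in>K. \<zeta> x) < \<infinity> \<Longrightarrow>
      ((\<lambda>t. SUP x\<in>K. ereal (riemannian_dist \<A> g x0 (f t x))) \<longlongrightarrow> \<infinity>)
        (at_left (real_of_ereal (INF x\<in>K. \<zeta> x)))"
begin

lemma lifetime_pos: "0 < (INF x\<in>K. \<zeta> x)"
  using flow_path_lifetime_inf[OF flow compact_K, of 0] flow_path_lifetime_pos[OF flow]
  by (simp add: zero_ereal_def)

text \<open>\<open>agree\<close> contains the information that \<open>f\<close> is still alive at
  each nonnegative time before the exit; negative \<open>s\<close> are covered by positivity of the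
  lifetime.\<close>

lemma first_exit_le_lifetime: "first_exit U h K \<le> (INF x\<in>K. \<zeta> x)"
proof (rule INF_greatest, rule dense_le)
  fix x s assume x: "x \<in> K" and s: "s < first_exit U h K"
  show "s \<le> \<zeta> x"
  proof (cases "0 \<le> s")
    case True
    then obtain t where t: "s = ereal t" "0 \<le> t"
      using s by (cases s) auto
    then show ?thesis
      using agree[OF x t(2)] s by auto
  next
    case False
    then show ?thesis
      using flow_path_lifetime_pos[OF flow, of x] by auto
  qed
qed

text \<open>The strict inequality puts all of \<open>K\<close> into the domain of \<open>f\<close>
  at the exit time, whereas \<open>agree\<close> only speaks of earlier times.\<close>

lemma first_exit_less_lifetime:
  assumes conn: "connected (UNIV :: 'a set)" and "compact (closure U)" and fin: "first_exit U h K < \<infinity>"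
  shows "first_exit U h K < (INF x\<in>K. \<zeta> x)"
proof (rule ccontr)
  assume "\<not> ?thesis"
  then have eq: "first_exit U h K = (INF x\<in>K. \<zeta> x)"
    using first_exit_le_lifetime by simp
  then obtain T where T: "(INF x\<in>K. \<zeta> x) = ereal T" "0 < T"
    using lifetime_pos fin by (cases "INF x\<in>K. \<zeta> x") auto
  obtain R where R: "\<And>z. z \<in> closure U \<Longrightarrow> \<exists>L\<in>path_lengths \<A> g x0 z. L \<le> R"
    by (rule path_lengths_compact[OF conn assms(2), where x=x0]) (rule that)
  have "((\<lambda>t. SUP x\<in>K. ereal (riemannian_dist \<A> g x0 (f t x))) \<longlongrightarrow> \<infinity>) (at_left T)"
    using blowup T by simp
  then show False
  proof (rule not_tendsto_infinity_bounded[OF _ T(2)])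
    fix t assume t: "0 \<le> t" "t < T"
    show "(SUP x\<in>K. ereal (riemannian_dist \<A> g x0 (f t x))) \<le> ereal R"
    proof (rule SUP_least)
      fix x assume x: "x \<in> K"
      have "ereal t < first_exit U h K"
        using t eq T by simp
      then have "f t x \<in> closure U"
        using before_first_exit[OF _ t(1) x] agree[OF x t(1)] by metis
      then show "ereal (riemannian_dist \<A> g x0 (f t x)) \<le> ereal R"
        using R riemannian_dist_le by fastforce
    qed
  qed
qed

text \<open>Both flows are continuous in time at \<open>s\<close> and agree before it, so their
  limits from the left coincide. At \<open>s = 0\<close> there are no earlier times, but both start
  at \<open>x\<close>.\<close>

lemma agree_at_first_exit:
  assumes s: "first_exit U h K = ereal s" "ereal s < (INF x\<in>K. \<zeta> x)" and x: "x \<in> K"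
  shows "h s x = f s x"
proof (cases "s = 0")
  case True
  then show ?thesis
    using flow_path_initial[OF flow] flow_path_initial[OF cut_flow] by simp
next
  case False
  then have s0: "0 < s"
    using first_exit_nonneg[of U h K] s(1) by simp
  have sx: "ereal s < \<zeta> x"
    using s(2) x by (rule less_INF_D)
  have "{0..s} \<subseteq> {t. 0 \<le> t \<and> ereal t < \<zeta> x}"
    using le_less_trans[OF _ sx] by auto
  then have "continuous_on {0..s} (\<lambda>t. f t x)"
    by (rule continuous_on_subset[OF flow_path_continuous_time[OF flow]])
  then have f_lim: "((\<lambda>t. f t x) \<longlongrightarrow> f s x) (at s within {0..s})"
    using s0 by (auto simp: continuous_on_def)
  have "continuous_on {0..s} (\<lambda>t. h t x)"
    by (rule continuous_on_subset[OF flow_path_continuous_time[OF cut_flow]]) auto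
  then have h_lim: "((\<lambda>t. h t x) \<longlongrightarrow> h s x) (at s within {0..s})"
    using s0 by (auto simp: continuous_on_def)
  have "eventually (\<lambda>t. f t x = h t x) (at s within {0..s})"
    unfolding eventually_at_filter using agree[OF x] s(1) by (intro always_eventually) auto
  then have "((\<lambda>t. h t x) \<longlongrightarrow> f s x) (at s within {0..s})"
    using f_lim by (rule Lim_transform_eventually[rotated])
  moreover have "at s within {0..s} \<noteq> bot"
    using s0 by (simp add: trivial_limit_within islimpt_Icc)
  ultimately show ?thesis
    using h_lim by (metis tendsto_unique)
qed

text \<open>Suppose the exit time \<open>s\<close> were at most \<open>t\<close>. The cut-off flow
  equals \<open>f\<close> at \<open>s\<close>, so it maps \<open>K\<close> into the open set
  \<open>U\<close>, and by the tube it keeps doing so for a further time \<open>\<delta>\<close>.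
  Hence \<open>s\<close> was not the exit time.\<close>

lemma first_exit_greater:
  assumes t: "0 \<le> t" "ereal t < (INF x\<in>K. \<zeta> x)"
    and sub: "\<And>s x. 0 \<le> s \<Longrightarrow> s \<le> t \<Longrightarrow> x \<in> K \<Longrightarrow> f s x \<in> U"
  shows "ereal t < first_exit U h K"
proof (rule ccontr)
  assume "\<not> ?thesis"
  then obtain s where s: "first_exit U h K = ereal s" "0 \<le> s" "s \<le> t"
    using first_exit_nonneg[of U h K] by (cases "first_exit U h K") auto
  then have s_less: "ereal s < (INF x\<in>K. \<zeta> x)"
    using t(2) by (meson ereal_less_eq(3) le_less_trans)
  have hs: "h s x \<in> U" if "x \<in> K" for x
    using agree_at_first_exit[OF s(1) s_less that] sub[OF s(2,3) that] by simp
  obtain \<delta> where \<delta>: "0 < \<delta>" "\<And>r y. 0 \<le> r \<Longrightarrow> \<bar>r - s\<bar> < \<delta> \<Longrightarrow> y \<in> K \<Longrightarrow> ereal r < \<infinity> \<and> h r y \<in> U"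
    by (rule flow_path_tube[OF cut_flow compact_K s(2) _ open_U]) (use hs in auto)
  have "ereal (s + \<delta>) \<le> first_exit U h K"
  proof (rule first_exit_geI)
    fix r x assume r: "0 \<le> r" "r < s + \<delta>" and x: "x \<in> K"
    show "h r x \<in> closure U"
    proof (cases "r < s")
      case True
      then show ?thesis
        using before_first_exit[OF _ r(1) x] s(1) by simp
    next
      case False
      then have "h r x \<in> U"
        using \<delta>(2)[OF r(1) _ x] r(2) by simp
      then show ?thesis
        using closure_subset by blast
    qed
  qed
  then show False
    using s(1) \<delta>(1) by simp
qed

end

section \<open>Measurability\<close>

text \<open>Difference quotients present the velocity of a random curve as a limit of measurable
  quantities.\<close>

lemma has_vector_derivative_imp_slope:
  fixes f :: "real \<Rightarrow> 'q::real_normed_vector"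
  assumes "(f has_vector_derivative D) (at s within T)"
  shows "((\<lambda>y. (f y - f s) /\<^sub>R (y - s)) \<longlongrightarrow> D) (at s within T)"
proof -
  have "((\<lambda>y. (1 / norm (y - s)) *\<^sub>R (f y - (f s + (y - s) *\<^sub>R D))) \<longlongrightarrow> 0) (at s within T)"
    using assms by (simp add: has_vector_derivative_def has_derivative_within)
  then have "((\<lambda>y. norm ((1 / norm (y - s)) *\<^sub>R (f y - (f s + (y - s) *\<^sub>R D)))) \<longlongrightarrow> 0) (at s within T)"
    by (rule tendsto_norm_zero)
  moreover have "norm ((1 / norm (y - s)) *\<^sub>R (f y - (f s + (y - s) *\<^sub>R D))) = norm ((f y - f s) /\<^sub>R (y - s) - D)"
    if "y \<noteq> s" for y
  proof -
    have "(f y - f s) /\<^sub>R (y - s) - D = (f y - (f s + (y - s) *\<^sub>R D)) /\<^sub>R (y - s)"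
      using that by (simp add: scaleR_diff_right scaleR_add_right)
    then show ?thesis
      by (simp add: divide_inverse)
  qed
  then have "eventually (\<lambda>y. norm ((1 / norm (y - s)) *\<^sub>R (f y - (f s + (y - s) *\<^sub>R D))) =
      norm ((f y - f s) /\<^sub>R (y - s) - D)) (at s within T)"
    by (auto simp: eventually_at_filter)
  ultimately have "((\<lambda>y. norm ((f y - f s) /\<^sub>R (y - s) - D)) \<longlongrightarrow> 0) (at s within T)"
    by (rule Lim_transform_eventually)
  then show ?thesis
    by (simp add: tendsto_norm_zero_iff LIM_zero_iff)
qed

text \<open>Rounding replaces a real time by one of countably many, which reduces measurability at a
  variable or random time to measurability at fixed times.\<close>

lemma tendsto_floor_fraction:
  fixes t :: real
  shows "(\<lambda>n. real_of_int \<lfloor>real (Suc n) * t\<rfloor> / real (Suc n)) \<longlonglongrightarrow> t"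
proof (rule LIM_zero_cancel, rule Lim_null_comparison)
  show "(\<lambda>n. 1 / real (Suc n)) \<longlonglongrightarrow> 0"
    by (rule LIMSEQ_Suc[OF lim_const_over_n])
  show "eventually (\<lambda>n. norm (real_of_int \<lfloor>real (Suc n) * t\<rfloor> / real (Suc n) - t) \<le> 1 / real (Suc n)) sequentially"
  proof (rule always_eventually, rule allI)
    fix n
    have "\<bar>real_of_int \<lfloor>real (Suc n) * t\<rfloor> - real (Suc n) * t\<bar> \<le> 1"
      by linarith
    moreover have "real_of_int \<lfloor>real (Suc n) * t\<rfloor> / real (Suc n) - t =
        (real_of_int \<lfloor>real (Suc n) * t\<rfloor> - real (Suc n) * t) / real (Suc n)"
      by (simp add: diff_divide_distrib del: of_nat_Suc)
    ultimately show "norm (real_of_int \<lfloor>real (Suc n) * t\<rfloor> / real (Suc n) - t) \<le> 1 / real (Suc n)"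
      by (simp add: abs_divide divide_right_mono del: of_nat_Suc)
  qed
qed

text \<open>Tonelli needs joint measurability, while \<open>h\<close> is measurable in \<omega> for
  fixed \<open>s\<close> and continuous in \<open>s\<close>. Rounding \<open>s\<close> to multiples
  of \<open>1 / Suc n\<close> gives jointly measurable functions that converge to the
  integrand.\<close>

lemma nn_integral_integral_le:
  fixes h :: "'w \<Rightarrow> real \<Rightarrow> real"
  assumes "sigma_finite_measure M" "a < b"
    and meas: "\<And>s. s \<in> {a..b} \<Longrightarrow> (\<lambda>\<omega>. h \<omega> s) \<in> borel_measurable M"
    and cont: "\<And>\<omega>. \<omega> \<in> space M \<Longrightarrow> continuous_on {a..b} (h \<omega>)"
    and nonneg: "\<And>\<omega> s. \<omega> \<in> space M \<Longrightarrow> s \<in> {a..b} \<Longrightarrow> 0 \<le> h \<omega> s"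
    and bound: "\<And>s. s \<in> {a..b} \<Longrightarrow> (\<integral>\<^sup>+\<omega>. ennreal (h \<omega> s) \<partial>M) \<le> C"
  shows "(\<lambda>\<omega>. ennreal (integral {a..b} (h \<omega>))) \<in> borel_measurable M"
    and "(\<integral>\<^sup>+\<omega>. ennreal (integral {a..b} (h \<omega>)) \<partial>M) \<le> ennreal (b - a) * C"
proof -
  interpret sigma_finite_measure M by fact
  interpret pair_sigma_finite M lborel ..
  \<comment> \<open>The second argument is clamped to \<open>{a..b}\<close> because rounded times
    can leave the interval.\<close>
  define H where "H \<omega> s = h \<omega> (max a (min b s))" for \<omega> s
  have clamp: "max a (min b s) \<in> {a..b}" for s
    using assms(2) by auto
  have "(\<lambda>p. H (fst p) (snd p)) \<in> borel_measurable (M \<Otimes>\<^sub>M borel)"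
  proof (rule borel_measurable_LIMSEQ_real)
    fix p :: "'w \<times> real" assume "p \<in> space (M \<Otimes>\<^sub>M borel)"
    then have p: "fst p \<in> space M"
      by (auto simp: space_pair_measure)
    have "continuous_on UNIV (\<lambda>s. H (fst p) s)"
      unfolding H_def by (rule continuous_on_compose2[OF cont[OF p]])
        (use clamp in \<open>auto intro!: continuous_intros\<close>)
    then show "(\<lambda>n. H (fst p) (real_of_int \<lfloor>real (Suc n) * snd p\<rfloor> / real (Suc n))) \<longlonglongrightarrow> H (fst p) (snd p)"
      by (rule continuous_on_tendsto_compose[OF _ tendsto_floor_fraction]) auto
  next
    fix n
    show "(\<lambda>p. H (fst p) (real_of_int \<lfloor>real (Suc n) * snd p\<rfloor> / real (Suc n))) \<in> borel_measurable (M \<Otimes>\<^sub>M borel)"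
    proof (rule measurable_compose_countable'[where I=UNIV and
          f="\<lambda>k p. H (fst p) (real_of_int k / real (Suc n))" and g="\<lambda>p. \<lfloor>real (Suc n) * snd p\<rfloor>"])
      fix k :: int
      have "(\<lambda>\<omega>. H \<omega> (real_of_int k / real (Suc n))) \<in> borel_measurable M"
        unfolding H_def by (rule meas[OF clamp])
      then show "(\<lambda>p. H (fst p) (real_of_int k / real (Suc n))) \<in> borel_measurable (M \<Otimes>\<^sub>M borel)"
        by (rule measurable_compose[OF measurable_fst])
    next
      have "(\<lambda>p. real (Suc n) * snd p) \<in> borel_measurable (M \<Otimes>\<^sub>M borel)"
        by measurable
      then show "(\<lambda>p. \<lfloor>real (Suc n) * snd p\<rfloor>) \<in> measurable (M \<Otimes>\<^sub>M borel) (count_space UNIV)"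
        by (rule measurable_compose[OF _ measurable_real_floor])
    qed simp
  qed
  then have H: "(\<lambda>p. ennreal (H (fst p) (snd p) * indicator {a..b} (snd p))) \<in> borel_measurable (M \<Otimes>\<^sub>M lborel)"
    by (simp cong: measurable_cong_sets)
  have int_eq: "ennreal (integral {a..b} (h \<omega>)) = (\<integral>\<^sup>+s. ennreal (H \<omega> s * indicator {a..b} s) \<partial>lborel)"
    if \<omega>: "\<omega> \<in> space M" for \<omega>
  proof -
    have "(h \<omega> has_integral integral {a..b} (h \<omega>)) {a..b}"
      using integrable_continuous_interval[OF cont[OF \<omega>]] by (rule integrable_integral)
    then have "(\<integral>\<^sup>+s. ennreal (indicator {a..b} s * h \<omega> s) \<partial>lborel) = ennreal (integral {a..b} (h \<omega>))"
      using nonneg[OF \<omega>] by (intro nn_integral_has_integral_lebesgue) auto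
    moreover have "indicator {a..b} s * h \<omega> s = H \<omega> s * indicator {a..b} s" for s
      by (auto simp: H_def indicator_def)
    ultimately show ?thesis
      by simp
  qed
  have "(\<lambda>\<omega>. \<integral>\<^sup>+s. ennreal (H \<omega> s * indicator {a..b} s) \<partial>lborel) \<in> borel_measurable M"
    using H by (intro lborel.borel_measurable_nn_integral) (simp add: case_prod_unfold)
  then show "(\<lambda>\<omega>. ennreal (integral {a..b} (h \<omega>))) \<in> borel_measurable M"
    by (subst measurable_cong[OF int_eq]) auto
  have "(\<integral>\<^sup>+\<omega>. ennreal (integral {a..b} (h \<omega>)) \<partial>M) =
      (\<integral>\<^sup>+\<omega>. (\<integral>\<^sup>+s. ennreal (H \<omega> s * indicator {a..b} s) \<partial>lborel) \<partial>M)"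
    by (rule nn_integral_cong[OF int_eq])
  also have "\<dots> = (\<integral>\<^sup>+s. (\<integral>\<^sup>+\<omega>. ennreal (H \<omega> s * indicator {a..b} s) \<partial>M) \<partial>lborel)"
    using H by (intro Fubini'[symmetric]) (simp add: case_prod_unfold)
  also have "\<dots> \<le> (\<integral>\<^sup>+s. C * indicator {a..b} s \<partial>lborel)"
  proof (rule nn_integral_mono)
    fix s :: real
    show "(\<integral>\<^sup>+\<omega>. ennreal (H \<omega> s * indicator {a..b} s) \<partial>M) \<le> C * indicator {a..b} s"
      using bound[of s] by (cases "s \<in> {a..b}") (auto simp: H_def)
  qed
  also have "\<dots> = C * ennreal (b - a)"
    using assms(2) by (simp add: nn_integral_cmult_indicator)
  finally show "(\<integral>\<^sup>+\<omega>. ennreal (integral {a..b} (h \<omega>)) \<partial>M) \<le> ennreal (b - a) * C"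
    by (simp add: mult.commute)
qed

section \<open>Limits, random times and random curves in the manifold\<close>

context atlas
begin

lemma regular_neighbourhood:
  fixes x :: 'a
  assumes "open S" "x \<in> S"
  obtains V where "open V" "x \<in> V" "closure V \<subseteq> S"
proof -
  obtain V C where V: "open V" "x \<in> V" "V \<subseteq> C" "compact C" "C \<subseteq> S"
    by (rule compact_neighbourhood[OF assms])
  then have "closure V \<subseteq> C"
    by (intro closure_minimal compact_imp_closed)
  then show thesis
    using V by (intro that[of V]) auto
qed

text \<open>The manifold enters through its topology alone, so a countable base replaces balls: the
  limit lies in an open \<open>S\<close> if and only if, for some basic \<open>b\<close> with
  \<open>closure b \<subseteq> S\<close>, the sequence is finally in \<open>closure b\<close>.
  Regularity supplies \<open>b\<close>, and closedness gives the converse.\<close>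

lemma borel_measurable_limit:
  fixes Y :: "nat \<Rightarrow> 'w \<Rightarrow> 'a"
  assumes meas: "\<And>n. Y n \<in> borel_measurable M"
    and lim: "\<And>\<omega>. \<omega> \<in> space M \<Longrightarrow> (\<lambda>n. Y n \<omega>) \<longlonglongrightarrow> Z \<omega>"
  shows "Z \<in> borel_measurable M"
proof (rule borel_measurableI)
  fix S :: "'a set" assume S: "open S"
  obtain \<B> :: "'a set set" where \<B>: "countable \<B>" "topological_basis \<B>"
    using ex_countable_basis by blast
  have "Z -` S \<inter> space M = (\<Union>b\<in>{b \<in> \<B>. closure b \<subseteq> S}. \<Union>N. \<Inter>n\<in>{N..}. Y n -` closure b \<inter> space M)"
  proof (intro equalityI subsetI)
    fix \<omega> assume \<omega>: "\<omega> \<in> Z -` S \<inter> space M"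
    then obtain V where V: "open V" "Z \<omega> \<in> V" "closure V \<subseteq> S"
      using regular_neighbourhood[OF S] by auto
    obtain b where b: "b \<in> \<B>" "Z \<omega> \<in> b" "b \<subseteq> V"
      using topological_basisE[OF \<B>(2) V(1,2)] by blast
    have "closure b \<subseteq> S"
      using closure_mono[OF b(3)] V(3) by blast
    moreover have "open b"
      using topological_basis_open[OF \<B>(2) b(1)] .
    then have "eventually (\<lambda>n. Y n \<omega> \<in> b) sequentially"
      using lim[of \<omega>] \<omega> b(2) by (intro topological_tendstoD) auto
    then obtain N where "\<And>n. N \<le> n \<Longrightarrow> Y n \<omega> \<in> closure b"
      unfolding eventually_sequentially using closure_subset by blast
    ultimately show "\<omega> \<in> (\<Union>b\<in>{b \<in> \<B>. closure b \<subseteq> S}. \<Union>N. \<Inter>n\<in>{N..}. Y n -` closure b \<inter> space M)"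
      using b(1) \<omega> by auto
  next
    fix \<omega> assume "\<omega> \<in> (\<Union>b\<in>{b \<in> \<B>. closure b \<subseteq> S}. \<Union>N. \<Inter>n\<in>{N..}. Y n -` closure b \<inter> space M)"
    then obtain b N where b: "closure b \<subseteq> S" "\<And>n. N \<le> n \<Longrightarrow> Y n \<omega> \<in> closure b \<and> \<omega> \<in> space M"
      by auto
    then have \<omega>: "\<omega> \<in> space M"
      by blast
    have "Z \<omega> \<in> closure b"
    proof (rule Lim_in_closed_set[OF closed_closure _ _ lim[OF \<omega>]])
      show "\<forall>\<^sub>F n in sequentially. Y n \<omega> \<in> closure b"
        unfolding eventually_sequentially using b(2) by blast
    qed simp
    then show "\<omega> \<in> Z -` S \<inter> space M"
      using b(1) \<omega> by blast
  qed
  moreover have "Y n -` closure b \<inter> space M \<in> sets M" for n b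
    using meas[of n] by (rule measurable_sets) simp
  then have "(\<Union>b\<in>{b \<in> \<B>. closure b \<subseteq> S}. \<Union>N. \<Inter>n\<in>{N..}. Y n -` closure b \<inter> space M) \<in> sets M"
    using \<B>(1) by (intro sets.countable_UN'' sets.countable_INT'' countable_Collect sets.countable_INT) auto
  ultimately show "Z -` S \<inter> space M \<in> sets M"
    by simp
qed

lemma borel_measurable_random_time:
  fixes Y :: "real \<Rightarrow> 'w \<Rightarrow> 'a"
  assumes meas: "\<And>t. 0 \<le> t \<Longrightarrow> Y t \<in> borel_measurable M"
    and cont: "\<And>\<omega>. \<omega> \<in> space M \<Longrightarrow> continuous_on {0..} (\<lambda>t. Y t \<omega>)"
    and \<tau>: "\<tau> \<in> borel_measurable M" "\<And>\<omega>. \<omega> \<in> space M \<Longrightarrow> 0 \<le> \<tau> \<omega>"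
  shows "(\<lambda>\<omega>. Y (\<tau> \<omega>) \<omega>) \<in> borel_measurable M"
proof (rule borel_measurable_limit)
  fix \<omega> assume \<omega>: "\<omega> \<in> space M"
  have "(\<lambda>n. max 0 (real_of_int \<lfloor>real (Suc n) * \<tau> \<omega>\<rfloor> / real (Suc n))) \<longlonglongrightarrow> max 0 (\<tau> \<omega>)"
    by (intro tendsto_max tendsto_const tendsto_floor_fraction)
  then show "(\<lambda>n. Y (max 0 (real_of_int \<lfloor>real (Suc n) * \<tau> \<omega>\<rfloor> / real (Suc n))) \<omega>) \<longlonglongrightarrow> Y (\<tau> \<omega>) \<omega>"
    using \<tau>(2)[OF \<omega>] by (intro continuous_on_tendsto_compose[OF cont[OF \<omega>]]) auto
next
  fix n
  \<comment> \<open>The map has to be measurable for every integer value \<open>k\<close> of the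
    floor, also for negative ones; \<open>max 0\<close> keeps the time where \<open>meas\<close>
    applies.\<close>
  show "(\<lambda>\<omega>. Y (max 0 (real_of_int \<lfloor>real (Suc n) * \<tau> \<omega>\<rfloor> / real (Suc n))) \<omega>) \<in> borel_measurable M"
  proof (rule measurable_compose_countable'[where I=UNIV and
        f="\<lambda>k. Y (max 0 (real_of_int k / real (Suc n)))" and g="\<lambda>\<omega>. \<lfloor>real (Suc n) * \<tau> \<omega>\<rfloor>"])
    show "(\<lambda>\<omega>. \<lfloor>real (Suc n) * \<tau> \<omega>\<rfloor>) \<in> measurable M (count_space UNIV)"
      using borel_measurable_times[OF borel_measurable_const \<tau>(1)]
      by (rule measurable_compose[OF _ measurable_real_floor])
  qed (auto intro!: meas)
qed

end

context riemannian
begin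

text \<open>No single chart serves all outcomes. Countably many chart domains cover the manifold,
  and on the event that \<open>\<gamma> \<omega> s\<close> lies in a given one, the speed is a Borel
  function of position and velocity in that chart.\<close>

lemma borel_measurable_speed:
  fixes \<gamma> :: "'w \<Rightarrow> real \<Rightarrow> 'a"
  assumes "a < b" "s \<in> {a..b}"
    and meas: "\<And>r. r \<in> {a..b} \<Longrightarrow> (\<lambda>\<omega>. \<gamma> \<omega> r) \<in> borel_measurable M"
    and C1: "\<And>\<omega>. \<omega> \<in> space M \<Longrightarrow> C1_curve \<A> a b (\<gamma> \<omega>)"
  shows "(\<lambda>\<omega>. speed a b (\<gamma> \<omega>) s) \<in> borel_measurable M"
proof -
  obtain \<U> where \<U>: "\<U> \<subseteq> fst ` \<A>" "countable \<U>" "\<Union>\<U> = \<Union>(fst ` \<A>)"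
    by (rule Lindelof[of "fst ` \<A>"]) (use open_domain in blast)
  have cover: "x \<in> \<Union>\<U>" for x
    unfolding \<U>(3) using chart_at[of x] by blast
  \<comment> \<open>\<open>e\<close> is an end point different from \<open>s\<close>. The points
    \<open>r n\<close> approach \<open>s\<close> from the side of \<open>e\<close> and never equal
    it, which works also if \<open>s\<close> is itself an end point.\<close>
  define e where "e = (if s < b then b else a)"
  define r where "r n = s + (e - s) / real (Suc (Suc n))" for n
  have e: "e \<in> {a..b}" "e \<noteq> s"
    using assms(1,2) by (auto simp: e_def)
  have r: "r n \<in> {a..b}" "r n \<noteq> s" for n
  proof -
    have "r n = (1 - 1 / real (Suc (Suc n))) *\<^sub>R s + (1 / real (Suc (Suc n))) *\<^sub>R e"
      by (simp add: r_def algebra_simps diff_divide_distrib del: of_nat_Suc)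
    then show "r n \<in> {a..b}"
      using convexD_alt[OF convex_real_interval(5) assms(2) e(1), of "1 / real (Suc (Suc n))"] by simp
    show "r n \<noteq> s"
      using e(2) by (simp add: r_def del: of_nat_Suc)
  qed
  have "(\<lambda>n. s + (e - s) / real (Suc (Suc n))) \<longlonglongrightarrow> s + 0"
    by (intro tendsto_add tendsto_const LIMSEQ_Suc[OF LIMSEQ_Suc[OF lim_const_over_n]])
  then have r_lim: "filterlim r (at s within {a..b}) sequentially"
    using r by (simp add: filterlim_at r_def[abs_def])
  show ?thesis
  proof (rule measurable_piecewise_restrict[where C="(\<lambda>V. {\<omega> \<in> space M. \<gamma> \<omega> s \<in> V}) ` \<U>"])
    show "countable ((\<lambda>V. {\<omega> \<in> space M. \<gamma> \<omega> s \<in> V}) ` \<U>)"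
      using \<U>(2) by simp
    show "space M \<subseteq> \<Union> ((\<lambda>V. {\<omega> \<in> space M. \<gamma> \<omega> s \<in> V}) ` \<U>)"
      using cover by blast
  next
    fix \<Omega> assume "\<Omega> \<in> (\<lambda>V. {\<omega> \<in> space M. \<gamma> \<omega> s \<in> V}) ` \<U>"
    then obtain c where c: "c \<in> \<A>" and \<Omega>: "\<Omega> = {\<omega> \<in> space M. \<gamma> \<omega> s \<in> fst c}"
      using \<U>(1) by blast
    have "\<Omega> \<inter> space M = (\<lambda>\<omega>. \<gamma> \<omega> s) -` fst c \<inter> space M"
      by (auto simp: \<Omega>)
    also have "\<dots> \<in> sets M"
      using meas[OF assms(2)] open_domain[OF c] by (intro measurable_sets) auto
    finally show "\<Omega> \<inter> space M \<in> sets M" .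
    let ?M = "restrict_space M \<Omega>"
    have space: "\<omega> \<in> space M" "\<gamma> \<omega> s \<in> fst c" if "\<omega> \<in> space ?M" for \<omega>
      using that by (auto simp: space_restrict_space \<Omega>)
    \<comment> \<open>Extension by zero makes the coordinates a Borel map on the whole space. For
      each outcome, \<open>\<gamma> \<omega> (r n)\<close> is outside the chart for finitely many
      \<open>n\<close> only, so the limit is not affected.\<close>
    define \<phi> where "\<phi> y = (if y \<in> fst c then snd c y else 0)" for y
    have \<phi>: "\<phi> \<in> borel_measurable borel"
      unfolding \<phi>_def using open_domain[OF c] continuous_on_chart[OF c]
      by (intro borel_measurable_continuous_on_if) auto
    have \<phi>_meas: "(\<lambda>\<omega>. \<phi> (\<gamma> \<omega> t)) \<in> borel_measurable ?M" if "t \<in> {a..b}" for t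
      by (rule measurable_compose[OF measurable_restrict_space1[OF meas[OF that]] \<phi>])
    have V: "(\<lambda>\<omega>. velocity \<A> a b (\<gamma> \<omega>) s c) \<in> borel_measurable ?M"
    proof (rule borel_measurable_LIMSEQ_metric)
      fix n
      show "(\<lambda>\<omega>. (\<phi> (\<gamma> \<omega> (r n)) - \<phi> (\<gamma> \<omega> s)) /\<^sub>R (r n - s)) \<in> borel_measurable ?M"
        by (intro borel_measurable_scaleR borel_measurable_const borel_measurable_diff \<phi>_meas r(1) assms(2))
    next
      fix \<omega> assume "\<omega> \<in> space ?M"
      then have \<omega>: "\<omega> \<in> space M" "\<gamma> \<omega> s \<in> fst c"
        by (rule space)+
      have "((\<lambda>y. ((snd c \<circ> \<gamma> \<omega>) y - (snd c \<circ> \<gamma> \<omega>) s) /\<^sub>R (y - s)) \<longlongrightarrow> velocity \<A> a b (\<gamma> \<omega>) s c) (at s within {a..b})"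
        using C1_curve_has_vector_derivative[OF C1[OF \<omega>(1)] assms(2) c \<omega>(2)]
        by (rule has_vector_derivative_imp_slope)
      then have "(\<lambda>n. ((snd c \<circ> \<gamma> \<omega>) (r n) - (snd c \<circ> \<gamma> \<omega>) s) /\<^sub>R (r n - s)) \<longlonglongrightarrow> velocity \<A> a b (\<gamma> \<omega>) s c"
        using r_lim by (rule filterlim_compose)
      moreover have "eventually (\<lambda>y. \<gamma> \<omega> y \<in> fst c) (at s within {a..b})"
        using C1_curve_continuous[OF C1[OF \<omega>(1)]] assms(2) open_domain[OF c] \<omega>(2)
        by (rule eventually_preimage_open)
      then have "eventually (\<lambda>n. \<gamma> \<omega> (r n) \<in> fst c) sequentially"
        using r_lim by (rule eventually_compose_filterlim)
      then have "eventually (\<lambda>n. ((snd c \<circ> \<gamma> \<omega>) (r n) - (snd c \<circ> \<gamma> \<omega>) s) /\<^sub>R (r n - s) =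
          (\<phi> (\<gamma> \<omega> (r n)) - \<phi> (\<gamma> \<omega> s)) /\<^sub>R (r n - s)) sequentially"
        by eventually_elim (use \<omega>(2) in \<open>simp add: \<phi>_def\<close>)
      ultimately show "(\<lambda>n. (\<phi> (\<gamma> \<omega> (r n)) - \<phi> (\<gamma> \<omega> s)) /\<^sub>R (r n - s)) \<longlonglongrightarrow> velocity \<A> a b (\<gamma> \<omega>) s c"
        by (rule Lim_transform_eventually)
    qed
    let ?S = "(snd c ` fst c) \<times> (UNIV :: 'e set)"
    define q where "q p = (if p \<in> ?S then quad c (fst p) (snd p) else 0)" for p
    have "open ?S"
      using open_chart_image[OF c] by (intro open_Times) auto
    moreover have "continuous_on ?S (\<lambda>p. quad c (fst p) (snd p))"
      by (intro continuous_on_quad[OF c] continuous_intros) auto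
    ultimately have q: "q \<in> borel_measurable borel"
      unfolding q_def by (intro borel_measurable_continuous_on_if) auto
    have "(\<lambda>\<omega>. (\<phi> (\<gamma> \<omega> s), velocity \<A> a b (\<gamma> \<omega>) s c)) \<in> borel_measurable ?M"
      using \<phi>_meas[OF assms(2)] V by (rule borel_measurable_Pair)
    then have "(\<lambda>\<omega>. sqrt (q (\<phi> (\<gamma> \<omega> s), velocity \<A> a b (\<gamma> \<omega>) s c))) \<in> borel_measurable ?M"
      by (intro measurable_compose[OF _ borel_measurable_sqrt] measurable_compose[OF _ q])
    moreover have "speed a b (\<gamma> \<omega>) s = sqrt (q (\<phi> (\<gamma> \<omega> s), velocity \<A> a b (\<gamma> \<omega>) s c))"
      if "\<omega> \<in> space ?M" for \<omega>
      using speed_eq[OF C1 assms(1,2) c] space[OF that] by (simp add: q_def \<phi>_def)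
    ultimately show "(\<lambda>\<omega>. speed a b (\<gamma> \<omega>) s) \<in> borel_measurable ?M"
      by (subst measurable_cong) auto
  qed
qed

lemma nn_integral_curve_length_le:
  fixes \<gamma> :: "'w \<Rightarrow> real \<Rightarrow> 'a"
  assumes "sigma_finite_measure M" "a < b"
    and meas: "\<And>r. r \<in> {a..b} \<Longrightarrow> (\<lambda>\<omega>. \<gamma> \<omega> r) \<in> borel_measurable M"
    and C1: "\<And>\<omega>. \<omega> \<in> space M \<Longrightarrow> C1_curve \<A> a b (\<gamma> \<omega>)"
    and bound: "\<And>s. s \<in> {a..b} \<Longrightarrow> (\<integral>\<^sup>+\<omega>. ennreal (speed a b (\<gamma> \<omega>) s) \<partial>M) \<le> C"
  shows "(\<lambda>\<omega>. ennreal (curve_length \<A> g a b (\<gamma> \<omega>))) \<in> borel_measurable M"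
    and "(\<integral>\<^sup>+\<omega>. ennreal (curve_length \<A> g a b (\<gamma> \<omega>)) \<partial>M) \<le> ennreal (b - a) * C"
proof -
  note * = nn_integral_integral_le[OF assms(1,2) borel_measurable_speed[OF assms(2) _ meas C1]
      continuous_on_speed[OF C1 assms(2)] speed_nonneg[OF C1 assms(2)] bound]
  show "(\<lambda>\<omega>. ennreal (curve_length \<A> g a b (\<gamma> \<omega>))) \<in> borel_measurable M"
    unfolding curve_length_speed by (rule *(1))
  show "(\<integral>\<^sup>+\<omega>. ennreal (curve_length \<A> g a b (\<gamma> \<omega>)) \<partial>M) \<le> ennreal (b - a) * C"
    unfolding curve_length_speed by (rule *(2))
qed

lemma tangent_map_scale:
  assumes "C1_map_on \<A> S f" "x \<in> S"
  shows "tangent_map \<A> f x (\<lambda>c. a *\<^sub>R v c) = (\<lambda>d. a *\<^sub>R tangent_map \<A> f x v d)"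
proof
  fix d
  let ?c = "chart_at \<A> x"
  show "tangent_map \<A> f x (\<lambda>c. a *\<^sub>R v c) d = a *\<^sub>R tangent_map \<A> f x v d"
  proof (cases "d \<in> \<A> \<and> f x \<in> fst d")
    case True
    then have "C_on 1 (snd d \<circ> f \<circ> chart_inv ?c) (snd ?c ` (S \<inter> fst ?c \<inter> f -` fst d))"
      using assms(1) chart_at(1) unfolding C1_map_on_def by blast
    then have "(snd d \<circ> f \<circ> chart_inv ?c) differentiable (at (snd ?c x))"
      by (rule C_on_1_differentiable) (use True assms(2) chart_at(2)[of x] in blast)
    then have "linear (frechet_derivative (snd d \<circ> f \<circ> chart_inv ?c) (at (snd ?c x)))"
      by (rule linear_frechet_derivative)
    then show ?thesis
      using True by (simp add: tangent_map_def Let_def linear_cmul)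
  next
    case False
    then show ?thesis
      by (auto simp: tangent_map_def Let_def)
  qed
qed

text \<open>Division by a bound \<open>W\<close>, instead of the speed itself, gives a vector of
  norm at most one even where the curve is at rest. This vector is admissible in the supremum that
  defines \<open>tangent_map_norm\<close>.\<close>

lemma speed_image_le:
  assumes "a < b" "C1_curve \<A> a b \<gamma>" "open S" "C1_map_on \<A> S f" "\<gamma> ` {a..b} \<subseteq> S" "s \<in> {a..b}"
    and W: "0 < W" "speed a b \<gamma> s \<le> W"
  shows "ennreal (speed a b (f \<circ> \<gamma>) s / W) \<le> tangent_map_norm \<A> g f (\<gamma> s)"
proof -
  let ?u = "velocity \<A> a b \<gamma> s"
  let ?v = "\<lambda>c. (1 / W) *\<^sub>R ?u c"
  have u: "?u \<in> tangent_space \<A> (\<gamma> s)"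
    using assms by (intro velocity_tangent)
  have "velocity \<A> a b (f \<circ> \<gamma>) s \<in> tangent_space \<A> ((f \<circ> \<gamma>) s)"
    by (rule velocity_tangent[OF C1_map_curve(1)[OF assms(1-5)] assms(1,6)])
  then have fu: "tangent_map \<A> f (\<gamma> s) ?u \<in> tangent_space \<A> (f (\<gamma> s))"
    using C1_map_curve(2)[OF assms(1-6)] by simp
  have "?v \<in> {v \<in> tangent_space \<A> (\<gamma> s). tnorm g (\<gamma> s) v \<le> 1}"
    using tangent_space_scale[OF u] tnorm_scale[OF u, of "1 / W"] W by (simp add: speed_def)
  then have "ennreal (tnorm g (f (\<gamma> s)) (tangent_map \<A> f (\<gamma> s) ?v)) \<le> tangent_map_norm \<A> g f (\<gamma> s)"
    unfolding tangent_map_norm_def by (rule SUP_upper)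
  moreover have "\<gamma> s \<in> S"
    using assms(5,6) by blast
  then have "tnorm g (f (\<gamma> s)) (tangent_map \<A> f (\<gamma> s) ?v) = speed a b (f \<circ> \<gamma>) s / W"
    using tangent_map_scale[OF assms(4), of "\<gamma> s" "1 / W" ?u] tnorm_scale[OF fu, of "1 / W"] W(1)
      C1_map_curve(2)[OF assms(1-6)] by (simp add: speed_def)
  ultimately show ?thesis
    by simp
qed

end

context atlas
begin

text \<open>Being outside \<open>closure U\<close> is an open condition in time and starting point,
  by \<open>flow_path_local\<close>. An exit at time \<open>t\<close> from
  \<open>\<sigma> r0\<close> is therefore accompanied by exits at rational parameters near
  \<open>r0\<close> and at rational times just after \<open>t\<close>, so countably many of them
  determine the infimum.\<close>

lemma borel_measurable_first_exit:
  fixes h :: "'w \<Rightarrow> real \<Rightarrow> 'a \<Rightarrow> 'a" and l :: real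
  assumes flow: "\<And>\<omega>. \<omega> \<in> space M \<Longrightarrow> flow_path \<A> (h \<omega>) (\<lambda>_. \<infinity>)"
    and meas: "\<And>t x. 0 \<le> t \<Longrightarrow> (\<lambda>\<omega>. h \<omega> t x) \<in> borel_measurable M"
    and \<sigma>: "continuous_on {0..l} \<sigma>" and "0 < l"
  shows "(\<lambda>\<omega>. first_exit U (h \<omega>) (\<sigma> ` {0..l})) \<in> borel_measurable M"
proof -
  let ?Q = "\<rat> \<inter> {0..} :: real set" and ?R = "\<rat> \<inter> {0..l}"
  let ?e = "\<lambda>q r \<omega>. if h \<omega> q (\<sigma> r) \<notin> closure U then ereal q else \<infinity>"
  have eq: "first_exit U (h \<omega>) (\<sigma> ` {0..l}) = (INF q\<in>?Q. INF r\<in>?R. ?e q r \<omega>)" if \<omega>: "\<omega> \<in> space M" for \<omega>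
  proof (rule antisym)
    show "first_exit U (h \<omega>) (\<sigma> ` {0..l}) \<le> (INF q\<in>?Q. INF r\<in>?R. ?e q r \<omega>)"
    proof (intro INF_greatest)
      fix q r assume q: "q \<in> ?Q" and r: "r \<in> ?R"
      show "first_exit U (h \<omega>) (\<sigma> ` {0..l}) \<le> ?e q r \<omega>"
      proof (cases "h \<omega> q (\<sigma> r) \<in> closure U")
        case False
        then have "first_exit U (h \<omega>) (\<sigma> ` {0..l}) \<le> ereal q"
          unfolding first_exit_def using q r by (intro INF_lower2[of "\<sigma> r"] INF_lower) auto
        then show ?thesis
          using False by simp
      qed simp
    qed
    show "(INF q\<in>?Q. INF r\<in>?R. ?e q r \<omega>) \<le> first_exit U (h \<omega>) (\<sigma> ` {0..l})"
      unfolding first_exit_def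
    proof (intro INF_greatest)
      fix x t assume "x \<in> \<sigma> ` {0..l}" and t: "t \<in> {t. 0 \<le> t \<and> h \<omega> t x \<notin> closure U}"
      then obtain r0 where r0: "r0 \<in> {0..l}" "x = \<sigma> r0"
        by blast
      obtain \<delta> W where W: "0 < \<delta>" "open W" "x \<in> W"
        "\<And>q y. 0 \<le> q \<Longrightarrow> \<bar>q - t\<bar> < \<delta> \<Longrightarrow> y \<in> W \<Longrightarrow> ereal q < \<infinity> \<and> h \<omega> q y \<in> - closure U"
        by (rule flow_path_local[OF flow[OF \<omega>], where s=t and x=x and N="- closure U"]) (use t in auto)
      have "eventually (\<lambda>r. \<sigma> r \<in> W) (at r0 within {0..l})"
        using \<sigma> r0 W by (intro eventually_preimage_open) auto
      then obtain \<eta> where \<eta>: "0 < \<eta>" "\<And>r. r \<in> {0..l} \<Longrightarrow> r \<noteq> r0 \<Longrightarrow> dist r r0 < \<eta> \<Longrightarrow> \<sigma> r \<in> W"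
        unfolding eventually_at by blast
      \<comment> \<open>Because \<open>0 < l\<close>, the parameters near \<open>r0\<close> contain
        a nondegenerate interval even if \<open>r0\<close> is an end point.\<close>
      have "max 0 (r0 - \<eta>) < min l (r0 + \<eta>)"
        using r0(1) \<eta>(1) \<open>0 < l\<close> by auto
      then obtain r where r: "r \<in> \<rat>" "max 0 (r0 - \<eta>) < r" "r < min l (r0 + \<eta>)"
        using Rats_dense_in_real by blast
      then have rR: "r \<in> ?R" and rW: "\<sigma> r \<in> W"
        using \<eta>(2)[of r] r0(2) W(3) by (cases "r = r0"; force simp: dist_real_def)+
      show "(INF q\<in>?Q. INF r\<in>?R. ?e q r \<omega>) \<le> ereal t"
      proof (rule ereal_le_epsilon2)
        fix e :: real assume "0 < e"
        then have "t < t + min \<delta> e"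
          using W(1) by simp
        then obtain q where q: "q \<in> \<rat>" "t < q" "q < t + min \<delta> e"
          using Rats_dense_in_real by blast
        then have "h \<omega> q (\<sigma> r) \<notin> closure U"
          using W(4)[of q "\<sigma> r"] t rW by auto
        then have "(INF q\<in>?Q. INF r\<in>?R. ?e q r \<omega>) \<le> ereal q"
          using q t rR by (intro INF_lower2[of q] INF_lower2[of r]) auto
        also have "\<dots> \<le> ereal t + ereal e"
          using q by simp
        finally show "(INF q\<in>?Q. INF r\<in>?R. ?e q r \<omega>) \<le> ereal t + ereal e" .
      qed
    qed
  qed
  have "(\<lambda>\<omega>. INF q\<in>?Q. INF r\<in>?R. ?e q r \<omega>) \<in> borel_measurable M"
  proof (intro borel_measurable_INF countable_Int1 countable_rat)
    fix q r assume "q \<in> ?Q" "r \<in> ?R"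
    then have "{\<omega> \<in> space M. h \<omega> q (\<sigma> r) \<in> - closure U} \<in> sets M"
      using measurable_sets[OF meas[of q "\<sigma> r"], of "- closure U"]
      by (simp add: vimage_def Int_def conj_commute)
    then show "?e q r \<in> borel_measurable M"
      by (intro measurable_If) auto
  qed
  then show ?thesis
    by (subst measurable_cong[OF eq])
qed

end

section \<open>Explosion along a curve\<close>

lemma exhaustion_compact:
  fixes U :: "nat \<Rightarrow> 'a::topological_space set"
  assumes U: "\<And>i. open (U i)" "\<And>i. closure (U i) \<subseteq> U (Suc i)" "(\<Union>i. U i) = UNIV"
    and "compact C"
  obtains i where "\<And>j. i \<le> j \<Longrightarrow> C \<subseteq> U j"
proof -
  have mono: "U i \<subseteq> U j" if "i \<le> j" for i j
    using that
  proof (rule lift_Suc_mono_le[rotated])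
    show "U n \<subseteq> U (Suc n)" for n
      using U(2)[of n] closure_subset by blast
  qed
  have "C \<subseteq> (\<Union>i\<in>UNIV. U i)"
    using U(3) by simp
  then obtain I where I: "finite I" "C \<subseteq> (\<Union>i\<in>I. U i)"
    by (rule compactE_image[OF assms(4) U(1)])
  show thesis
  proof (rule that)
    fix j assume j: "Max (insert 0 I) \<le> j"
    have "U i \<subseteq> U j" if "i \<in> I" for i
      using mono[of i j] I(1) that j by simp
    then show "C \<subseteq> U j"
      using I(2) by blast
  qed
qed

context riemannian
begin

text \<open>The distance is measured from the surviving point \<open>x\<close> itself. Its images up
  to \<open>T\<close> are reached from \<open>x\<close> at cost at most \<open>R0\<close>, and any
  other image point costs at most the length of the image curve more. So a distance above
  \<open>R0 + R\<close> forces a length above \<open>R\<close>, and this holds for all large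
  \<open>j\<close>.\<close>

lemma curve_length_blowup:
  assumes conn: "connected (UNIV :: 'a set)" and flow: "flow_path \<A> f \<zeta>"
    and "0 < l" and \<sigma>: "C1_curve \<A> 0 l \<sigma>" and x: "x \<in> \<sigma> ` {0..l}" "\<zeta> x = \<infinity>"
    and T: "(INF x\<in>\<sigma> ` {0..l}. \<zeta> x) = ereal T"
    and blowup: "((\<lambda>t. SUP y\<in>\<sigma> ` {0..l}. ereal (riemannian_dist \<A> g x (f t y))) \<longlongrightarrow> \<infinity>) (at_left T)"
    and \<tau>: "\<And>j. 0 \<le> \<tau> j" "\<And>j. \<tau> j < T" "\<And>t. 0 \<le> t \<Longrightarrow> t < T \<Longrightarrow> eventually (\<lambda>j. t < \<tau> j) sequentially"
  shows "eventually (\<lambda>j. R < curve_length \<A> g 0 l (\<lambda>s. f (\<tau> j) (\<sigma> s))) sequentially"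
proof -
  have "0 < T"
    using \<tau>(1)[of 0] \<tau>(2)[of 0] by simp
  have "compact ((\<lambda>(t, x). f t x) ` ({0..T} \<times> {x}))"
    by (rule flow_path_compact_image[OF flow]) (use x(2) in auto)
  then obtain R0 where R0: "\<And>z. z \<in> (\<lambda>(t, x). f t x) ` ({0..T} \<times> {x}) \<Longrightarrow> \<exists>L\<in>path_lengths \<A> g x z. L \<le> R0"
    by (rule path_lengths_compact[OF conn, where x=x]) (rule that)
  have "eventually (\<lambda>t. ereal (R0 + R) < (SUP y\<in>\<sigma> ` {0..l}. ereal (riemannian_dist \<A> g x (f t y)))) (at_left T)"
    using blowup by (rule order_tendstoD) simp
  then obtain b where b: "b < T" "\<And>t. b < t \<Longrightarrow> t < T \<Longrightarrow>
      ereal (R0 + R) < (SUP y\<in>\<sigma> ` {0..l}. ereal (riemannian_dist \<A> g x (f t y)))"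
    unfolding eventually_at_left[OF \<open>0 < T\<close>] by blast
  have "eventually (\<lambda>j. max b 0 < \<tau> j) sequentially"
    using b(1) \<open>0 < T\<close> by (intro \<tau>(3)) auto
  then show ?thesis
  proof eventually_elim
    case (elim j)
    then have "ereal (R0 + R) < (SUP y\<in>\<sigma> ` {0..l}. ereal (riemannian_dist \<A> g x (f (\<tau> j) y)))"
      using b(2) \<tau>(2) by simp
    then obtain y where y: "y \<in> \<sigma> ` {0..l}" "R0 + R < riemannian_dist \<A> g x (f (\<tau> j) y)"
      by (auto simp: less_SUP_iff)
    obtain s r where s: "s \<in> {0..l}" "x = \<sigma> s" and r: "r \<in> {0..l}" "y = \<sigma> r"
      using x(1) y(1) by blast
    have "\<sigma> ` {0..l} \<subseteq> {x. ereal (\<tau> j) < \<zeta> x}"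
    proof
      fix z assume z: "z \<in> \<sigma> ` {0..l}"
      have "ereal (\<tau> j) < (INF x\<in>\<sigma> ` {0..l}. \<zeta> x)"
        using T \<tau>(2) by simp
      then show "z \<in> {x. ereal (\<tau> j) < \<zeta> x}"
        using z by (auto dest: less_INF_D)
    qed
    then have C1: "C1_curve \<A> 0 l (\<lambda>s. f (\<tau> j) (\<sigma> s))"
      using C1_map_curve(1)[OF \<open>0 < l\<close> \<sigma> flow_path_domain_open[OF flow \<tau>(1)] flow_path_C1_map[OF flow \<tau>(1)], of j]
      by (simp add: comp_def)
    have "f (\<tau> j) x \<in> (\<lambda>(t, x). f t x) ` ({0..T} \<times> {x})"
      using \<tau>(1,2)[of j] by (intro image_eqI[of _ _ "(\<tau> j, x)"]) auto
    then obtain L where L: "L \<in> path_lengths \<A> g x (f (\<tau> j) (\<sigma> s))" "L \<le> R0"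
      using R0 s(2) by blast
    obtain L' where "L' \<in> path_lengths \<A> g x (f (\<tau> j) (\<sigma> r))"
      "L' \<le> L + curve_length \<A> g 0 l (\<lambda>s. f (\<tau> j) (\<sigma> s))"
      using path_lengths_along_curve[OF L(1) C1 \<open>0 < l\<close> s(1) r(1)] by blast
    then show ?case
      using riemannian_dist_le y(2) r(2) L(2) by fastforce
  qed
qed

end

lemma (in atlas) partial_flow_path:
  assumes "partial_flow \<A> g P \<F> B X A F \<xi>"
  shows "AE \<omega> in P. flow_path \<A> (\<lambda>t x. F t x \<omega>) (\<lambda>x. \<xi> x \<omega>)"
proof -
  have "AE \<omega> in P.
        (\<forall>x. 0 < \<xi> x \<omega> \<and> F 0 x \<omega> = x) \<and>
        (\<forall>t\<ge>0. C1_diffeo_on \<A> {x. ereal t < \<xi> x \<omega>} (\<lambda>x. F t x \<omega>)) \<and>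
        (\<forall>s\<ge>0. \<forall>c\<in>\<A>. \<forall>d\<in>\<A>. \<forall>C.
           compact C \<and> C \<subseteq> fst c \<and> C \<subseteq> {x. ereal s < \<xi> x \<omega>} \<and> (\<lambda>x. F s x \<omega>) ` C \<subseteq> fst d \<longrightarrow>
           (\<forall>\<epsilon>>0. eventually (\<lambda>t.
              C \<subseteq> {x. ereal t < \<xi> x \<omega>} \<and> (\<lambda>x. F t x \<omega>) ` C \<subseteq> fst d \<and>
              (\<forall>x\<in>C. norm (snd d (F t x \<omega>) - snd d (F s x \<omega>)) < \<epsilon> \<and>
                 onorm (\<lambda>u.
                   frechet_derivative (snd d \<circ> (\<lambda>y. F t y \<omega>) \<circ> chart_inv c) (at (snd c x)) u -
                   frechet_derivative (snd d \<circ> (\<lambda>y. F s y \<omega>) \<circ> chart_inv c) (at (snd c x)) u) < \<epsilon>))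
              (at s within {0..})))"
    by (rule assms[unfolded partial_flow_def, THEN conjunct2, THEN conjunct1])
  then show ?thesis
  proof (rule eventually_mono, goal_cases)
    case (1 \<omega>)
    note C1_topology = 1[THEN conjunct2, THEN conjunct2]
    show ?case
      unfolding flow_path_def
    proof (intro conjI)
      show "\<forall>x. 0 < \<xi> x \<omega> \<and> F 0 x \<omega> = x" "\<forall>t\<ge>0. C1_diffeo_on \<A> {x. ereal t < \<xi> x \<omega>} (\<lambda>x. F t x \<omega>)"
        by (rule 1[THEN conjunct1], rule 1[THEN conjunct2, THEN conjunct1])
    next
      show "\<forall>s\<ge>0. \<forall>c\<in>\<A>. \<forall>d\<in>\<A>. \<forall>C.
          compact C \<and> C \<subseteq> fst c \<and> C \<subseteq> {x. ereal s < \<xi> x \<omega>} \<and> (\<lambda>x. F s x \<omega>) ` C \<subseteq> fst d \<longrightarrow>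
          (\<forall>\<epsilon>>0. eventually (\<lambda>t. C \<subseteq> {x. ereal t < \<xi> x \<omega>} \<and> (\<lambda>x. F t x \<omega>) ` C \<subseteq> fst d \<and>
             (\<forall>x\<in>C. norm (snd d (F t x \<omega>) - snd d (F s x \<omega>)) < \<epsilon>)) (at s within {0..}))"
      proof (intro allI impI ballI)
        fix s c d C \<epsilon>
        assume "0 \<le> s" "c \<in> \<A>" "d \<in> \<A>" "compact C \<and> C \<subseteq> fst c \<and> C \<subseteq> {x. ereal s < \<xi> x \<omega>} \<and> (\<lambda>x. F s x \<omega>) ` C \<subseteq> fst d"
          "(0::real) < \<epsilon>"
        from C1_topology[rule_format, OF this]
        show "eventually (\<lambda>t. C \<subseteq> {x. ereal t < \<xi> x \<omega>} \<and> (\<lambda>x. F t x \<omega>) ` C \<subseteq> fst d \<and>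
            (\<forall>x\<in>C. norm (snd d (F t x \<omega>) - snd d (F s x \<omega>)) < \<epsilon>)) (at s within {0..})"
          by (rule eventually_mono) simp
      qed
    qed
  qed
qed

section \<open>The flow and its localisation as one setting\<close>

locale flow_setting = riemannian \<A> g + prob_space P
  for \<A> :: "('a::{t2_space,second_countable_topology}, 'e::euclidean_space) chart set"
    and g :: "('a, 'e) metric" and P :: "'w measure" +
  fixes \<F> :: "real \<Rightarrow> 'w measure" and B :: "real \<Rightarrow> 'w \<Rightarrow> 'b::euclidean_space"
    and X :: "'a \<Rightarrow> 'b \<Rightarrow> ('a, 'e) tvec" and A :: "'a \<Rightarrow> ('a, 'e) tvec"
    and F :: "real \<Rightarrow> 'a \<Rightarrow> 'w \<Rightarrow> 'a" and \<xi> :: "'a \<Rightarrow> 'w \<Rightarrow> ereal"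
    and U :: "nat \<Rightarrow> 'a set" and \<phi> :: "nat \<Rightarrow> 'a \<Rightarrow> real"
    and G :: "nat \<Rightarrow> real \<Rightarrow> 'a \<Rightarrow> 'w \<Rightarrow> 'a"
  assumes connected: "connected (UNIV :: 'a set)"
    and usual_conditions: "usual_conditions P \<F>"
    and partial_flow: "partial_flow \<A> g P \<F> B X A F \<xi>"
    and localisation: "localisation \<A> g P \<F> B X A F \<xi> U \<phi> G"
begin

lemma open_U: "open (U i)"
  and compact_closure_U: "compact (closure (U i))"
  and closure_U: "closure (U i) \<subseteq> U (Suc i)"
  and U_cover: "(\<Union>i. U i) = UNIV"
  using localisation[unfolded localisation_def, THEN conjunct1]
    localisation[unfolded localisation_def, THEN conjunct2, THEN conjunct1] by simp_all

lemma cut_partial_flow: "partial_flow \<A> g P \<F> B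
    (\<lambda>x u c. \<phi> i x *\<^sub>R X x u c) (\<lambda>x c. \<phi> i x *\<^sub>R A x c) (G i) (\<lambda>x \<omega>. \<infinity>)"
  by (rule localisation[unfolded localisation_def, THEN conjunct2, THEN conjunct2, THEN conjunct2,
        THEN conjunct1, THEN spec])

text \<open>With infinite lifetime, adaptedness of the maximal solution is measurability of the map
  itself, without an event of survival.\<close>

lemma cut_flow_measurable:
  assumes "0 \<le> t"
  shows "(\<lambda>\<omega>. G i t x \<omega>) \<in> borel_measurable P"
proof (rule borel_measurableI)
  fix S :: "'a set" assume "open S"
  then have "{\<omega> \<in> space P. ereal t < \<infinity> \<and> G i t x \<omega> \<in> S} \<in> sets (\<F> t)"
    using cut_partial_flow[of i, unfolded partial_flow_def, THEN conjunct1, THEN spec,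
        unfolded maximal_solution_def, THEN conjunct2, THEN conjunct1] assms by simp
  moreover have "sets (\<F> t) \<subseteq> sets P"
    using usual_conditions unfolding usual_conditions_def subalgebra_def by blast
  ultimately show "(\<lambda>\<omega>. G i t x \<omega>) -` S \<inter> space P \<in> sets P"
    by (auto simp: vimage_def Int_def conj_commute)
qed

lemma blowup_AE:
  assumes "compact K"
  shows "AE \<omega> in P. explosion_inf \<xi> K \<omega> < \<infinity> \<longrightarrow>
    ((\<lambda>t. SUP x\<in>K. ereal (riemannian_dist \<A> g x0 (F t x \<omega>))) \<longlongrightarrow> \<infinity>)
      (at_left (real_of_ereal (explosion_inf \<xi> K \<omega>)))"
  by (rule partial_flow[unfolded partial_flow_def, THEN conjunct2, THEN conjunct2, rule_format, OF assms])

text \<open>The exceptional null set depends on \<open>j\<close>, but there are countably many of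
  these, so one null set serves all \<open>j\<close>.\<close>

lemma stopped_flow_AE:
  assumes "compact K" "K \<noteq> {}"
  shows "AE \<omega> in P. \<forall>j. stopped_flow \<A> g (\<lambda>t x. F t x \<omega>) (\<lambda>x. \<xi> x \<omega>) (\<lambda>t x. G j t x \<omega>) (U j) K x0"
proof -
  have "AE \<omega> in P. stopped_flow \<A> g (\<lambda>t x. F t x \<omega>) (\<lambda>x. \<xi> x \<omega>) (\<lambda>t x. G j t x \<omega>) (U j) K x0" for j
  proof -
    have "AE \<omega> in P. \<forall>x\<in>K. \<forall>t\<ge>0. ereal t < exit_inf (U j) (G j) K \<omega> \<longrightarrow> ereal t < \<xi> x \<omega> \<and> G j t x \<omega> = F t x \<omega>"
      by (rule localisation[unfolded localisation_def, THEN conjunct2, THEN conjunct2, THEN conjunct2,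
            THEN conjunct2, THEN spec, THEN spec, THEN mp, OF assms(1)])
    then show ?thesis
      using partial_flow_path[OF partial_flow] partial_flow_path[OF cut_partial_flow[of j]] blowup_AE[OF assms(1), of x0]
    proof eventually_elim
      case (elim \<omega>)
      then show ?case
        using assms open_U[of j]
        by unfold_locales (simp_all add: explosion_inf_def exit_inf_def exit_time_def first_exit_def)
    qed
  qed
  then show ?thesis
    by (simp add: AE_all_countable)
qed

end

lemma exit_inf_eq: "exit_inf U G K \<omega> = first_exit U (\<lambda>t x. G t x \<omega>) K"
  by (simp add: exit_inf_def exit_time_def first_exit_def)

section \<open>Expected length at the exit time and the consequence of Fatou's lemma\<close>

context flow_setting
begin

text \<open>On \<open>\<Omega>1\<close> the flow at the exit time is the cut-off flow, which makes
  the length measurable. In the factor \<open>l * W\<close>, Tonelli contributes the length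
  \<open>l\<close> of the parameter interval, and \<open>W\<close> is the normalisation of
  \<open>speed_image_le\<close>.\<close>

lemma expected_length_le:
  fixes j :: nat and t :: real
  assumes \<sigma>: "C1_curve \<A> 0 l \<sigma>" "0 < l" and K: "K = \<sigma> ` {0..l}" and \<Omega>0: "\<Omega>0 \<in> sets P"
    and sf: "\<And>\<omega>. \<omega> \<in> \<Omega>0 \<Longrightarrow>
      stopped_flow \<A> g (\<lambda>t x. F t x \<omega>) (\<lambda>x. \<xi> x \<omega>) (\<lambda>t x. G j t x \<omega>) (U j) K x0"
    and W: "0 < W" "\<And>s. s \<in> {0..l} \<Longrightarrow> speed 0 l \<sigma> s \<le> W"
  defines "\<Omega>1 \<equiv> {\<omega> \<in> \<Omega>0. exit_inf (U j) (G j) K \<omega> < ereal t}"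
  defines "\<Lambda> \<equiv> \<lambda>\<omega>. ennreal (curve_length \<A> g 0 l
    (\<lambda>s. F (real_of_ereal (exit_inf (U j) (G j) K \<omega>)) (\<sigma> s) \<omega>)) * indicator \<Omega>1 \<omega>"
  shows "\<Lambda> \<in> borel_measurable P"
    and "(\<integral>\<^sup>+\<omega>. \<Lambda> \<omega> \<partial>P) \<le> ennreal (l * W) *
      (SUP x\<in>K. \<integral>\<^sup>+ \<omega>.
        tangent_map_norm \<A> g (\<lambda>y. F (real_of_ereal (exit_inf (U j) (G j) K \<omega>)) y \<omega>) x *
        indicator {\<omega>. exit_inf (U j) (G j) K \<omega> < ereal t} \<omega> \<partial>P)"
proof -
  let ?S = "exit_inf (U j) (G j) K"
  let ?c = "SUP x\<in>K. \<integral>\<^sup>+ \<omega>.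
        tangent_map_norm \<A> g (\<lambda>y. F (real_of_ereal (?S \<omega>)) y \<omega>) x *
        indicator {\<omega>. ?S \<omega> < ereal t} \<omega> \<partial>P"
  define \<tau> where "\<tau> \<omega> = real_of_ereal (?S \<omega>)" for \<omega>
  \<comment> \<open>\<open>G j\<close> is continuous for all times and measurable at each of them,
    so the random time may be inserted; paths of \<open>F\<close> may have ended.\<close>
  define \<gamma> where "\<gamma> \<omega> s = G j (\<tau> \<omega>) (\<sigma> s) \<omega>" for \<omega> s
  have \<Omega>0_space: "\<Omega>0 \<subseteq> space P"
    using sets.sets_into_space[OF \<Omega>0] .
  have cut: "flow_path \<A> (\<lambda>t x. G j t x \<omega>) (\<lambda>_. \<infinity>)" if "\<omega> \<in> \<Omega>0" for \<omega>
    using sf[OF that] by (rule stopped_flow.cut_flow)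
  have "(\<lambda>\<omega>. first_exit (U j) (\<lambda>t x. G j t x \<omega>) (\<sigma> ` {0..l})) \<in> borel_measurable (restrict_space P \<Omega>0)"
    using cut by (intro borel_measurable_first_exit measurable_restrict_space1 cut_flow_measurable
        C1_curve_continuous \<sigma>) (auto simp: space_restrict_space)
  then have S0: "?S \<in> borel_measurable (restrict_space P \<Omega>0)"
    by (simp add: exit_inf_eq[abs_def] K)
  then have "{\<omega> \<in> space (restrict_space P \<Omega>0). ?S \<omega> < ereal t} \<in> sets (restrict_space P \<Omega>0)"
    by measurable
  moreover have "{\<omega> \<in> space (restrict_space P \<Omega>0). ?S \<omega> < ereal t} = \<Omega>1"
    using \<Omega>0_space by (auto simp: \<Omega>1_def space_restrict_space)
  ultimately have \<Omega>1: "\<Omega>1 \<in> sets P"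
    using \<Omega>0 by (simp add: sets_restrict_space_iff)
  \<comment> \<open>On \<open>\<Omega>1\<close> the exit time is below \<open>t\<close>, hence real.
    Elsewhere it may be infinite, and \<open>real_of_ereal\<close> would return 0.\<close>
  let ?M = "restrict_space P \<Omega>1"
  have space_M: "\<omega> \<in> space ?M \<longleftrightarrow> \<omega> \<in> \<Omega>1" for \<omega>
    using sets.sets_into_space[OF \<Omega>1] by (auto simp: space_restrict_space)
  have \<Omega>1_\<Omega>0: "\<omega> \<in> \<Omega>0" if "\<omega> \<in> \<Omega>1" for \<omega>
    using that by (simp add: \<Omega>1_def)
  have "?S \<in> borel_measurable ?M"
    using measurable_restrict_space1[OF S0, of \<Omega>1] \<Omega>1_\<Omega>0
    by (simp add: restrict_restrict_space \<Omega>0 \<Omega>1 Int_absorb1 subsetI)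
  then have \<tau>_meas: "\<tau> \<in> borel_measurable ?M"
    unfolding \<tau>_def by (rule borel_measurable_real_of_ereal)
  have S_\<tau>: "?S \<omega> = ereal (\<tau> \<omega>)" "0 \<le> \<tau> \<omega>" if "\<omega> \<in> \<Omega>1" for \<omega>
  proof -
    have "0 \<le> ?S \<omega>" "?S \<omega> < ereal t"
      using that first_exit_nonneg by (simp_all add: exit_inf_eq \<Omega>1_def)
    then show "?S \<omega> = ereal (\<tau> \<omega>)" "0 \<le> \<tau> \<omega>"
      unfolding \<tau>_def by (cases "?S \<omega>"; simp)+
  qed
  have \<tau>_less: "ereal (\<tau> \<omega>) < (INF x\<in>K. \<xi> x \<omega>)" and agree: "x \<in> K \<Longrightarrow> G j (\<tau> \<omega>) x \<omega> = F (\<tau> \<omega>) x \<omega>"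
    if \<omega>: "\<omega> \<in> \<Omega>1" for \<omega> x
  proof -
    interpret stopped_flow \<A> g "\<lambda>t x. F t x \<omega>" "\<lambda>x. \<xi> x \<omega>" "\<lambda>t x. G j t x \<omega>" "U j" K x0
      by (rule sf[OF \<Omega>1_\<Omega>0[OF \<omega>]])
    have S: "first_exit (U j) (\<lambda>t x. G j t x \<omega>) K = ereal (\<tau> \<omega>)"
      using S_\<tau>(1)[OF \<omega>] by (simp add: exit_inf_eq)
    show "ereal (\<tau> \<omega>) < (INF x\<in>K. \<xi> x \<omega>)"
      using first_exit_less_lifetime[OF connected compact_closure_U] S by simp
    then show "x \<in> K \<Longrightarrow> G j (\<tau> \<omega>) x \<omega> = F (\<tau> \<omega>) x \<omega>"
      by (rule agree_at_first_exit[OF S])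
  qed
  have \<gamma>_meas: "(\<lambda>\<omega>. \<gamma> \<omega> s) \<in> borel_measurable ?M" for s
    unfolding \<gamma>_def
  proof (rule borel_measurable_random_time[OF measurable_restrict_space1[OF cut_flow_measurable] _ \<tau>_meas])
    fix \<omega> assume "\<omega> \<in> space ?M"
    then have \<omega>: "\<omega> \<in> \<Omega>1"
      by (simp add: space_M)
    then show "0 \<le> \<tau> \<omega>"
      by (rule S_\<tau>)
    show "continuous_on {0..} (\<lambda>t. G j t (\<sigma> s) \<omega>)"
      using flow_path_continuous_time[OF cut[OF \<Omega>1_\<Omega>0[OF \<omega>]], of "\<sigma> s"] by (simp add: atLeast_def)
  qed
  have flow_curve: "C1_curve \<A> 0 l (\<gamma> \<omega>)" "s \<in> {0..l} \<Longrightarrow>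
      ennreal (speed 0 l (\<gamma> \<omega>) s / W) \<le> tangent_map_norm \<A> g (\<lambda>y. F (\<tau> \<omega>) y \<omega>) (\<sigma> s)"
    "curve_length \<A> g 0 l (\<gamma> \<omega>) = curve_length \<A> g 0 l (\<lambda>s. F (\<tau> \<omega>) (\<sigma> s) \<omega>)"
    if \<omega>: "\<omega> \<in> \<Omega>1" for \<omega> s
  proof -
    let ?f = "\<lambda>y. F (\<tau> \<omega>) y \<omega>" and ?D = "{x. ereal (\<tau> \<omega>) < \<xi> x \<omega>}"
    have flow: "flow_path \<A> (\<lambda>t x. F t x \<omega>) (\<lambda>x. \<xi> x \<omega>)"
      using sf[OF \<Omega>1_\<Omega>0[OF \<omega>]] by (rule stopped_flow.flow)
    have sub: "\<sigma> ` {0..l} \<subseteq> ?D"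
      using \<tau>_less[OF \<omega>] K by (auto dest: less_INF_D)
    note facts = \<sigma>(2,1) flow_path_domain_open[OF flow S_\<tau>(2)[OF \<omega>]] flow_path_C1_map[OF flow S_\<tau>(2)[OF \<omega>]] sub
    have eq: "\<gamma> \<omega> s = (?f \<circ> \<sigma>) s" if "s \<in> {0..l}" for s
      using agree[OF \<omega>] that K by (simp add: \<gamma>_def)
    have C1: "C1_curve \<A> 0 l (?f \<circ> \<sigma>)"
      by (rule C1_map_curve(1)[OF facts])
    then show "C1_curve \<A> 0 l (\<gamma> \<omega>)"
      by (rule C1_curve_cong[OF \<sigma>(2) _ eq])
    show "curve_length \<A> g 0 l (\<gamma> \<omega>) = curve_length \<A> g 0 l (\<lambda>s. F (\<tau> \<omega>) (\<sigma> s) \<omega>)"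
      by (rule curve_length_cong) (simp add: eq)
    show "ennreal (speed 0 l (\<gamma> \<omega>) s / W) \<le> tangent_map_norm \<A> g ?f (\<sigma> s)" if s: "s \<in> {0..l}"
    proof -
      have "velocity \<A> 0 l (\<gamma> \<omega>) s = velocity \<A> 0 l (?f \<circ> \<sigma>) s"
        by (rule velocity_cong[OF eq s])
      then have "speed 0 l (\<gamma> \<omega>) s = speed 0 l (?f \<circ> \<sigma>) s"
        by (simp only: speed_def eq[OF s])
      then show ?thesis
        using speed_image_le[OF facts s W(1) W(2)[OF s]] by simp
    qed
  qed
  have bound: "(\<integral>\<^sup>+\<omega>. ennreal (speed 0 l (\<gamma> \<omega>) s) \<partial>?M) \<le> ennreal W * ?c" if s: "s \<in> {0..l}" for s
  proof -
    have meas: "(\<lambda>\<omega>. speed 0 l (\<gamma> \<omega>) s) \<in> borel_measurable ?M"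
      using flow_curve(1) by (intro borel_measurable_speed \<sigma>(2) s \<gamma>_meas) (simp add: space_M)
    have "(\<integral>\<^sup>+\<omega>. ennreal (speed 0 l (\<gamma> \<omega>) s) \<partial>?M) = (\<integral>\<^sup>+\<omega>. ennreal W * ennreal (speed 0 l (\<gamma> \<omega>) s / W) \<partial>?M)"
      using W(1) by (simp flip: ennreal_mult')
    also have "\<dots> = ennreal W * (\<integral>\<^sup>+\<omega>. ennreal (speed 0 l (\<gamma> \<omega>) s / W) \<partial>?M)"
      by (intro nn_integral_cmult measurable_compose[OF _ measurable_ennreal] borel_measurable_divide
          meas borel_measurable_const)
    also have "(\<integral>\<^sup>+\<omega>. ennreal (speed 0 l (\<gamma> \<omega>) s / W) \<partial>?M) =
        (\<integral>\<^sup>+\<omega>. ennreal (speed 0 l (\<gamma> \<omega>) s / W) * indicator \<Omega>1 \<omega> \<partial>P)"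
      using \<Omega>1 by (simp add: nn_integral_restrict_space)
    \<comment> \<open>Measurability of the operator norm in \<omega> is not at hand, and
      monotonicity of the integral does not ask for it.\<close>
    also have "\<dots> \<le> (\<integral>\<^sup>+\<omega>. tangent_map_norm \<A> g (\<lambda>y. F (real_of_ereal (?S \<omega>)) y \<omega>) (\<sigma> s) *
        indicator {\<omega>. ?S \<omega> < ereal t} \<omega> \<partial>P)"
    proof (rule nn_integral_mono)
      fix \<omega>
      show "ennreal (speed 0 l (\<gamma> \<omega>) s / W) * indicator \<Omega>1 \<omega> \<le>
          tangent_map_norm \<A> g (\<lambda>y. F (real_of_ereal (?S \<omega>)) y \<omega>) (\<sigma> s) * indicator {\<omega>. ?S \<omega> < ereal t} \<omega>"
      proof (cases "\<omega> \<in> \<Omega>1")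
        case True
        then show ?thesis
          using flow_curve(2)[OF True s] by (simp add: \<Omega>1_def \<tau>_def)
      qed simp
    qed
    also have "\<dots> \<le> ?c"
      using s K by (intro SUP_upper) auto
    finally show ?thesis
      by (simp add: mult_left_mono)
  qed
  have sigma: "sigma_finite_measure ?M"
    using \<Omega>1 by (intro sigma_finite_measure_restrict_space sigma_finite_measure_axioms) auto
  note len = nn_integral_curve_length_le[OF sigma \<sigma>(2) \<gamma>_meas _ bound]
  have \<Lambda>_eq: "\<Lambda> \<omega> = ennreal (curve_length \<A> g 0 l (\<gamma> \<omega>)) * indicator \<Omega>1 \<omega>" for \<omega>
    using flow_curve(3)[of \<omega>] by (cases "\<omega> \<in> \<Omega>1") (simp_all add: \<Lambda>_def \<tau>_def)
  have \<Omega>1_space: "\<Omega>1 \<inter> space P \<in> sets P"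
    using \<Omega>1 by simp
  have "(\<lambda>\<omega>. ennreal (curve_length \<A> g 0 l (\<gamma> \<omega>))) \<in> borel_measurable ?M"
    by (rule len(1)) (use flow_curve(1) in \<open>simp_all add: space_M\<close>)
  then show "\<Lambda> \<in> borel_measurable P"
    unfolding \<Lambda>_eq[abs_def] by (simp add: borel_measurable_restrict_space_iff_ennreal[OF \<Omega>1_space])
  have "(\<integral>\<^sup>+\<omega>. \<Lambda> \<omega> \<partial>P) = (\<integral>\<^sup>+\<omega>. ennreal (curve_length \<A> g 0 l (\<gamma> \<omega>)) \<partial>?M)"
    using \<Omega>1 by (simp add: \<Lambda>_eq nn_integral_restrict_space)
  also have "\<dots> \<le> ennreal (l - 0) * (ennreal W * ?c)"
    by (rule len(2)) (use flow_curve(1) in \<open>simp_all add: space_M\<close>)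
  also have "\<dots> = ennreal (l * W) * ?c"
    using W(1) \<sigma>(2) by (simp add: ennreal_mult mult.assoc)
  finally show "(\<integral>\<^sup>+\<omega>. \<Lambda> \<omega> \<partial>P) \<le> ennreal (l * W) * ?c" .
qed

lemma C1_curve_image_compact: "K \<in> C1_curve_images \<A> \<Longrightarrow> compact K"
  and C1_curve_image_nonempty: "K \<in> C1_curve_images \<A> \<Longrightarrow> K \<noteq> {}"
  unfolding C1_curve_images_def
  by (auto intro!: compact_continuous_image C1_curve_continuous)

lemma curve_nonexplosive:
  assumes K: "K \<in> C1_curve_images \<A>" and x: "x \<in> K" "AE \<omega> in P. \<xi> x \<omega> = \<infinity>"
    and bound: "\<And>t. 0 < t \<Longrightarrow> liminf (\<lambda>j. SUP x\<in>K. \<integral>\<^sup>+ \<omega>.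
        tangent_map_norm \<A> g (\<lambda>y. F (real_of_ereal (exit_inf (U j) (G j) K \<omega>)) y \<omega>) x *
        indicator {\<omega>. exit_inf (U j) (G j) K \<omega> < ereal t} \<omega> \<partial>P) < \<infinity>"
  shows "AE \<omega> in P. explosion_inf \<xi> K \<omega> = \<infinity>"
proof -
  obtain \<sigma> l where \<sigma>: "C1_curve \<A> 0 l \<sigma>" "0 < l" "K = \<sigma> ` {0..l}"
    using K unfolding C1_curve_images_def by blast
  let ?S = "\<lambda>j. exit_inf (U j) (G j) K"
  let ?sf = "\<lambda>\<omega> j. stopped_flow \<A> g (\<lambda>t x. F t x \<omega>) (\<lambda>x. \<xi> x \<omega>) (\<lambda>t x. G j t x \<omega>) (U j) K x"
  have "AE \<omega> in P. (\<forall>j. ?sf \<omega> j) \<and> \<xi> x \<omega> = \<infinity>"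
    using stopped_flow_AE[OF C1_curve_image_compact[OF K] C1_curve_image_nonempty[OF K], of x] x(2)
    by eventually_elim simp
  then obtain N where N: "N \<in> null_sets P" "{\<omega> \<in> space P. \<not> ((\<forall>j. ?sf \<omega> j) \<and> \<xi> x \<omega> = \<infinity>)} \<subseteq> N"
    unfolding eventually_ae_filter by blast
  \<comment> \<open>The set of good outcomes is not known to be measurable; the complement of a null
    set that contains the bad ones is.\<close>
  define \<Omega>0 where "\<Omega>0 = space P - N"
  have \<Omega>0: "\<Omega>0 \<in> sets P"
    using N(1) by (auto simp: \<Omega>0_def)
  have good: "?sf \<omega> j" "\<xi> x \<omega> = \<infinity>" if "\<omega> \<in> \<Omega>0" for \<omega> j
    using that N(2) by (auto simp: \<Omega>0_def)
  have AE_\<Omega>0: "AE \<omega> in P. \<omega> \<in> \<Omega>0"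
    using AE_not_in[OF N(1)] by (auto simp: \<Omega>0_def)
  have "bounded (speed 0 l \<sigma> ` {0..l})"
    by (intro compact_imp_bounded compact_continuous_image continuous_on_speed \<sigma> compact_Icc)
  then obtain W0 where W0: "\<forall>v\<in>speed 0 l \<sigma> ` {0..l}. \<bar>v\<bar> \<le> W0"
    unfolding bounded_real ..
  \<comment> \<open>The maximum with 1 keeps \<open>W\<close> positive for a constant curve.\<close>
  define W where "W = max 1 W0"
  have W: "0 < W"
    by (simp add: W_def)
  have speed_W: "speed 0 l \<sigma> s \<le> W" if "s \<in> {0..l}" for s
  proof -
    have "\<bar>speed 0 l \<sigma> s\<bar> \<le> W0"
      using W0 that by blast
    then show ?thesis
      by (simp add: W_def)
  qed
  \<comment> \<open>\<open>\<kappa>\<close> cancels the factor \<open>l * W\<close>, so the expected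
    normalised lengths are bounded by the very quantities of the hypothesis.\<close>
  define \<kappa> where "\<kappa> = ennreal (1 / (l * W))"
  have lW: "0 < l * W"
    using \<sigma>(2) W by simp
  have main: "AE \<omega> in P. \<not> (explosion_inf \<xi> K \<omega> < ereal t)" if t: "0 < t" for t
  proof -
    define \<Lambda> where "\<Lambda> j \<omega> = ennreal (curve_length \<A> g 0 l
      (\<lambda>s. F (real_of_ereal (?S j \<omega>)) (\<sigma> s) \<omega>)) * indicator {\<omega> \<in> \<Omega>0. ?S j \<omega> < ereal t} \<omega>" for j \<omega>
    let ?c = "\<lambda>j. SUP x\<in>K. \<integral>\<^sup>+ \<omega>.
        tangent_map_norm \<A> g (\<lambda>y. F (real_of_ereal (?S j \<omega>)) y \<omega>) x *
        indicator {\<omega>. ?S j \<omega> < ereal t} \<omega> \<partial>P"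
    have \<Lambda>: "\<Lambda> j \<in> borel_measurable P" "(\<integral>\<^sup>+\<omega>. \<Lambda> j \<omega> \<partial>P) \<le> ennreal (l * W) * ?c j" for j
      unfolding \<Lambda>_def
      using expected_length_le[OF \<sigma> \<Omega>0 good(1) W speed_W, where j=j and t=t] by auto
    have "(\<integral>\<^sup>+\<omega>. \<kappa> * \<Lambda> j \<omega> \<partial>P) \<le> ?c j" for j
    proof -
      have "(\<integral>\<^sup>+\<omega>. \<kappa> * \<Lambda> j \<omega> \<partial>P) = \<kappa> * (\<integral>\<^sup>+\<omega>. \<Lambda> j \<omega> \<partial>P)"
        using \<Lambda>(1) by (rule nn_integral_cmult)
      also have "\<dots> \<le> \<kappa> * (ennreal (l * W) * ?c j)"
        by (rule mult_left_mono[OF \<Lambda>(2)]) simp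
      also have "\<dots> = (\<kappa> * ennreal (l * W)) * ?c j"
        by (simp add: mult.assoc)
      also have "\<kappa> * ennreal (l * W) = 1"
        using lW unfolding \<kappa>_def by (subst ennreal_mult[symmetric]) auto
      finally show ?thesis
        by simp
    qed
    then have "liminf (\<lambda>j. \<integral>\<^sup>+\<omega>. \<kappa> * \<Lambda> j \<omega> \<partial>P) \<le> liminf ?c"
      by (intro Liminf_mono always_eventually) auto
    moreover have "(\<integral>\<^sup>+\<omega>. liminf (\<lambda>j. \<kappa> * \<Lambda> j \<omega>) \<partial>P) \<le> liminf (\<lambda>j. \<integral>\<^sup>+\<omega>. \<kappa> * \<Lambda> j \<omega> \<partial>P)"
      using \<Lambda>(1) by (intro nn_integral_liminf borel_measurable_times) auto
    ultimately have "(\<integral>\<^sup>+\<omega>. liminf (\<lambda>j. \<kappa> * \<Lambda> j \<omega>) \<partial>P) < \<infinity>"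
      using bound[OF t] by (meson le_less_trans)
    then have "AE \<omega> in P. liminf (\<lambda>j. \<kappa> * \<Lambda> j \<omega>) \<noteq> \<infinity>"
      using \<Lambda>(1) by (intro nn_integral_PInf_AE borel_measurable_liminf borel_measurable_times) auto
    with AE_\<Omega>0 show ?thesis
    proof eventually_elim
      case (elim \<omega>)
      show ?case
      proof
        assume less: "explosion_inf \<xi> K \<omega> < ereal t"
        note sf = good(1)[OF elim(1)]
        have flow: "flow_path \<A> (\<lambda>t x. F t x \<omega>) (\<lambda>x. \<xi> x \<omega>)"
          using sf by (rule stopped_flow.flow)
        obtain T where T: "explosion_inf \<xi> K \<omega> = ereal T" "0 < T"
          using stopped_flow.lifetime_pos[OF sf] less unfolding explosion_inf_def
          by (cases "INF x\<in>K. \<xi> x \<omega>") auto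
        have S: "?S j \<omega> < ereal T" "0 \<le> ?S j \<omega>" for j
        proof -
          have "?S j \<omega> \<le> explosion_inf \<xi> K \<omega>"
            using stopped_flow.first_exit_le_lifetime[OF sf] by (simp add: exit_inf_eq explosion_inf_def)
          then have "?S j \<omega> < \<infinity>"
            using T by auto
          then show "?S j \<omega> < ereal T"
            using stopped_flow.first_exit_less_lifetime[OF sf connected compact_closure_U] T
            by (simp add: exit_inf_eq explosion_inf_def)
          show "0 \<le> ?S j \<omega>"
            by (simp add: exit_inf_eq first_exit_nonneg)
        qed
        define \<tau> where "\<tau> j = real_of_ereal (?S j \<omega>)" for j
        have \<tau>: "?S j \<omega> = ereal (\<tau> j)" "0 \<le> \<tau> j" "\<tau> j < T" for j
          using S[of j] unfolding \<tau>_def by (cases "?S j \<omega>"; simp)+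
        \<comment> \<open>Up to a time \<open>r < T\<close> the images of \<open>K\<close> fill a
          compact set, which lies in \<open>U j\<close> for large \<open>j\<close>, so the exit
          comes after \<open>r\<close>. This is the convergence of the exit times to the explosion
          time.\<close>
        have \<tau>_lim: "eventually (\<lambda>j. r < \<tau> j) sequentially" if r: "0 \<le> r" "r < T" for r
        proof -
          have r_less: "ereal r < \<xi> y \<omega>" if "y \<in> K" for y
            using that r(2) T(1) unfolding explosion_inf_def by (metis less_INF_D less_ereal.simps(1))
          then have "compact ((\<lambda>(t, x). F t x \<omega>) ` ({0..r} \<times> K))"
            by (rule flow_path_compact_image[OF flow C1_curve_image_compact[OF K]])
          then obtain i where i: "\<And>j. i \<le> j \<Longrightarrow> (\<lambda>(t, x). F t x \<omega>) ` ({0..r} \<times> K) \<subseteq> U j"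
            by (rule exhaustion_compact[OF open_U closure_U U_cover]) (rule that)
          have "r < \<tau> j" if j: "i \<le> j" for j
          proof -
            have "F s y \<omega> \<in> U j" if "0 \<le> s" "s \<le> r" "y \<in> K" for s y
              using that by (intro subsetD[OF i[OF j]] image_eqI[where x="(s, y)"]) auto
            then have "ereal r < first_exit (U j) (\<lambda>t x. G j t x \<omega>) K"
              using r T(1) by (intro stopped_flow.first_exit_greater[OF sf]) (simp_all add: explosion_inf_def)
            then show ?thesis
              using \<tau>(1)[of j] by (simp add: exit_inf_eq)
          qed
          then show ?thesis
            unfolding eventually_sequentially by blast
        qed
        have blowup: "((\<lambda>t. SUP y\<in>K. ereal (riemannian_dist \<A> g x (F t y \<omega>))) \<longlongrightarrow> \<infinity>) (at_left T)"
          using stopped_flow.blowup[OF sf] T(1) by (simp add: explosion_inf_def)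
        have large: "eventually (\<lambda>j. R < curve_length \<A> g 0 l (\<lambda>s. F (\<tau> j) (\<sigma> s) \<omega>)) sequentially" for R
        proof (rule curve_length_blowup[OF connected flow \<sigma>(2,1) _ good(2)[OF elim(1)] _ _ \<tau>(2,3) \<tau>_lim])
          show "x \<in> \<sigma> ` {0..l}"
            using x(1) \<sigma>(3) by simp
          show "(INF y\<in>\<sigma> ` {0..l}. \<xi> y \<omega>) = ereal T"
            using T(1) \<sigma>(3) by (simp add: explosion_inf_def)
          show "((\<lambda>t. SUP y\<in>\<sigma> ` {0..l}. ereal (riemannian_dist \<A> g x (F t y \<omega>))) \<longlongrightarrow> \<infinity>) (at_left T)"
            using blowup \<sigma>(3) by simp
        qed
        have unbounded: "ennreal R \<le> liminf (\<lambda>j. \<kappa> * \<Lambda> j \<omega>)" if "0 \<le> R" for R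
        proof (rule Liminf_bounded)
          show "eventually (\<lambda>j. ennreal R \<le> \<kappa> * \<Lambda> j \<omega>) sequentially"
            using large[of "R * (l * W)"]
          proof eventually_elim
            case (elim j)
            \<comment> \<open>Explosion before \<open>t\<close> puts every exit time below
              \<open>t\<close>, so the indicator in \<open>\<Lambda>\<close> is one for this
              outcome, whatever \<open>j\<close> is.\<close>
            have "ereal T < ereal t"
              using less T(1) by simp
            then have "?S j \<omega> < ereal t"
              using S(1)[of j] by (rule less_trans[rotated])
            then have "\<Lambda> j \<omega> = ennreal (curve_length \<A> g 0 l (\<lambda>s. F (\<tau> j) (\<sigma> s) \<omega>))"
              using \<open>\<omega> \<in> \<Omega>0\<close> by (simp add: \<Lambda>_def \<tau>_def)
            then have "\<kappa> * \<Lambda> j \<omega> = ennreal (curve_length \<A> g 0 l (\<lambda>s. F (\<tau> j) (\<sigma> s) \<omega>) / (l * W))"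
              using lW by (simp add: \<kappa>_def ennreal_mult'[symmetric])
            moreover have "R \<le> curve_length \<A> g 0 l (\<lambda>s. F (\<tau> j) (\<sigma> s) \<omega>) / (l * W)"
              using elim lW by (simp add: pos_le_divide_eq)
            ultimately show ?case
              by (simp add: ennreal_leI)
          qed
        qed
        show False
        proof (cases "liminf (\<lambda>j. \<kappa> * \<Lambda> j \<omega>)")
          case (real v)
          then show False
            using unbounded[of "v + 1"] by simp
        next
          case top
          then show False
            using elim(2) by simp
        qed
      qed
    qed
  qed
  \<comment> \<open>The null set depends on \<open>t\<close>; integer times suffice to exclude every
    finite explosion time.\<close>
  have "AE \<omega> in P. \<forall>n. \<not> (explosion_inf \<xi> K \<omega> < ereal (real (Suc n)))"
    unfolding AE_all_countable by (intro allI main) simp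
  then show ?thesis
  proof eventually_elim
    case (elim \<omega>)
    show ?case
    proof (rule ereal_top)
      fix r :: real
      obtain n where "r < real n"
        using reals_Archimedean2 by blast
      then have "ereal r \<le> ereal (real (Suc n))"
        by simp
      also have "\<dots> \<le> explosion_inf \<xi> K \<omega>"
        using elim by (simp add: not_less)
      finally show "ereal r \<le> explosion_inf \<xi> K \<omega>" .
    qed
  qed
qed

end

section \<open>Discs in dimension at most two\<close>

text \<open>In dimension one \<open>b2\<close> is zero, hence the bound
  \<open>b2 \<bullet> b2 \<le> 1\<close> in place of an equality. The sphere then consists of two
  points, and the curve runs back and forth over the whole segment between them, still within the
  closed ball.\<close>

lemma sphere_subset_circle:
  fixes r :: real
  assumes "DIM('e) \<le> 2" "0 < r"
  obtains b1 b2 :: "'e::euclidean_space"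
  where "sphere 0 r \<subseteq> (\<lambda>s. (r * cos s) *\<^sub>R b1 + (r * sin s) *\<^sub>R b2) ` {0..2 * pi}"
    "\<And>s. norm ((r * cos s) *\<^sub>R b1 + (r * sin s) *\<^sub>R b2) \<le> r"
proof -
  obtain b1 b2 :: 'e where b: "b1 \<bullet> b2 = 0" "b1 \<bullet> b1 = 1" "b2 \<bullet> b2 \<le> 1"
    and rep: "\<And>x. norm x = r \<Longrightarrow> \<exists>u v. x = u *\<^sub>R b1 + v *\<^sub>R b2 \<and> u\<^sup>2 + v\<^sup>2 = r\<^sup>2"
  proof (cases "DIM('e) = 1")
    case True
    then obtain b :: 'e where B: "Basis = {b}"
      by (meson card_1_singletonE)
    show thesis
    proof (rule that[of b 0])
      have bB: "b \<in> Basis"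
        unfolding B by blast
      show "b \<bullet> 0 = 0" "(0::'e) \<bullet> 0 \<le> 1" "b \<bullet> b = 1"
        using bB by simp_all
      fix x :: 'e assume x: "norm x = r"
      have "x = (x \<bullet> b) *\<^sub>R b"
        using euclidean_representation[of x, unfolded B] by simp
      moreover have "(x \<bullet> b)\<^sup>2 = r\<^sup>2"
        using euclidean_inner[of x x, unfolded B] x by (simp add: power2_eq_square flip: power2_norm_eq_inner)
      ultimately show "\<exists>u v. x = u *\<^sub>R b + v *\<^sub>R 0 \<and> u\<^sup>2 + v\<^sup>2 = r\<^sup>2"
        by (intro exI[of _ "x \<bullet> b"] exI[of _ 0]) simp
    qed
  next
    case False
    then have "DIM('e) = 2"
      using assms(1) DIM_positive[where 'a='e] by linarith
    then obtain b1 b2 :: 'e where B: "Basis = {b1, b2}" "b1 \<noteq> b2"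
      by (meson card_2_iff)
    show thesis
    proof (rule that[of b1 b2])
      have bB: "b1 \<in> Basis" "b2 \<in> Basis"
        unfolding B(1) by blast+
      then show "b1 \<bullet> b2 = 0" "b1 \<bullet> b1 = 1" "b2 \<bullet> b2 \<le> 1"
        using B(2) by (simp_all add: inner_Basis)
      fix x :: 'e assume x: "norm x = r"
      have "x = (x \<bullet> b1) *\<^sub>R b1 + (x \<bullet> b2) *\<^sub>R b2"
        using euclidean_representation[of x, unfolded B(1)] B(2) by simp
      moreover have "(x \<bullet> b1)\<^sup>2 + (x \<bullet> b2)\<^sup>2 = r\<^sup>2"
        using euclidean_inner[of x x, unfolded B(1)] B(2) x by (simp add: power2_eq_square flip: power2_norm_eq_inner)
      ultimately show "\<exists>u v. x = u *\<^sub>R b1 + v *\<^sub>R b2 \<and> u\<^sup>2 + v\<^sup>2 = r\<^sup>2"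
        by blast
    qed
  qed
  show thesis
  proof (rule that[of b1 b2])
    show "sphere 0 r \<subseteq> (\<lambda>s. (r * cos s) *\<^sub>R b1 + (r * sin s) *\<^sub>R b2) ` {0..2 * pi}"
    proof
      fix x :: 'e assume "x \<in> sphere 0 r"
      then have "norm x = r"
        by simp
      then obtain u v where uv: "x = u *\<^sub>R b1 + v *\<^sub>R b2" "u\<^sup>2 + v\<^sup>2 = r\<^sup>2"
        using rep by blast
      then have "(u / r)\<^sup>2 + (v / r)\<^sup>2 = 1"
        using assms(2) by (simp add: power_divide flip: add_divide_distrib)
      then obtain s where "0 \<le> s" "s < 2 * pi" "u / r = cos s" "v / r = sin s"
        using sincos_total_2pi by metis
      then show "x \<in> (\<lambda>s. (r * cos s) *\<^sub>R b1 + (r * sin s) *\<^sub>R b2) ` {0..2 * pi}"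
        using uv(1) assms(2) by (intro image_eqI[of _ _ s]) (auto simp: field_simps)
    qed
    fix s
    have "(norm ((r * cos s) *\<^sub>R b1 + (r * sin s) *\<^sub>R b2))\<^sup>2 = r\<^sup>2 * ((cos s)\<^sup>2 + (sin s)\<^sup>2 * (b2 \<bullet> b2))"
      unfolding power2_norm_eq_inner using b(1,2)
      by (simp add: inner_add_left inner_add_right inner_commute[of b2 b1] power2_eq_square algebra_simps)
    also have "\<dots> \<le> r\<^sup>2 * ((cos s)\<^sup>2 + (sin s)\<^sup>2)"
      using b(3) by (intro mult_left_mono add_left_mono mult_left_le) auto
    finally show "norm ((r * cos s) *\<^sub>R b1 + (r * sin s) *\<^sub>R b2) \<le> r"
      using assms(2) by (simp add: power2_le_iff_abs_le)
  qed
qed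

section \<open>The image of a disc under the flow\<close>

context atlas
begin

text \<open>Outside \<open>Q\<close> the image of \<open>D\<close> is open and closed, so off \<open>closure U\<close> it is determined by which
  members of a finite cover of \<open>frontier U\<close> by connected sets it contains: only finitely many
  such sets occur.\<close>

lemma flow_images_bounded:
  assumes conn: "connected (UNIV :: 'a set)" and flow: "flow_path \<A> f \<zeta>"
    and D: "compact D" "open D0" "D0 \<subseteq> D"
    and U: "open U" "compact (closure U)" "U \<noteq> {}" "compact Q" "Q \<subseteq> U"
    and J: "\<And>t x. t \<in> J \<Longrightarrow> x \<in> D \<Longrightarrow> ereal t < \<zeta> x" "\<And>t. t \<in> J \<Longrightarrow> 0 \<le> t"
      "\<And>t. t \<in> J \<Longrightarrow> f t ` (D - D0) \<subseteq> Q"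
  obtains C where "compact C" "\<And>t. t \<in> J \<Longrightarrow> f t ` D \<subseteq> C"
proof -
  define V where "V t = f t ` D - Q" for t
  have E: "compact (f t ` D)" if t: "t \<in> J" for t
  proof -
    have "continuous_on {x. ereal t < \<zeta> x} (f t)"
      using flow_path_C1_map[OF flow J(2)[OF t]] by (simp add: C1_map_on_def)
    then have "continuous_on D (f t)"
      by (rule continuous_on_subset) (use J(1)[OF t] in auto)
    then show ?thesis
      using D(1) by (rule compact_continuous_image)
  qed
  have V_open: "open (V t)" if t: "t \<in> J" for t
  proof -
    let ?S = "{x. ereal t < \<zeta> x}"
    have diffeo: "C1_diffeo_on \<A> ?S (f t)"
      using flow_path_diffeo[OF flow J(2)[OF t]] .
    then have inj: "inj_on (f t) ?S" and op: "open (f t ` ?S)"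
      and cont: "continuous_on (f t ` ?S) (inv_into ?S (f t))"
      by (simp_all add: C1_diffeo_on_def C1_map_on_def)
    have D0S: "D0 \<subseteq> ?S"
      using D(3) J(1)[OF t] by auto
    \<comment> \<open>As a preimage under the continuous inverse, which lives on an open set, the
      image of \<open>D0\<close> is open.\<close>
    have "f t ` D0 = f t ` ?S \<inter> inv_into ?S (f t) -` D0"
    proof (intro equalityI subsetI)
      fix y assume "y \<in> f t ` D0"
      then obtain x where x: "x \<in> D0" "y = f t x"
        by blast
      then have "x \<in> ?S"
        using D0S by blast
      then show "y \<in> f t ` ?S \<inter> inv_into ?S (f t) -` D0"
        using x inv_into_f_f[OF inj] by simp
    next
      fix y assume y: "y \<in> f t ` ?S \<inter> inv_into ?S (f t) -` D0"
      then have "f t (inv_into ?S (f t) y) = y"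
        by (intro f_inv_into_f) blast
      then show "y \<in> f t ` D0"
        using y by (metis IntD2 imageI vimageD)
    qed
    then have "open (f t ` D0)"
      using continuous_open_preimage[OF cont op D(2)] by simp
    \<comment> \<open>The rim \<open>D - D0\<close> is sent into \<open>Q\<close>, so outside
      \<open>Q\<close> only the image of \<open>D0\<close> remains.\<close>
    moreover have "V t = f t ` D0 - Q"
      using J(3)[OF t] D(3) unfolding V_def by blast
    ultimately show ?thesis
      using U(4) by (simp add: open_Diff compact_imp_closed)
  qed
  have "\<exists>N. open N \<and> z \<in> N \<and> connected N \<and> N \<inter> Q = {}" if z: "z \<in> closure U - U" for z
  proof -
    have "open (- Q)" "z \<in> - Q"
      using U(4,5) z by (auto simp: compact_imp_closed open_Compl)
    then obtain c r where c: "c \<in> \<A>" "z \<in> fst c" "0 < r" "cball (snd c z) r \<subseteq> snd c ` (fst c \<inter> - Q)"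
      by (rule chart_neighbourhood)
    have "chart_inv c ` ball (snd c z) r \<subseteq> - Q"
      using chart_inv_ball(4)[OF c] ball_subset_cball by blast
    then show ?thesis
      using chart_inv_ball(1,2,5)[OF c] by (intro exI[of _ "chart_inv c ` ball (snd c z) r"]) blast
  qed
  then obtain N where N: "\<And>z. z \<in> closure U - U \<Longrightarrow> open (N z) \<and> z \<in> N z \<and> connected (N z) \<and> N z \<inter> Q = {}"
    by metis
  have "compact (closure U - U)"
    using compact_diff[OF U(2,1)] .
  moreover have "open (N z)" if "z \<in> closure U - U" for z
    using N[OF that] by blast
  moreover have "closure U - U \<subseteq> (\<Union>z\<in>closure U - U. N z)"
    using N by blast
  ultimately obtain I where I: "I \<subseteq> closure U - U" "finite I" "closure U - U \<subseteq> (\<Union>z\<in>I. N z)"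
    by (rule compactE_image)
  have N_V: "N z \<subseteq> V t" if z: "z \<in> I" and t: "t \<in> J" and meet: "x \<in> N z" "x \<in> V t" for z t x
  proof -
    have Nz: "connected (N z)" "N z \<inter> Q = {}"
      using N I(1) z by blast+
    have "open (- (f t ` D))"
      using compact_imp_closed[OF E[OF t]] by (rule open_Compl)
    moreover have "V t \<inter> - (f t ` D) \<inter> N z = {}" "N z \<subseteq> V t \<union> - (f t ` D)"
      using Nz(2) by (auto simp: V_def)
    ultimately have "V t \<inter> N z = {} \<or> - (f t ` D) \<inter> N z = {}"
      using connectedD[OF Nz(1) V_open[OF t]] by blast
    then show ?thesis
      using meet Nz(2) by (auto simp: V_def)
  qed
  define k where "k t = {z \<in> I. N z \<subseteq> V t}" for t
  have k_determines: "V t - closure U \<subseteq> V s" if t: "t \<in> J" and s: "s \<in> J" and eq: "k t = k s" for t s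
  proof -
    \<comment> \<open>The points of \<open>V t\<close> off \<open>closure U\<close> that
      \<open>V s\<close> misses. The set is an intersection of open sets and also one of closed
      sets. The two descriptions could differ only on \<open>closure U - U\<close>, where
      \<open>k t = k s\<close> puts every point of \<open>V t\<close> into a cover member contained
      in \<open>V s\<close>.\<close>
    let ?A = "V t \<inter> - (f s ` D) \<inter> - closure U"
    have "?A = f t ` D \<inter> - V s \<inter> - U"
    proof (intro equalityI subsetI)
      fix x assume "x \<in> ?A"
      then show "x \<in> f t ` D \<inter> - V s \<inter> - U"
        using closure_subset[of U] by (auto simp: V_def)
    next
      fix x assume x: "x \<in> f t ` D \<inter> - V s \<inter> - U"
      then have xV: "x \<in> V t" "x \<notin> f s ` D" "x \<notin> V s"
        using U(5) by (auto simp: V_def)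
      have "x \<notin> closure U"
      proof
        assume "x \<in> closure U"
        then obtain z where z: "z \<in> I" "x \<in> N z"
          using x I(3) by blast
        then have "z \<in> k s"
          using N_V[OF z(1) t z(2) xV(1)] eq unfolding k_def by blast
        then show False
          using z(2) xV(3) unfolding k_def by blast
      qed
      then show "x \<in> ?A"
        using xV by simp
    qed
    moreover have "open ?A"
      using V_open[OF t] compact_imp_closed[OF E[OF s]] by (intro open_Int open_Compl) auto
    moreover have "closed (f t ` D \<inter> - V s \<inter> - U)"
      using V_open[OF s] U(1) compact_imp_closed[OF E[OF t]] by (intro closed_Int closed_Compl)
    ultimately have "open ?A" "closed ?A"
      by simp_all
    moreover have "\<forall>T :: 'a set. open T \<and> closed T \<longrightarrow> T = {} \<or> T = UNIV"
      using conn by (simp add: connected_clopen)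
    ultimately have "?A = {} \<or> ?A = UNIV"
      by blast
    then have "?A = {}"
      using U(3) closure_subset[of U] by blast
    then show ?thesis
      by (auto simp: V_def)
  qed
  \<comment> \<open>One time is chosen for each of the finitely many patterns \<open>k t\<close>;
    off \<open>closure U\<close>, the image of \<open>D\<close> at that time contains all images
    with the same pattern.\<close>
  define rep where "rep v = (SOME t. t \<in> J \<and> k t = v)" for v
  have rep: "rep (k t) \<in> J" "k (rep (k t)) = k t" if "t \<in> J" for t
    using someI[of "\<lambda>s. s \<in> J \<and> k s = k t" t] that unfolding rep_def by auto
  have "finite (k ` J)"
    by (rule finite_subset[OF _ finite_Pow_iff[THEN iffD2, OF I(2)]]) (auto simp: k_def)
  then have "compact (closure U \<union> (\<Union>v\<in>k ` J. f (rep v) ` D))"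
    using E rep(1) U(2) by (intro compact_Un compact_UN) auto
  moreover have "f t ` D \<subseteq> closure U \<union> (\<Union>v\<in>k ` J. f (rep v) ` D)" if t: "t \<in> J" for t
  proof
    fix x assume x: "x \<in> f t ` D"
    show "x \<in> closure U \<union> (\<Union>v\<in>k ` J. f (rep v) ` D)"
    proof (cases "x \<in> closure U")
      case False
      then have "x \<in> V t - closure U"
        using x U(5) closure_subset[of U] by (auto simp: V_def)
      then have "x \<in> f (rep (k t)) ` D"
        using k_determines[OF t rep(1)[OF t]] rep(2)[OF t] unfolding V_def by auto
      then show ?thesis
        using t by blast
    qed simp
  qed
  ultimately show thesis
    by (rule that)
qed

lemma smooth_simplex_image_curve:
  "K \<in> smooth_simplex_images TYPE(real) \<A> \<Longrightarrow> K \<in> C1_curve_images \<A>"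
proof -
  assume "K \<in> smooth_simplex_images TYPE(real) \<A>"
  then obtain \<sigma> :: "real \<Rightarrow> 'a" and V where K: "K = \<sigma> ` (convex hull (insert 0 Basis))"
    and V: "open V" "convex hull (insert 0 Basis) \<subseteq> V" "continuous_on V \<sigma>"
    and sm: "\<And>c. c \<in> \<A> \<Longrightarrow> smooth_on (snd c \<circ> \<sigma>) (V \<inter> \<sigma> -` fst c)"
    unfolding smooth_simplex_images_def by blast
  have hull: "convex hull (insert 0 Basis) = {0..1::real}"
    using segment_convex_hull[of 0 "1::real"] by (simp add: closed_segment_eq_real_ivl)
  have "C1_curve \<A> 0 1 (\<sigma> \<circ> (\<lambda>s. s))"
  proof (rule C1_curve_compose(1)[OF _ V(1,3), where p'="\<lambda>_. 1"])
    show "C_on 1 (snd d \<circ> \<sigma>) (V \<inter> \<sigma> -` fst d)" if "d \<in> \<A>" for d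
      using sm[OF that] unfolding smooth_on_def by blast
    show "(\<lambda>s. s) ` {0..1} \<subseteq> V"
      using V(2) hull by simp
  qed (auto intro!: derivative_eq_intros simp flip: has_real_derivative_iff_has_vector_derivative)
  then have "C1_curve \<A> 0 1 \<sigma>"
    by (simp add: comp_def)
  then show ?thesis
    unfolding C1_curve_images_def K hull by (intro CollectI exI[of _ \<sigma>] exI[of _ "1::real"]) simp
qed

text \<open>\<open>K\<close> has to contain the rim \<open>D - D0\<close> but may enter
  \<open>D0\<close>, as it does in dimension one.\<close>

lemma disc_neighbourhood:
  fixes x :: 'a
  assumes "DIM('e) \<le> 2"
  obtains D D0 K where "compact D" "open D0" "D0 \<subseteq> D" "x \<in> D0" "K \<in> C1_curve_images \<A>" "D - D0 \<subseteq> K"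
proof -
  obtain c r where c: "c \<in> \<A>" "x \<in> fst c" "0 < r" "cball (snd c x) r \<subseteq> snd c ` (fst c \<inter> UNIV)"
    by (rule chart_neighbourhood[of UNIV x]) auto
  obtain b1 b2 :: 'e
    where b: "sphere 0 r \<subseteq> (\<lambda>s. (r * cos s) *\<^sub>R b1 + (r * sin s) *\<^sub>R b2) ` {0..2 * pi}"
      "\<And>s. norm ((r * cos s) *\<^sub>R b1 + (r * sin s) *\<^sub>R b2) \<le> r"
    by (rule sphere_subset_circle[OF assms c(3)]) (rule that)
  define p where "p s = snd c x + ((r * cos s) *\<^sub>R b1 + (r * sin s) *\<^sub>R b2)" for s
  have "p s \<in> cball (snd c x) r" for s
    using b(2)[of s] norm_minus_cancel[of "p s - snd c x"] by (simp add: p_def dist_norm)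
  then have "p ` {0..2 * pi} \<subseteq> snd c ` fst c"
    using c(4) by auto
  moreover have "(p has_vector_derivative (- r * sin s) *\<^sub>R b1 + (r * cos s) *\<^sub>R b2) (at s within {0..2 * pi})" for s
    unfolding p_def by (auto intro!: derivative_eq_intros simp: mult.commute)
  moreover have "continuous_on {0..2 * pi} (\<lambda>s. (- r * sin s) *\<^sub>R b1 + (r * cos s) *\<^sub>R b2)"
    by (intro continuous_intros)
  ultimately have C1: "C1_curve \<A> 0 (2 * pi) (chart_inv c \<circ> p)"
    by (intro C1_curve_chart(1)[OF _ c(1)]) auto
  show thesis
  proof (rule that)
    show "compact (chart_inv c ` cball (snd c x) r)" "open (chart_inv c ` ball (snd c x) r)"
      "chart_inv c ` ball (snd c x) r \<subseteq> chart_inv c ` cball (snd c x) r"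
      "x \<in> chart_inv c ` ball (snd c x) r"
      using chart_inv_ball[OF c] by (auto intro: image_mono)
    show "(chart_inv c \<circ> p) ` {0..2 * pi} \<in> C1_curve_images \<A>"
      unfolding C1_curve_images_def using C1
      by (intro CollectI exI[of _ "chart_inv c \<circ> p"] exI[of _ "2 * pi"]) simp
    show "chart_inv c ` cball (snd c x) r - chart_inv c ` ball (snd c x) r \<subseteq> (chart_inv c \<circ> p) ` {0..2 * pi}"
    proof
      fix z assume "z \<in> chart_inv c ` cball (snd c x) r - chart_inv c ` ball (snd c x) r"
      then obtain y where y: "z = chart_inv c y" "y \<in> cball (snd c x) r" "y \<notin> ball (snd c x) r"
        by blast
      then have "y - snd c x \<in> sphere 0 r"
        by (simp add: dist_norm norm_minus_commute)
      then obtain s where s: "s \<in> {0..2 * pi}" "y - snd c x = (r * cos s) *\<^sub>R b1 + (r * sin s) *\<^sub>R b2"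
        using b(1) by blast
      have "p s = y"
        unfolding p_def s(2)[symmetric] by simp
      then show "z \<in> (chart_inv c \<circ> p) ` {0..2 * pi}"
        using s(1) y(1) by (intro image_eqI[of _ _ s]) simp_all
    qed
  qed
qed

end

section \<open>From curves and discs to strong completeness\<close>

context flow_setting
begin

lemma disc_nonexplosive:
  assumes D: "compact D" "open D0" "D0 \<subseteq> D" "D - D0 \<subseteq> K"
    and K: "compact K" "K \<noteq> {}" "AE \<omega> in P. explosion_inf \<xi> K \<omega> = \<infinity>"
  shows "AE \<omega> in P. explosion_inf \<xi> D \<omega> = \<infinity>"
  \<comment> \<open>Here \<open>undefined\<close> is merely some point of the manifold, used as base
    point of the distance.\<close>
  using partial_flow_path[OF partial_flow] K(3) blowup_AE[OF D(1), of undefined]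
proof eventually_elim
  case (elim \<omega>)
  let ?f = "\<lambda>t x. F t x \<omega>" and ?\<zeta> = "\<lambda>x. \<xi> x \<omega>"
  show ?case
  proof (rule ccontr)
    assume fin: "explosion_inf \<xi> D \<omega> \<noteq> \<infinity>"
    have "0 < explosion_inf \<xi> D \<omega>"
      using flow_path_lifetime_inf[OF elim(1) D(1), of 0] flow_path_lifetime_pos[OF elim(1)]
      by (simp add: explosion_inf_def zero_ereal_def)
    then obtain T where T: "explosion_inf \<xi> D \<omega> = ereal T" "0 < T"
      using fin by (cases "explosion_inf \<xi> D \<omega>") auto
    have K_inf: "ereal t < \<xi> x \<omega>" if "x \<in> K" for t x
    proof -
      have "\<infinity> \<le> \<xi> x \<omega>"
        using elim(2) that unfolding explosion_inf_def by (metis INF_lower)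
      then show ?thesis
        by simp
    qed
    let ?Q = "(\<lambda>(t, x). F t x \<omega>) ` ({0..T} \<times> K)"
    have Q: "compact ?Q"
      using K_inf by (intro flow_path_compact_image[OF elim(1) K(1)])
    then obtain i where i: "\<And>j. i \<le> j \<Longrightarrow> ?Q \<subseteq> U j"
      by (rule exhaustion_compact[OF open_U closure_U U_cover]) (rule that)
    \<comment> \<open>A nonempty \<open>U i\<close> is what prevents the clopen set in
      \<open>flow_images_bounded\<close> from being the whole space.\<close>
    have "?Q \<noteq> {}"
      using K(2) T(2) by auto
    then have U_ne: "U i \<noteq> {}"
      using i[of i] by blast
    have D_less: "ereal t < \<xi> x \<omega>" if "t \<in> {0..<T}" "x \<in> D" for t x
    proof -
      have "ereal t < explosion_inf \<xi> D \<omega>"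
        using that(1) T(1) by simp
      then show ?thesis
        using that(2) unfolding explosion_inf_def by (rule less_INF_D)
    qed
    have in_Q: "?f t ` (D - D0) \<subseteq> ?Q" if "t \<in> {0..<T}" for t
    proof
      fix y assume "y \<in> ?f t ` (D - D0)"
      then obtain x where "y = F t x \<omega>" "x \<in> K"
        using D(4) by blast
      then show "y \<in> ?Q"
        using that by (intro image_eqI[of _ _ "(t, x)"]) auto
    qed
    obtain C where C: "compact C" "\<And>t. t \<in> {0..<T} \<Longrightarrow> ?f t ` D \<subseteq> C"
      by (rule flow_images_bounded[where J="{0..<T}", OF connected elim(1) D(1-3) open_U compact_closure_U U_ne Q i[OF order_refl]])
        (rule D_less, assumption+, simp, rule in_Q, assumption, rule that)
    obtain R where R: "\<And>z. z \<in> C \<Longrightarrow> \<exists>L\<in>path_lengths \<A> g undefined z. L \<le> R"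
      by (rule path_lengths_compact[OF connected C(1), where x=undefined]) (rule that)
    have "((\<lambda>t. SUP x\<in>D. ereal (riemannian_dist \<A> g undefined (F t x \<omega>))) \<longlongrightarrow> \<infinity>) (at_left T)"
      using elim(3) T(1) by simp
    then show False
    proof (rule not_tendsto_infinity_bounded[OF _ T(2)])
      fix t assume t: "0 \<le> t" "t < T"
      show "(SUP x\<in>D. ereal (riemannian_dist \<A> g undefined (F t x \<omega>))) \<le> ereal R"
      proof (rule SUP_least)
        fix x assume "x \<in> D"
        then have "F t x \<omega> \<in> C"
          using C(2)[of t] t by auto
        then show "ereal (riemannian_dist \<A> g undefined (F t x \<omega>)) \<le> ereal R"
          using R riemannian_dist_le by fastforce
      qed
    qed
  qed
qed

text \<open>Survival of single points leaves uncountably many null sets. Discs have interior,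
  countably many of their interiors cover the manifold, and so one null set serves for all
  points.\<close>

lemma nonexplosive_everywhere:
  assumes "DIM('e) \<le> 2" and curves: "\<And>K. K \<in> C1_curve_images \<A> \<Longrightarrow> AE \<omega> in P. explosion_inf \<xi> K \<omega> = \<infinity>"
  shows "AE \<omega> in P. \<forall>x. \<xi> x \<omega> = \<infinity>"
proof -
  define \<V> where "\<V> = {V. open V \<and> (AE \<omega> in P. \<forall>x\<in>V. \<xi> x \<omega> = \<infinity>)}"
  have cover: "\<exists>V\<in>\<V>. x \<in> V" for x
  proof -
    obtain D D0 K where D: "compact D" "open D0" "D0 \<subseteq> D" "x \<in> D0" "K \<in> C1_curve_images \<A>" "D - D0 \<subseteq> K"
      by (rule disc_neighbourhood[OF assms(1)])
    have "AE \<omega> in P. explosion_inf \<xi> D \<omega> = \<infinity>"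
      by (rule disc_nonexplosive[OF D(1-3,6) C1_curve_image_compact[OF D(5)]
            C1_curve_image_nonempty[OF D(5)] curves[OF D(5)]])
    then have "AE \<omega> in P. \<forall>x\<in>D0. \<xi> x \<omega> = \<infinity>"
    proof eventually_elim
      case (elim \<omega>)
      show ?case
      proof
        fix y assume "y \<in> D0"
        then have "explosion_inf \<xi> D \<omega> \<le> \<xi> y \<omega>"
          using D(3) unfolding explosion_inf_def by (intro INF_lower) blast
        then show "\<xi> y \<omega> = \<infinity>"
          using elim by simp
      qed
    qed
    then show ?thesis
      using D(2,4) unfolding \<V>_def by blast
  qed
  obtain \<V>' where \<V>': "\<V>' \<subseteq> \<V>" "countable \<V>'" "\<Union>\<V>' = \<Union>\<V>"
    by (rule Lindelof[of \<V>]) (auto simp: \<V>_def)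
  have "AE \<omega> in P. \<forall>V\<in>\<V>'. \<forall>x\<in>V. \<xi> x \<omega> = \<infinity>"
    using \<V>'(1) by (subst AE_ball_countable[OF \<V>'(2)]) (auto simp: \<V>_def)
  then show ?thesis
  proof eventually_elim
    case (elim \<omega>)
    show ?case
    proof
      fix x
      have "x \<in> \<Union>\<V>'"
        using cover[of x] \<V>'(3) by blast
      then show "\<xi> x \<omega> = \<infinity>"
        using elim by blast
    qed
  qed
qed

lemma strongly_completeI:
  assumes "AE \<omega> in P. \<forall>x. \<xi> x \<omega> = \<infinity>"
  shows "strongly_complete P F \<xi>"
proof -
  have "AE \<omega> in P. flow_path \<A> (\<lambda>t x. F t x \<omega>) (\<lambda>x. \<xi> x \<omega>) \<and> (\<forall>x. \<xi> x \<omega> = \<infinity>)"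
    using partial_flow_path[OF partial_flow] assms by eventually_elim simp
  then obtain N where N: "N \<in> null_sets P"
    "{\<omega> \<in> space P. \<not> (flow_path \<A> (\<lambda>t x. F t x \<omega>) (\<lambda>x. \<xi> x \<omega>) \<and> (\<forall>x. \<xi> x \<omega> = \<infinity>))} \<subseteq> N"
    unfolding eventually_ae_filter by blast
  \<comment> \<open>Continuity is demanded for every outcome, so on the null set the flow is
    replaced by the identity at all times.\<close>
  define H where "H t x \<omega> = (if \<omega> \<in> N then x else F t x \<omega>)" for t x \<omega>
  have "AE \<omega> in P. \<xi> x \<omega> = \<infinity> \<and> (\<forall>t\<ge>0. H t x \<omega> = F t x \<omega>)" for x
    using AE_not_in[OF N(1)] assms by eventually_elim (simp add: H_def)
  moreover have "continuous_on ({0..} \<times> UNIV) (\<lambda>(t, x). H t x \<omega>)" if \<omega>: "\<omega> \<in> space P" for \<omega>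
  proof (cases "\<omega> \<in> N")
    case True
    then show ?thesis
      by (simp add: H_def case_prod_unfold continuous_on_snd)
  next
    case False
    then have flow: "flow_path \<A> (\<lambda>t x. F t x \<omega>) (\<lambda>x. \<xi> x \<omega>)" and inf: "\<And>x. \<xi> x \<omega> = \<infinity>"
      using N(2) \<omega> by blast+
    have "{(t, x). 0 \<le> t \<and> ereal t < \<xi> x \<omega>} = {0..} \<times> UNIV"
      using inf by auto
    then show ?thesis
      using flow_path_continuous[OF flow] False by (simp add: H_def)
  qed
  ultimately show ?thesis
    unfolding strongly_complete_def by (intro exI[of _ H]) blast
qed

text \<open>Within a segment neighbourhood survival passes from any point to any other, so the set
  of surviving points is open and closed at once.\<close>

lemma points_nonexplosive:
  assumes "AE \<omega> in P. \<xi> xbar \<omega> = \<infinity>"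
    and curve: "\<And>K x. K \<in> C1_curve_images \<A> \<Longrightarrow> x \<in> K \<Longrightarrow> AE \<omega> in P. \<xi> x \<omega> = \<infinity> \<Longrightarrow>
      AE \<omega> in P. explosion_inf \<xi> K \<omega> = \<infinity>"
  shows "AE \<omega> in P. \<xi> x \<omega> = \<infinity>"
proof (rule connected_induction_simple[OF connected UNIV_I UNIV_I, of "\<lambda>x. AE \<omega> in P. \<xi> x \<omega> = \<infinity>"])
  show "AE \<omega> in P. \<xi> xbar \<omega> = \<infinity>"
    by fact
next
  fix u :: 'a
  obtain N M where N: "open N" "u \<in> N"
    "\<And>y z. y \<in> N \<Longrightarrow> z \<in> N \<Longrightarrow> \<exists>\<tau>. C1_curve \<A> 0 1 \<tau> \<and> \<tau> 0 = y \<and> \<tau> 1 = z \<and> curve_length \<A> g 0 1 \<tau> \<le> M"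
    by (rule segment_neighbourhood[where x=u]) (rule that)
  have step: "AE \<omega> in P. \<xi> z \<omega> = \<infinity>" if yz: "y \<in> N" "z \<in> N" "AE \<omega> in P. \<xi> y \<omega> = \<infinity>" for y z
  proof -
    obtain \<tau> where \<tau>: "C1_curve \<A> 0 1 \<tau>" "\<tau> 0 = y" "\<tau> 1 = z"
      using N(3)[OF yz(1,2)] by blast
    have K: "\<tau> ` {0..1} \<in> C1_curve_images \<A>"
      unfolding C1_curve_images_def using \<tau>(1) by (intro CollectI exI[of _ \<tau>] exI[of _ "1::real"]) simp
    have ends: "y \<in> \<tau> ` {0..1}" "z \<in> \<tau> ` {0..1}"
      using \<tau>(2,3) by (auto intro: image_eqI[of _ _ 0] image_eqI[of _ _ 1])
    have "AE \<omega> in P. explosion_inf \<xi> (\<tau> ` {0..1}) \<omega> = \<infinity>"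
      by (rule curve[OF K ends(1) yz(3)])
    then show ?thesis
    proof eventually_elim
      case (elim \<omega>)
      have "explosion_inf \<xi> (\<tau> ` {0..1}) \<omega> \<le> \<xi> z \<omega>"
        unfolding explosion_inf_def using ends(2) by (rule INF_lower)
      then show ?case
        using elim by simp
    qed
  qed
  show "\<exists>T. openin (top_of_set UNIV) T \<and> u \<in> T \<and>
      (\<forall>y\<in>T. \<forall>z\<in>T. (AE \<omega> in P. \<xi> y \<omega> = \<infinity>) \<longrightarrow> (AE \<omega> in P. \<xi> z \<omega> = \<infinity>))"
  proof (intro exI[of _ N] conjI ballI impI)
    show "openin (top_of_set UNIV) N"
      using N(1) by simp
  qed (rule N(2), rule step)
qed

end

theorem theorem5p2p4:
  fixes \<A> :: "('a::{t2_space,second_countable_topology}, 'e::euclidean_space) chart set"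
    and g :: "('a, 'e) metric"
    and P :: "'w measure"
    and \<F> :: "real \<Rightarrow> 'w measure"
    and B :: "real \<Rightarrow> 'w \<Rightarrow> real ^ 'm"
    and X :: "'a \<Rightarrow> real ^ 'm \<Rightarrow> ('a, 'e) tvec"
    and A :: "'a \<Rightarrow> ('a, 'e) tvec"
    and F :: "real \<Rightarrow> 'a \<Rightarrow> 'w \<Rightarrow> 'a"
    and \<xi> :: "'a \<Rightarrow> 'w \<Rightarrow> ereal"
    and U :: "nat \<Rightarrow> 'a set"
    and \<phi> :: "nat \<Rightarrow> 'a \<Rightarrow> real"
    and G :: "nat \<Rightarrow> real \<Rightarrow> 'a \<Rightarrow> 'w \<Rightarrow> 'a"
    and xbar :: 'a
  assumes "smooth_atlas \<A>" and "riemannian_metric \<A> g"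
    and "connected (UNIV :: 'a set)"
    and "Metric_space.mcomplete UNIV (riemannian_dist \<A> g)"
    and "prob_space P" and "usual_conditions P \<F>" and "brownian_motion P \<F> B"
    and "C2_diffusion_coeff \<A> X" and "C2_vector_field \<A> A"
    and "partial_flow \<A> g P \<F> B X A F \<xi>"
    and "localisation \<A> g P \<F> B X A F \<xi> U \<phi> G"
    and "AE \<omega> in P. \<xi> xbar \<omega> = \<infinity>"
    and "\<And>K t. K \<in> C1_curve_images \<A> \<Longrightarrow> 0 < t \<Longrightarrow>
      liminf (\<lambda>j. SUP x\<in>K. \<integral>\<^sup>+ \<omega>.
        tangent_map_norm \<A> g (\<lambda>y. F (real_of_ereal (exit_inf (U j) (G j) K \<omega>)) y \<omega>) x *
        indicator {\<omega>. exit_inf (U j) (G j) K \<omega> < ereal t} \<omega> \<partial>P) < \<infinity>"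
  shows "(\<forall>H\<in>C1_curve_images \<A>. AE \<omega> in P. explosion_inf \<xi> H \<omega> = \<infinity>) \<and>
    strongly_p_complete TYPE(real) \<A> P \<xi> \<and>
    (DIM('e) \<le> 2 \<longrightarrow> strongly_complete P F \<xi>)"
proof -
  interpret flow_setting \<A> g P \<F> B X A F \<xi> U \<phi> G
    using assms(1-6,10,11)
    by (simp add: flow_setting_def flow_setting_axioms_def riemannian_def riemannian_axioms_def atlas_def)
  have curve: "AE \<omega> in P. explosion_inf \<xi> K \<omega> = \<infinity>"
    if "K \<in> C1_curve_images \<A>" "x \<in> K" "AE \<omega> in P. \<xi> x \<omega> = \<infinity>" for K x
    using that by (rule curve_nonexplosive) (rule assms(13)[OF that(1)])
  have curves: "AE \<omega> in P. explosion_inf \<xi> K \<omega> = \<infinity>" if K: "K \<in> C1_curve_images \<A>" for K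
  proof -
    \<comment> \<open>Any point of \<open>K\<close> can play the surviving one, since survival has
      spread from \<open>xbar\<close> to the whole manifold.\<close>
    obtain x where x: "x \<in> K"
      using C1_curve_image_nonempty[OF K] by blast
    have "AE \<omega> in P. \<xi> x \<omega> = \<infinity>"
      using assms(12) by (rule points_nonexplosive) (rule curve)
    then show ?thesis
      by (rule curve[OF K x])
  qed
  moreover have "strongly_p_complete TYPE(real) \<A> P \<xi>"
    unfolding strongly_p_complete_def using curves smooth_simplex_image_curve by blast
  moreover have "strongly_complete P F \<xi>" if "DIM('e) \<le> 2"
    by (rule strongly_completeI[OF nonexplosive_everywhere[OF that curves]])
  ultimately show ?thesis
    by blast
qed

end
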